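(* For every $\varepsilon>0$, every $\lambda'>0$ and every positive integer $d'$ there exist an infinite family of integers $n'_k$ and a family of Grassmann posets $Y_k$ such that each $Y_k$ is a $[d',n'_k,(n'_k)^{\varepsilon},\lambda']$-poset.
   Context: All vector spaces are over $\mathbb{F}_2$. An $\ell$-dimensional Grassmann poset over $\mathbb{F}_2^n$ is a set $Y$ of subspaces of $\mathbb{F}_2^n$ such that (1) if $w\in Y$ and $w'\subseteq w$ is a subspace then $w'\in Y$, and (2) every maximal subspace in $Y$ has dimension $\ell$. $Y(i)$ denotes the $i$-dimensional subspaces in $Y$; the ambient space of $Y$ is the span of the vectors in the subspaces of $Y(1)$. $Y$ is measured by a probability distribution $\mu$ on $Y(\ell)$ with full support; a random flag $v_1\subsetneq\cdots\subsetneq v_\ell$ is obtained by sampling $v_\ell\sim\mu$ and then a uniformly random complete flag inside $v_\ell$. For $i\le \ell-2$ and $w\in Y(i)$, the link graph $Y_w$ has vertex set $\{v\in\mathbb{F}_2^n: \mathrm{span}(v)+w\in Y(i+1)\}$ and edges $\{v,v'\}$ with $\mathrm{span}(v,v')+w\in Y(i+2)$, weighted according to the random flag conditioned on $v_i=w$ (choose $v$ with $w+\mathrm{span}(v)=v_{i+1}$ and $v'$ with $w+\mathrm{span}(v,v')=v_{i+2}$ uniformly). For a weighted graph $G$, $\lambda(G)$ is the second largest absolute value of an eigenvalue of its random walk operator. $Y$ is a $\lambda$-expander if $\lambda(Y_w)\le\lambda$ for every $i\le\ell-2$ and $w\in Y(i)$. For integers $d,n,D$ and $\lambda>0$, a $[d,n,D,\lambda]$-poset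 is a $d$-dimensional Grassmann poset that is a $\lambda$-expander, whose ambient space is $\mathbb{F}_2^n$, and with $|Y(1)|\le 2^D$. *)

theory Defs
  imports "HOL-Probability.Probability" "HOL-Library.Function_Algebras"
    "HOL-Library.Set_Algebras" "HOL-Library.Z2" "HOL-Library.Multiset"
begin

definition fun_scale :: "'k::field \<Rightarrow> ('v \<Rightarrow> 'k) \<Rightarrow> 'v \<Rightarrow> 'k" where
  "fun_scale c f = (\<lambda>x. c * f x)"

text \<open>
  The pointwise vector space structure on functions is used both over the two-element
  field (vectors) and over the reals (functions on the vertices of a graph).
\<close>

global_interpretation fun_vs: vector_space fun_scale
  by unfold_locales (auto simp: fun_scale_def fun_eq_iff algebra_simps)


subsection \<open>Grassmann posets over the two-element field\<close>

text \<open>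
  Vectors are sequences over the field \<^typ>\<open>bit\<close>; the \<open>n\<close>-dimensional space consists of
  those vanishing from index \<open>n\<close> on, so that \<open>n\<close> may vary inside a statement.
\<close>

type_synonym f2vec = "nat \<Rightarrow> bit"

definition F2 :: "nat \<Rightarrow> f2vec set" where
  "F2 n = {v. \<forall>i\<ge>n. v i = 0}"

definition grassmann_poset :: "nat \<Rightarrow> nat \<Rightarrow> f2vec set set \<Rightarrow> bool" where
  "grassmann_poset l n Y \<longleftrightarrow>
     (\<forall>w\<in>Y. fun_vs.subspace w \<and> w \<subseteq> F2 n) \<and>
     (\<forall>w\<in>Y. \<forall>w'. fun_vs.subspace w' \<and> w' \<subseteq> w \<longrightarrow> w' \<in> Y) \<and>
     (\<forall>w\<in>Y. (\<forall>u\<in>Y. w \<subseteq> u \<longrightarrow> u = w) \<longrightarrow> fun_vs.dim w = l)"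

definition level :: "f2vec set set \<Rightarrow> nat \<Rightarrow> f2vec set set" where
  "level Y i = {w \<in> Y. fun_vs.dim w = i}"

definition ambient_space :: "f2vec set set \<Rightarrow> f2vec set" where
  "ambient_space Y = fun_vs.span (\<Union>(level Y 1))"

text \<open>
  Full support of the measure also forces the top level, hence the poset, to be nonempty.
\<close>

definition measured_grassmann_poset ::
  "nat \<Rightarrow> nat \<Rightarrow> f2vec set set \<Rightarrow> f2vec set pmf \<Rightarrow> bool" where
  "measured_grassmann_poset l n Y \<mu> \<longleftrightarrow> grassmann_poset l n Y \<and> set_pmf \<mu> = level Y l"


subsection \<open>Random flags\<close>

text \<open>
  A flag is stored as the list of its subspaces, starting with the zero space at index 0,
  so that the entry at index \<open>i\<close> has dimension \<open>i\<close>.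
\<close>

definition complete_flags :: "f2vec set \<Rightarrow> f2vec set list set" where
  "complete_flags v =
     {F. length F = Suc (fun_vs.dim v) \<and>
         (\<forall>i\<le>fun_vs.dim v. fun_vs.subspace (F ! i) \<and> fun_vs.dim (F ! i) = i) \<and>
         sorted_wrt (\<subset>) F \<and> last F = v}"

definition random_flag :: "f2vec set pmf \<Rightarrow> f2vec set list pmf" where
  "random_flag \<mu> = bind_pmf \<mu> (\<lambda>v. pmf_of_set (complete_flags v))"


subsection \<open>Weighted graphs and their second eigenvalue\<close>

text \<open>
  A weighted graph is given by a finite vertex set \<open>V\<close> and a nonnegative weight \<open>wt\<close> on
  two-element sets of vertices; the edges are the sets of positive weight.
\<close>

definition walk_operator :: "'v set \<Rightarrow> ('v set \<Rightarrow> real) \<Rightarrow> ('v \<Rightarrow> real) \<Rightarrow> 'v \<Rightarrow> real" where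
  "walk_operator V wt f v =
     (\<Sum>u\<in>V. wt {v, u} / (\<Sum>x\<in>V. wt {v, x}) * f u)"

text \<open>Functions on \<open>V\<close> are represented by functions vanishing outside \<open>V\<close>.\<close>

definition walk_eigenspace :: "'v set \<Rightarrow> ('v set \<Rightarrow> real) \<Rightarrow> real \<Rightarrow> ('v \<Rightarrow> real) set" where
  "walk_eigenspace V wt \<theta> =
     {f. (\<forall>v. v \<notin> V \<longrightarrow> f v = 0) \<and> (\<forall>v\<in>V. walk_operator V wt f v = \<theta> * f v)}"

text \<open>
  The walk operator is self-adjoint with respect to its stationary measure, so it is
  diagonalizable over the reals and geometric and algebraic multiplicities agree.
\<close>

definition walk_spectrum :: "'v set \<Rightarrow> ('v set \<Rightarrow> real) \<Rightarrow> real multiset" where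
  "walk_spectrum V wt =
     (\<Sum>\<theta> | walk_eigenspace V wt \<theta> \<noteq> {0}.
        replicate_mset (fun_vs.dim (walk_eigenspace V wt \<theta>)) \<theta>)"

text \<open>The absolute values are listed in decreasing order; index 1 is the second largest.\<close>

definition graph_lambda :: "'v set \<Rightarrow> ('v set \<Rightarrow> real) \<Rightarrow> real" where
  "graph_lambda V wt =
     rev (sorted_list_of_multiset (image_mset abs (walk_spectrum V wt))) ! 1"


subsection \<open>Link graphs and expansion\<close>

definition link_vertices :: "nat \<Rightarrow> f2vec set set \<Rightarrow> nat \<Rightarrow> f2vec set \<Rightarrow> f2vec set" where
  "link_vertices n Y i w = {v \<in> F2 n. fun_vs.span {v} + w \<in> level Y (i + 1)}"

text \<open>
  The distribution of the random edge of the link of \<open>w\<close>, where \<open>w\<close> has dimension \<open>i\<close>. When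
  \<open>\<mu>\<close> has support \<open>level Y l\<close>, its support consists of the sets \<open>{v, v'}\<close> with
  \<open>span {v, v'} + w \<in> level Y (i + 2)\<close>.
\<close>

definition link_edge_pmf :: "f2vec set pmf \<Rightarrow> nat \<Rightarrow> f2vec set \<Rightarrow> f2vec set pmf" where
  "link_edge_pmf \<mu> i w =
     bind_pmf (cond_pmf (random_flag \<mu>) {F. F ! i = w}) (\<lambda>F.
     bind_pmf (pmf_of_set {v. w + fun_vs.span {v} = F ! (i + 1)}) (\<lambda>v.
     bind_pmf (pmf_of_set {v'. w + fun_vs.span {v, v'} = F ! (i + 2)}) (\<lambda>v'.
     return_pmf {v, v'})))"

definition link_lambda ::
  "nat \<Rightarrow> f2vec set set \<Rightarrow> f2vec set pmf \<Rightarrow> nat \<Rightarrow> f2vec set \<Rightarrow> real" where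
  "link_lambda n Y \<mu> i w = graph_lambda (link_vertices n Y i w) (pmf (link_edge_pmf \<mu> i w))"

definition expander_poset ::
  "nat \<Rightarrow> nat \<Rightarrow> real \<Rightarrow> f2vec set set \<Rightarrow> f2vec set pmf \<Rightarrow> bool" where
  "expander_poset l n lam Y \<mu> \<longleftrightarrow>
     (\<forall>i. i + 2 \<le> l \<longrightarrow> (\<forall>w\<in>level Y i. link_lambda n Y \<mu> i w \<le> lam))"

text \<open>The size exponent \<open>D\<close> is real, since it is instantiated with real powers of \<open>n\<close>.\<close>

definition parameter_poset ::
  "nat \<Rightarrow> nat \<Rightarrow> real \<Rightarrow> real \<Rightarrow> f2vec set set \<Rightarrow> f2vec set pmf \<Rightarrow> bool" where
  "parameter_poset d n D lam Y \<mu> \<longleftrightarrow>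
     measured_grassmann_poset d n Y \<mu> \<and>
     expander_poset d n lam Y \<mu> \<and>
     ambient_space Y = F2 n \<and>
     real (card (level Y 1)) \<le> 2 powr D"

end

theory Submission
  imports Defs
begin

text \<open>
  A poset is encoded by a finite family of \<open>d\<close>-tuples of linearly independent vectors (frames) that
  is invariant under the action of \<open>GL\<^sub>d\<close> on tuples: the flag of a uniformly random frame is the
  random flag of the poset spanned by the frames, and the edges of a link are pairs of consecutive
  frame vectors conditioned on the span of the preceding ones.

  All bases of the \<open>m\<close>-dimensional space form an expanding family. From an expanding family of frames
  of size \<open>R = 2 ^ d * s\<close> one obtains an expanding family of frames of size \<open>d\<close> in the tensor square of
  the ambient space: label the indices by the subsets of \<open>{..<d}\<close>, each label being used \<open>s\<close> times; for
  independent frames \<open>p\<close> and \<open>q\<close> the new vector with index \<open>a\<close> is the sum of \<open>p\<^sub>k \<otimes> q\<^sub>k\<close> over the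
  indices \<open>k\<close> whose label contains \<open>a\<close>. The correlation of two new vectors is bounded by revealing the
  old vectors one at a time, and each step is controlled by the expansion of the old family. The
  ambient dimension is squared while the number of vectors is raised to a bounded power. After \<open>k\<close>
  steps the dimension is \<open>n = m ^ 2 ^ k\<close> with only \<open>2 ^ O(m)\<close> vectors, and \<open>m\<close> is at most
  any prescribed power of \<open>n\<close> for large \<open>k\<close>.
\<close>

section \<open>The second eigenvalue of a weighted graph\<close>

text \<open>The obstacle is that a link conditions on earlier new vectors, and this entangles all
  the old ones. A sum of tensors over an index set \<open>S\<close> is a matrix of rank
  \<open>card S\<close>: it determines the spans of its left and of its right vectors, but it is
  unchanged when an invertible matrix acts on the left tuple and the inverse transpose on the right
  one. Conditioning therefore leaves large groups of transvections alive. If a function of a new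
  vector is invariant under \<open>2 ^ s\<close> of them, while they move one old vector through
  nearly uncorrelated positions, Bessel's inequality makes its covariance with that old vector
  small. This is why each label occurs \<open>s\<close> times and why all subsets serve as labels,
  even those outside both sums: whenever an index is revealed, \<open>s\<close> other unrevealed
  indices must be indistinguishable from it for the conditioning. Equal multiplicities also let
  \<open>GL\<^sub>d\<close> act on the labels, which keeps the new family invariant. A step costs a
  square root and a factor \<open>R\<close>, so the recursion starts from much longer frames with a
  much smaller expansion constant.\<close>

lemma second_largest_le:
  fixes M' :: "real multiset"
  assumes "M' \<noteq> {#}" "\<And>x. x \<in># M' \<Longrightarrow> x \<le> lam" "lam \<le> a"
  shows "rev (sorted_list_of_multiset (add_mset a M')) ! 1 \<le> lam"
proof -
  define ys where "ys = sorted_list_of_multiset M'"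
  have ms: "mset ys = M'" "sorted ys" by (simp_all add: ys_def)
  have "sorted (ys @ [a])" using ms assms by (auto simp: sorted_append) (metis order_trans set_mset_mset)
  moreover have "mset (ys @ [a]) = add_mset a M'" using ms by simp
  ultimately have "sorted_list_of_multiset (add_mset a M') = ys @ [a]"
    by (metis sorted_list_of_multiset_mset sorted_sort_id)
  moreover have ne: "ys \<noteq> []" using ms assms by auto
  ultimately have "rev (sorted_list_of_multiset (add_mset a M')) ! 1 = rev ys ! 0" by simp
  also have "\<dots> \<in> set ys" using ne by (metis length_greater_0_conv length_rev nth_mem set_rev)
  finally show ?thesis using assms ms by (metis set_mset_mset)
qed

text \<open>\<open>N\<close> weighs ordered pairs and \<open>c\<close> absorbs the normalisation of
  \<open>wt\<close>. The hypothesis \<open>gap\<close> is a Rayleigh quotient bound on functions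
  whose degree-weighted mean vanishes; \<open>lam < 1\<close> makes the eigenvalue 1 simple, so that
  it takes exactly one place in the spectrum.\<close>

locale gap_graph =
  fixes V :: "'v set" and wt :: "'v set \<Rightarrow> real" and N :: "'v \<Rightarrow> 'v \<Rightarrow> real" and c lam :: real
  assumes fin: "finite V" and two: "\<exists>a\<in>V. \<exists>b\<in>V. a \<noteq> b" and c: "c > 0"
    and wt: "\<And>v u. v \<in> V \<Longrightarrow> u \<in> V \<Longrightarrow> wt {v, u} = c * N v u"
    and sym: "\<And>v u. v \<in> V \<Longrightarrow> u \<in> V \<Longrightarrow> N v u = N u v"
    and pos: "\<And>v. v \<in> V \<Longrightarrow> (\<Sum>u\<in>V. N v u) > 0"
    and gap: "\<And>f. (\<Sum>v\<in>V. (\<Sum>u\<in>V. N v u) * f v) = 0 \<Longrightarrow>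
      \<bar>\<Sum>v\<in>V. \<Sum>u\<in>V. N v u * (f v * f u)\<bar> \<le> lam * (\<Sum>v\<in>V. (\<Sum>u\<in>V. N v u) * (f v)\<^sup>2)"
    and lam: "lam < 1"
begin

definition D :: "'v \<Rightarrow> real" where "D v = (\<Sum>u\<in>V. N v u)"

definition ip :: "('v \<Rightarrow> real) \<Rightarrow> ('v \<Rightarrow> real) \<Rightarrow> real" where "ip f g = (\<Sum>v\<in>V. D v * (f v * g v))"

definition E :: "('v \<Rightarrow> real) \<Rightarrow> ('v \<Rightarrow> real) \<Rightarrow> real" where
  "E f g = (\<Sum>v\<in>V. \<Sum>u\<in>V. N v u * (f v * g u))"

definition mean0 :: "('v \<Rightarrow> real) \<Rightarrow> bool" where "mean0 f \<longleftrightarrow> (\<Sum>v\<in>V. D v * f v) = 0"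

abbreviation "ES \<equiv> walk_eigenspace V wt"

lemma D_pos: "v \<in> V \<Longrightarrow> D v > 0"
  using pos by (simp add: D_def)

lemma ip_nonneg: "ip f f \<ge> 0"
  unfolding ip_def using D_pos by (intro sum_nonneg) (auto simp: less_imp_le)

lemma ip_eq_0: "ip f f = 0 \<Longrightarrow> v \<in> V \<Longrightarrow> f v = 0"
proof -
  assume 0: "ip f f = 0" and v: "v \<in> V"
  have "\<forall>v\<in>V. D v * (f v * f v) = 0"
    using 0 fin D_pos unfolding ip_def by (subst (asm) sum_nonneg_eq_0_iff) (auto simp: less_imp_le)
  then show ?thesis using D_pos[OF v] v by auto
qed

lemma ip_commute: "ip f g = ip g f"
  by (simp add: ip_def mult.commute)

lemma E_commute: "E f g = E g f"
proof -
  have "E f g = (\<Sum>u\<in>V. \<Sum>v\<in>V. N v u * (f v * g u))" unfolding E_def by (rule sum.swap)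
  also have "\<dots> = E g f" unfolding E_def using sym by (intro sum.cong) auto
  finally show ?thesis .
qed

lemma gap': "mean0 f \<Longrightarrow> \<bar>E f f\<bar> \<le> lam * ip f f"
  using gap[of f] by (simp add: mean0_def E_def ip_def D_def power2_eq_square)

lemma walk: "v \<in> V \<Longrightarrow> D v * walk_operator V wt f v = (\<Sum>u\<in>V. N v u * f u)"
proof -
  assume v: "v \<in> V"
  have "(\<Sum>x\<in>V. wt {v, x}) = c * D v" using v by (simp add: wt D_def sum_distrib_left)
  then have "walk_operator V wt f v = (\<Sum>u\<in>V. (c * N v u) / (c * D v) * f u)"
    unfolding walk_operator_def using v wt by (simp cong: sum.cong)
  then show ?thesis using c D_pos[OF v] by (simp add: sum_distrib_left)
qed

text \<open>Since \<open>E\<close> is symmetric, this identity is the self-adjointness of the walk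
  operator for the degree-weighted inner product.\<close>

lemma E_walk: "E g f = ip g (walk_operator V wt f)"
proof -
  have "E g f = (\<Sum>v\<in>V. g v * (\<Sum>u\<in>V. N v u * f u))"
    unfolding E_def by (simp add: sum_distrib_left mult.left_commute)
  also have "\<dots> = ip g (walk_operator V wt f)"
    unfolding ip_def by (intro sum.cong) (auto simp: walk[symmetric])
  finally show ?thesis .
qed

lemma ES_E: "f \<in> ES \<theta> \<Longrightarrow> E g f = \<theta> * ip g f"
  unfolding E_walk ip_def walk_eigenspace_def by (simp add: sum_distrib_left mult.left_commute)

lemma ES_eq_0: "f \<in> ES \<theta> \<Longrightarrow> ip f f = 0 \<Longrightarrow> f = 0"
  using ip_eq_0[of f] by (auto simp: walk_eigenspace_def fun_eq_iff)

lemma mean_walk: "(\<Sum>v\<in>V. D v * walk_operator V wt f v) = (\<Sum>v\<in>V. D v * f v)"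
  using E_walk[of "\<lambda>_. 1" f] E_commute[of "\<lambda>_. 1" f]
  by (simp add: ip_def E_def D_def sum_distrib_right)

text \<open>The walk preserves the degree-weighted mean, so an eigenvalue other than 1 forces that
  mean to vanish.\<close>

lemma ES_mean0: assumes "f \<in> ES \<theta>" "\<theta> \<noteq> 1" shows "mean0 f"
proof -
  have "(\<Sum>v\<in>V. D v * f v) = (\<Sum>v\<in>V. D v * walk_operator V wt f v)" by (simp add: mean_walk)
  also have "\<dots> = \<theta> * (\<Sum>v\<in>V. D v * f v)"
    using assms by (simp add: walk_eigenspace_def sum_distrib_left mult.left_commute)
  finally show ?thesis using assms(2) by (simp add: mean0_def)
qed

lemma ES_bound: assumes "f \<in> ES \<theta>" "f \<noteq> 0" "mean0 f" shows "\<bar>\<theta>\<bar> \<le> lam"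
proof -
  have "ip f f \<noteq> 0" using ES_eq_0 assms by blast
  then have p: "ip f f > 0" using ip_nonneg[of f] by simp
  have "\<bar>\<theta>\<bar> * ip f f \<le> lam * ip f f" using gap'[OF assms(3)] ES_E[OF assms(1), of f] p by (simp add: abs_mult)
  then show ?thesis using p by simp
qed

definition oneV :: "'v \<Rightarrow> real" where "oneV v = (if v \<in> V then 1 else 0)"

lemma oneV_ES: "oneV \<in> ES 1"
proof -
  have "walk_operator V wt oneV v = 1" if v: "v \<in> V" for v
  proof -
    have "(\<Sum>u\<in>V. N v u * oneV u) = D v" unfolding D_def by (intro sum.cong) (auto simp: oneV_def)
    then show ?thesis using walk[OF v, of oneV] D_pos[OF v] by simp
  qed
  then show ?thesis by (simp add: walk_eigenspace_def oneV_def)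
qed

lemma oneV_neq_0: "oneV \<noteq> 0"
  using two by (auto simp: oneV_def fun_eq_iff)

lemma walk_linear: "walk_operator V wt (\<lambda>v. f v - m * g v) v = walk_operator V wt f v - m * walk_operator V wt g v"
  unfolding walk_operator_def sum_distrib_left sum_subtractf[symmetric]
  by (intro sum.cong) (auto simp: right_diff_distrib)

text \<open>Subtracting the mean from a fixed function leaves a fixed function of mean zero, which
  the gap with \<open>lam < 1\<close> forces to vanish.\<close>

lemma ES_1: "ES 1 = fun_vs.span {oneV}"
proof
  show "fun_vs.span {oneV} \<subseteq> ES 1"
  proof
    fix f assume "f \<in> fun_vs.span {oneV}"
    then obtain k where "f = fun_scale k oneV" by (auto simp: fun_vs.span_singleton)
    then have f: "f = (\<lambda>v. k * oneV v)" by (simp add: fun_scale_def)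
    have "walk_operator V wt f v = k * walk_operator V wt oneV v" for v
      unfolding f walk_operator_def by (simp add: sum_distrib_left algebra_simps)
    then show "f \<in> ES 1" using oneV_ES by (auto simp: f walk_eigenspace_def)
  qed
  show "ES 1 \<subseteq> fun_vs.span {oneV}"
  proof
    fix f assume f: "f \<in> ES 1"
    define m where "m = (\<Sum>v\<in>V. D v * f v) / (\<Sum>v\<in>V. D v)"
    have "V \<noteq> {}" using two by auto
    then have pD: "(\<Sum>v\<in>V. D v) > 0" using fin D_pos by (intro sum_pos) auto
    define g where "g = (\<lambda>v. f v - m * oneV v)"
    have g: "g \<in> ES 1" using f oneV_ES unfolding g_def walk_eigenspace_def by (auto simp: walk_linear)
    have "(\<Sum>v\<in>V. D v * g v) = (\<Sum>v\<in>V. D v * f v) - m * (\<Sum>v\<in>V. D v)"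
      by (simp add: g_def oneV_def algebra_simps sum_subtractf sum_distrib_left)
    then have "mean0 g" using pD by (simp add: mean0_def m_def)
    then have "g = 0" using ES_bound[OF g] lam by fastforce
    then have "f = fun_scale m oneV" by (simp add: g_def fun_eq_iff fun_scale_def)
    then show "f \<in> fun_vs.span {oneV}" by (auto simp: fun_vs.span_singleton)
  qed
qed

lemma ip_sum_left: "finite S \<Longrightarrow> ip (\<Sum>h\<in>S. fun_scale (u h) h) g = (\<Sum>h\<in>S. u h * ip h g)"
proof (induction S rule: finite_induct)
  case empty
  then show ?case by (simp add: ip_def)
next
  case (insert x S)
  have "ip (a + b) g = ip a g + ip b g" for a b by (simp add: ip_def algebra_simps sum.distrib)
  moreover have "ip (fun_scale k a) g = k * ip a g" for k a
    by (simp add: ip_def fun_scale_def sum_distrib_left algebra_simps)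
  ultimately show ?case using insert by (simp del: plus_fun_apply)
qed

lemma ES_in_span: "f \<in> ES \<theta> \<Longrightarrow> f \<in> fun_vs.span ((\<lambda>v x. if x = v then 1 else 0) ` V)"
proof -
  assume f: "f \<in> ES \<theta>"
  have "f = (\<Sum>v\<in>V. fun_scale (f v) (\<lambda>x. if x = v then 1 else 0))"
  proof
    fix x
    have sa: "(\<Sum>v\<in>A. h v) x = (\<Sum>v\<in>A. h v x)" for A and h :: "'v \<Rightarrow> 'v \<Rightarrow> real"
      by (induction A rule: infinite_finite_induct) auto
    have "(\<Sum>v\<in>V. fun_scale (f v) (\<lambda>x. if x = v then 1 else 0)) x = (\<Sum>v\<in>V. if x = v then f v else 0)"
      unfolding sa by (intro sum.cong) (auto simp: fun_scale_def)
    also have "\<dots> = f x" using f fin by (auto simp: walk_eigenspace_def)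
    finally show "f x = (\<Sum>v\<in>V. fun_scale (f v) (\<lambda>x. if x = v then 1 else 0)) x" by simp
  qed
  also have "\<dots> \<in> fun_vs.span ((\<lambda>v x. if x = v then 1 else 0) ` V)"
    by (intro fun_vs.span_sum fun_vs.span_scale fun_vs.span_base) auto
  finally show ?thesis .
qed

lemma ES_orthogonal: "f \<in> ES \<theta> \<Longrightarrow> g \<in> ES \<theta>' \<Longrightarrow> \<theta> \<noteq> \<theta>' \<Longrightarrow> ip f g = 0"
proof -
  assume f: "f \<in> ES \<theta>" and g: "g \<in> ES \<theta>'" and ne: "\<theta> \<noteq> \<theta>'"
  have "\<theta> * ip f g = \<theta>' * ip f g"
    using ES_E[OF f, of g] ES_E[OF g, of f] E_commute[of f g] ip_commute[of f g] by simp
  then show ?thesis using ne by simp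
qed

lemma zero_ES: "0 \<in> ES \<theta>"
  by (simp add: walk_eigenspace_def walk_operator_def)

text \<open>Eigenfunctions of distinct eigenvalues are orthogonal, hence independent in a
  finite-dimensional space. Over an infinite set the sum in \<open>walk_spectrum\<close> would
  collapse to its default value.\<close>

lemma finite_spectrum: "finite {\<theta>. ES \<theta> \<noteq> {0}}"
proof -
  have "\<forall>\<theta>\<in>{\<theta>. ES \<theta> \<noteq> {0}}. \<exists>f. f \<in> ES \<theta> \<and> f \<noteq> 0" using zero_ES by blast
  from bchoice[OF this] obtain F where F: "\<And>\<theta>. ES \<theta> \<noteq> {0} \<Longrightarrow> F \<theta> \<in> ES \<theta> \<and> F \<theta> \<noteq> 0" by auto
  define A where "A = F ` {\<theta>. ES \<theta> \<noteq> {0}}"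
  have inj: "inj_on F {\<theta>. ES \<theta> \<noteq> {0}}"
  proof (rule inj_onI)
    fix \<theta> \<theta>' assume h: "\<theta> \<in> {\<theta>. ES \<theta> \<noteq> {0}}" "\<theta>' \<in> {\<theta>. ES \<theta> \<noteq> {0}}" "F \<theta> = F \<theta>'"
    show "\<theta> = \<theta>'"
    proof (rule ccontr)
      assume "\<theta> \<noteq> \<theta>'"
      have FF: "F \<theta> \<in> ES \<theta>" "F \<theta> \<in> ES \<theta>'" "F \<theta> \<noteq> 0" using F[of \<theta>] F[of \<theta>'] h by auto
      show False using ES_eq_0[OF FF(1) ES_orthogonal[OF FF(1,2) \<open>\<theta> \<noteq> \<theta>'\<close>]] FF(3) by blast
    qed
  qed
  have "fun_vs.independent A"
    unfolding fun_vs.independent_explicit_finite_subsets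
  proof (intro allI impI ballI)
    fix S u g assume S: "S \<subseteq> A" "finite S" "(\<Sum>h\<in>S. fun_scale (u h) h) = 0" "g \<in> S"
    have "g \<in> A" using S(1,4) by blast
    then obtain \<theta> where \<theta>: "ES \<theta> \<noteq> {0}" "g = F \<theta>" unfolding A_def by blast
    have z: "ip h g = 0" if "h \<in> S - {g}" for h
    proof -
      have "h \<in> A" using S(1) that by blast
      then obtain \<theta>' where \<theta>': "ES \<theta>' \<noteq> {0}" "h = F \<theta>'" unfolding A_def by blast
      then have "\<theta>' \<noteq> \<theta>" using that \<theta> by blast
      then show ?thesis using ES_orthogonal[of h \<theta>' g \<theta>] F[OF \<theta>(1)] F[OF \<theta>'(1)] \<theta>(2) \<theta>'(2) by simp
    qed
    have "0 = ip (\<Sum>h\<in>S. fun_scale (u h) h) g" by (simp add: S(3) ip_def)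
    also have "\<dots> = (\<Sum>h\<in>S. u h * ip h g)" by (rule ip_sum_left[OF S(2)])
    also have "\<dots> = u g * ip g g" using S z by (subst sum.remove[of S g]) auto
    finally have "u g = 0 \<or> ip g g = 0" by simp
    then show "u g = 0" using ES_eq_0[of g \<theta>] F[OF \<theta>(1)] \<theta>(2) by auto
  qed
  moreover have "A \<subseteq> fun_vs.span ((\<lambda>v x. if x = v then 1 else 0) ` V)"
    using ES_in_span F unfolding A_def by blast
  ultimately have "finite A"
    using fun_vs.independent_span_bound[of "(\<lambda>v x. if x = v then 1 else 0) ` V" A] fin by blast
  then show ?thesis unfolding A_def using inj finite_imageD by blast
qed

text \<open>The dimension is a cardinality, which an infinite basis would turn into 0; finiteness of
  the basis ensures that every eigenvalue appears in the spectrum with positive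
  multiplicity.\<close>

lemma dim_ES_pos: assumes "ES \<theta> \<noteq> {0}" shows "fun_vs.dim (ES \<theta>) > 0"
proof -
  obtain B where B: "B \<subseteq> ES \<theta>" "fun_vs.independent B" "ES \<theta> \<subseteq> fun_vs.span B" "card B = fun_vs.dim (ES \<theta>)"
    using fun_vs.basis_exists by blast
  have "B \<subseteq> fun_vs.span ((\<lambda>v x. if x = v then 1 else 0) ` V)" using B ES_in_span by blast
  then have "finite B"
    using fun_vs.independent_span_bound[of "(\<lambda>v x. if x = v then 1 else 0) ` V" B] fin B by blast
  moreover have "B \<noteq> {}" using B(3) assms zero_ES by auto
  ultimately show ?thesis using B(4) by (metis card_gt_0_iff)
qed

text \<open>The first-order condition at an extremum: a quadratic without constant term that is
  never negative has no linear term.\<close>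

lemma quadratic_nonneg_imp_0:
  fixes b k :: real
  assumes "\<And>t. 2 * t * b + t\<^sup>2 * k \<ge> 0" "k \<ge> 0"
  shows "b = 0"
proof -
  define u where "u = b / (k + 1)"
  have b: "b = u * (k + 1)" using assms(2) by (simp add: u_def)
  have "2 * (- u) * b + (- u)\<^sup>2 * k \<ge> 0" by (rule assms(1))
  also have "2 * (- u) * b + (- u)\<^sup>2 * k = - (u\<^sup>2 * (k + 2))"
    unfolding b by (simp add: algebra_simps power2_eq_square)
  finally have "u\<^sup>2 * (k + 2) \<le> 0" by simp
  then have "u = 0" using assms(2) by (simp add: mult_le_0_iff)
  then show ?thesis using b by simp
qed

text \<open>Functions live on the whole type, so compactness comes from the product topology with
  the factor \<open>{0}\<close> outside \<open>V\<close>. Inside, the norm bounds the square of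
  \<open>f v\<close> by \<open>1 / D v\<close>, and adding 1 turns this into a bound for
  \<open>f v\<close> itself.\<close>

lemma compact_sphere:
  "compact {f. (\<forall>v. v \<notin> V \<longrightarrow> f v = 0) \<and> mean0 f \<and> ip f f = 1}"
proof -
  define J where "J v = (if v \<in> V then {- (1 / D v + 1) .. 1 / D v + 1} else {0::real})" for v
  have "compactin (product_topology (\<lambda>_. euclidean) UNIV) (PiE UNIV J)"
    unfolding compactin_PiE by (auto simp: J_def)
  then have comp: "compact (PiE UNIV J)" by (simp add: euclidean_product_topology)
  have "closed {f. mean0 f}" unfolding mean0_def
    by (intro closed_Collect_eq continuous_intros continuous_on_product_coordinates)
  moreover have "closed {f. ip f f = 1}" unfolding ip_def
    by (intro closed_Collect_eq continuous_intros continuous_on_product_coordinates)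
  ultimately have "compact (PiE UNIV J \<inter> ({f. mean0 f} \<inter> {f. ip f f = 1}))"
    by (intro compact_Int_closed comp closed_Int)
  moreover have "{f. (\<forall>v. v \<notin> V \<longrightarrow> f v = 0) \<and> mean0 f \<and> ip f f = 1} = PiE UNIV J \<inter> ({f. mean0 f} \<inter> {f. ip f f = 1})"
  proof (intro equalityI subsetI)
    fix f assume f: "f \<in> {f. (\<forall>v. v \<notin> V \<longrightarrow> f v = 0) \<and> mean0 f \<and> ip f f = 1}"
    have "f v \<in> J v" for v
    proof (cases "v \<in> V")
      case True
      have "D v * (f v * f v) \<le> ip f f"
        unfolding ip_def using fin True D_pos by (intro member_le_sum) (auto simp: less_imp_le)
      then have "f v * f v \<le> 1 / D v" using f D_pos[OF True] by (simp add: field_simps)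
      then have "\<bar>f v\<bar>\<^sup>2 \<le> 1 / D v" by (simp add: power2_eq_square)
      moreover have "\<bar>f v\<bar> \<le> \<bar>f v\<bar>\<^sup>2 + 1"
        by (smt (verit) power2_eq_square mult_left_mono mult_nonneg_nonneg zero_le_power2 mult_cancel_left2)
      ultimately show ?thesis using True by (auto simp: J_def abs_le_iff)
    next
      case False
      then show ?thesis using f by (simp add: J_def)
    qed
    then show "f \<in> PiE UNIV J \<inter> ({f. mean0 f} \<inter> {f. ip f f = 1})" using f by auto
  next
    fix f assume f: "f \<in> PiE UNIV J \<inter> ({f. mean0 f} \<inter> {f. ip f f = 1})"
    have "f v = 0" if "v \<notin> V" for v
    proof -
      have "f v \<in> J v" using f by auto
      then show ?thesis using that by (simp add: J_def)
    qed
    then show "f \<in> {f. (\<forall>v. v \<notin> V \<longrightarrow> f v = 0) \<and> mean0 f \<and> ip f f = 1}" using f by auto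
  qed
  ultimately show ?thesis by simp
qed

text \<open>The entry at index 1 of the list of eigenvalues is meaningful only if there is a second
  eigenvalue. A maximiser of the Rayleigh quotient on the unit sphere of mean-zero functions
  provides it.\<close>

lemma exists_mean0_eigenfunction:
  obtains f \<theta> where "f \<in> ES \<theta>" "f \<noteq> 0" "mean0 f"
proof -
  define S where "S = {f. (\<forall>v. v \<notin> V \<longrightarrow> f v = 0) \<and> mean0 f \<and> ip f f = 1}"
  have scale: "\<exists>k. k \<noteq> 0 \<and> (\<lambda>v. k * g v) \<in> S" if g: "\<forall>v. v \<notin> V \<longrightarrow> g v = 0" "mean0 g" "ip g g \<noteq> 0" for g
  proof -
    have p: "ip g g > 0" using g ip_nonneg[of g] by simp
    let ?k = "1 / sqrt (ip g g)"
    have "ip (\<lambda>v. k * g v) (\<lambda>v. k * g v) = (k * k) * ip g g" for k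
      by (simp add: ip_def sum_distrib_left algebra_simps)
    then have "ip (\<lambda>v. ?k * g v) (\<lambda>v. ?k * g v) = (?k * ?k) * ip g g" .
    also have "\<dots> = 1" using p by (simp add: real_sqrt_mult_self)
    finally have "ip (\<lambda>v. ?k * g v) (\<lambda>v. ?k * g v) = 1" .
    moreover have "mean0 (\<lambda>v. ?k * g v)"
    proof -
      have "(\<Sum>v\<in>V. D v * (?k * g v)) = ?k * (\<Sum>v\<in>V. D v * g v)"
        unfolding sum_distrib_left by (intro sum.cong) (auto simp: mult.left_commute)
      then show ?thesis using g(2) by (simp add: mean0_def)
    qed
    ultimately have "(\<lambda>v. ?k * g v) \<in> S" using g(1) by (simp add: S_def)
    then show ?thesis using p by (intro exI[of _ ?k]) auto
  qed
  obtain a b where ab: "a \<in> V" "b \<in> V" "a \<noteq> b" using two by blast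
  \<comment> \<open>Two vertices with opposite weights inverse to their degrees give a nonzero
    function of mean zero, so the sphere is not empty.\<close>
  define g0 where "g0 v = (if v = a then 1 / D a else 0) - (if v = b then 1 / D b else 0)" for v
  have "(\<Sum>v\<in>V. D v * g0 v) = (\<Sum>v\<in>V. (if v = a then 1 else 0) - (if v = b then 1 else 0))"
    using D_pos[OF ab(1)] D_pos[OF ab(2)] by (intro sum.cong) (auto simp: g0_def)
  then have g0m: "mean0 g0" using ab fin by (simp add: mean0_def sum_subtractf)
  have "g0 a \<noteq> 0" using ab D_pos[OF ab(1)] by (simp add: g0_def)
  then have "ip g0 g0 \<noteq> 0" using ip_eq_0 ab by blast
  moreover have "\<forall>v. v \<notin> V \<longrightarrow> g0 v = 0" using ab by (auto simp: g0_def)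
  ultimately have Sne: "S \<noteq> {}" using scale[of g0] g0m by blast
  have Scomp: "compact S" unfolding S_def by (rule compact_sphere)
  have Scont: "continuous_on S (\<lambda>f. E f f)" unfolding E_def
    by (intro continuous_intros continuous_on_subset[OF continuous_on_product_coordinates]) auto
  from continuous_attains_sup[OF Scomp Sne Scont] obtain f where f: "f \<in> S" "\<forall>g\<in>S. E g g \<le> E f f"
    by blast
  define M where "M = E f f"
  have fS: "\<forall>v. v \<notin> V \<longrightarrow> f v = 0" "mean0 f" "ip f f = 1" using f(1) by (auto simp: S_def)
  have q: "E g g \<le> M * ip g g" if g: "\<forall>v. v \<notin> V \<longrightarrow> g v = 0" "mean0 g" for g
  proof (cases "ip g g = 0")
    case True
    then have "\<And>v. v \<in> V \<Longrightarrow> g v = 0" using ip_eq_0 by blast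
    then have "E g g = 0" by (simp add: E_def)
    then show ?thesis using True by simp
  next
    case False
    then obtain k where k: "k \<noteq> 0" "(\<lambda>v. k * g v) \<in> S" using scale g by blast
    have "E (\<lambda>v. k * g v) (\<lambda>v. k * g v) = k\<^sup>2 * E g g"
      by (simp add: E_def sum_distrib_left power2_eq_square algebra_simps)
    moreover have "ip (\<lambda>v. k * g v) (\<lambda>v. k * g v) = k\<^sup>2 * ip g g"
      by (simp add: ip_def sum_distrib_left power2_eq_square algebra_simps)
    moreover have "ip (\<lambda>v. k * g v) (\<lambda>v. k * g v) = 1" using k by (simp add: S_def)
    moreover have "E (\<lambda>v. k * g v) (\<lambda>v. k * g v) \<le> M" using bspec[OF f(2) k(2)] by (simp add: M_def)
    ultimately have "k\<^sup>2 * E g g \<le> k\<^sup>2 * (M * ip g g)" by (simp add: algebra_simps)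
    then show ?thesis using k(1) by (simp add: mult_le_cancel_left)
  qed
  have B0: "M * ip f g = E f g" if g: "\<forall>v. v \<notin> V \<longrightarrow> g v = 0" "mean0 g" for g
  proof -
    have "M * ip f g - E f g = 0"
    proof (rule quadratic_nonneg_imp_0)
      show "M * ip g g - E g g \<ge> 0" using q[OF g] by simp
      fix t
      have ipx: "ip (\<lambda>v. f v + t * g v) (\<lambda>v. f v + t * g v) = ip f f + 2 * t * ip f g + t\<^sup>2 * ip g g"
        by (simp add: ip_def sum_distrib_left power2_eq_square algebra_simps sum.distrib)
      have "E (\<lambda>v. f v + t * g v) (\<lambda>v. f v + t * g v) = E f f + t * E f g + t * E g f + t\<^sup>2 * E g g"
        by (simp add: E_def sum_distrib_left power2_eq_square algebra_simps sum.distrib)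
      then have Ex: "E (\<lambda>v. f v + t * g v) (\<lambda>v. f v + t * g v) = E f f + 2 * t * E f g + t\<^sup>2 * E g g"
        using E_commute[of f g] by simp
      have "mean0 (\<lambda>v. f v + t * g v)"
        using fS(2) g(2) by (simp add: mean0_def algebra_simps sum.distrib flip: sum_distrib_left)
      then have "E (\<lambda>v. f v + t * g v) (\<lambda>v. f v + t * g v) \<le> M * ip (\<lambda>v. f v + t * g v) (\<lambda>v. f v + t * g v)"
        using fS(1) g(1) by (intro q) auto
      then show "2 * t * (M * ip f g - E f g) + t\<^sup>2 * (M * ip g g - E g g) \<ge> 0"
        unfolding ipx Ex using fS(3) by (simp add: M_def algebra_simps)
    qed
    then show ?thesis by simp
  qed
  \<comment> \<open>\<open>h\<close> is the residual of the eigenvalue equation. It has mean zero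
    itself, so the first-order condition \<open>B0\<close> can be tested on it and gives
    \<open>ip h h = 0\<close>.\<close>
  define h where "h v = (if v \<in> V then walk_operator V wt f v - M * f v else 0)" for v
  have "(\<Sum>v\<in>V. D v * h v) = (\<Sum>v\<in>V. D v * walk_operator V wt f v) - M * (\<Sum>v\<in>V. D v * f v)"
    by (simp add: h_def algebra_simps sum_subtractf sum_distrib_left)
  then have hm: "mean0 h" using fS(2) by (simp add: mean_walk mean0_def)
  have "ip h h = ip h (walk_operator V wt f) - M * ip h f"
    by (simp add: ip_def h_def algebra_simps sum_subtractf sum_distrib_left sum.distrib)
  also have "\<dots> = 0" using B0[of h] hm E_walk[of h f] E_commute[of h f] ip_commute[of h f] by (simp add: h_def)
  finally have "\<And>v. v \<in> V \<Longrightarrow> h v = 0" using ip_eq_0 by blast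
  then have "f \<in> ES M" using fS(1) by (auto simp: walk_eigenspace_def h_def)
  moreover have "f \<noteq> 0" using fS(3) by (auto simp: ip_def)
  ultimately show ?thesis using that fS(2) by blast
qed

text \<open>After one copy of 1 is split off, every remaining eigenvalue is at most
  \<open>lam\<close> in absolute value and at least one remains, so index 1 points to one of
  them.\<close>

theorem graph_lambda_le: "graph_lambda V wt \<le> lam"
proof -
  define \<Theta> where "\<Theta> = {\<theta>. ES \<theta> \<noteq> {0}}"
  have fin\<Theta>: "finite \<Theta>" unfolding \<Theta>_def by (rule finite_spectrum)
  have one: "1 \<in> \<Theta>" using oneV_ES oneV_neq_0 by (auto simp: \<Theta>_def)
  define M' where "M' = (\<Sum>\<theta>\<in>\<Theta> - {1}. replicate_mset (fun_vs.dim (ES \<theta>)) \<theta>)"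
  have "fun_vs.independent {oneV}" using oneV_neq_0 by simp
  then have dim1: "fun_vs.dim (ES 1) = 1"
    unfolding ES_1 by (subst fun_vs.dim_span_eq_card_independent) auto
  have "walk_spectrum V wt = add_mset 1 M'"
    unfolding walk_spectrum_def M'_def \<Theta>_def[symmetric]
    by (subst sum.remove[OF fin\<Theta> one]) (simp add: dim1)
  then have sp: "image_mset abs (walk_spectrum V wt) = add_mset 1 (image_mset abs M')" by simp
  have memM: "x \<in># M' \<longleftrightarrow> x \<in> \<Theta> - {1}" for x
    unfolding M'_def using fin\<Theta> dim_ES_pos by (auto simp: set_mset_sum \<Theta>_def)
  have bound: "\<bar>\<theta>\<bar> \<le> lam" if \<theta>: "\<theta> \<in> \<Theta> - {1}" for \<theta>
  proof -
    obtain f where "f \<in> ES \<theta>" "f \<noteq> 0" using \<theta> zero_ES by (auto simp: \<Theta>_def)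
    then show ?thesis using ES_bound ES_mean0 \<theta> by blast
  qed
  obtain f \<theta> where f: "f \<in> ES \<theta>" "f \<noteq> 0" "mean0 f" by (rule exists_mean0_eigenfunction)
  have "\<bar>\<theta>\<bar> \<le> lam" using ES_bound[OF f] .
  then have "\<theta> \<noteq> 1" using lam by auto
  then have "\<theta> \<in># M'" using f by (auto simp: memM \<Theta>_def)
  then have ne: "image_mset abs M' \<noteq> {#}" by auto
  show ?thesis unfolding graph_lambda_def sp
    by (rule second_largest_le[OF ne]) (use memM bound lam in auto)
qed

end

section \<open>Linear algebra over the two-element field\<close>

declare add_bit_eq_xor [simp del] mult_bit_eq_and [simp del]

lemma bit_add_self [simp]: "(b::bit) + b = 0"
  by (cases b) simp_all

lemma f2_add_self [simp]: "(v::f2vec) + v = 0"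
  by (simp add: fun_eq_iff)

lemma f2_minus [simp]: "(v::f2vec) - w = v + w"
  by (simp add: fun_eq_iff)

lemma f2_add_left_self [simp]: "(v::f2vec) + (v + w) = w"
  by (simp flip: add.assoc)

lemma f2_add_eq_0_iff: "(v::f2vec) + w = 0 \<longleftrightarrow> v = w"
  by (metis f2_add_left_self f2_add_self add.right_neutral)

lemma fun_scale_bit [simp]: "fun_scale (0::bit) v = 0" "fun_scale (1::bit) v = v"
  by (simp_all add: fun_scale_def fun_eq_iff)

lemma sum_fun_apply: "(\<Sum>k\<in>A. f k) x = (\<Sum>k\<in>A. f k x)" for f :: "'a \<Rightarrow> 'b \<Rightarrow> 'c::comm_monoid_add"
  by (induction A rule: infinite_finite_induct) auto

lemma f2_subspace_iff:
  "fun_vs.subspace (W :: f2vec set) \<longleftrightarrow> 0 \<in> W \<and> (\<forall>x\<in>W. \<forall>y\<in>W. x + y \<in> W)"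
proof -
  have "fun_scale c x \<in> W" if "0 \<in> W" "x \<in> W" for c :: bit and x
    using that by (cases c) auto
  then show ?thesis unfolding fun_vs.subspace_def by auto
qed

definition unitv :: "nat \<Rightarrow> f2vec" where "unitv k = (\<lambda>i. if i = k then 1 else 0)"

definition chi :: "nat set \<Rightarrow> f2vec" where "chi D = (\<lambda>k. if k \<in> D then 1 else 0)"

lemma chi_empty [simp]: "chi {} = 0"
  by (simp add: chi_def fun_eq_iff)

lemma chi_singleton [simp]: "chi {k} = unitv k"
  by (auto simp: chi_def unitv_def fun_eq_iff)

lemma chi_inject [simp]: "chi A = chi B \<longleftrightarrow> A = B"
  by (metis (mono_tags, lifting) bit_not_zero_iff chi_def set_eqI zero_neq_one)

lemma F2_chi: "c \<in> F2 R \<longleftrightarrow> (\<exists>D\<subseteq>{..<R}. c = chi D)"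
proof
  assume "c \<in> F2 R"
  moreover have "c = chi {k. c k = 1}"
    by (auto simp: chi_def fun_eq_iff)
  ultimately show "\<exists>D\<subseteq>{..<R}. c = chi D"
    by (intro exI[of _ "{k. c k = 1}"]) (auto simp: F2_def, metis not_le zero_neq_one)
qed (auto simp: F2_def chi_def subset_iff)

lemma chi_in_F2 [simp]: "chi D \<in> F2 R \<longleftrightarrow> D \<subseteq> {..<R}"
  by (auto simp: F2_def chi_def subset_iff not_le)

lemma F2_eq_image: "F2 R = chi ` Pow {..<R}"
  using F2_chi by auto

lemma finite_F2 [simp]: "finite (F2 R)"
  by (simp add: F2_eq_image)

lemma card_F2: "card (F2 R) = 2 ^ R"
proof -
  have "inj_on chi (Pow {..<R})" by (auto simp: inj_on_def)
  then show ?thesis by (simp add: F2_eq_image card_image card_Pow)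
qed

lemma zero_in_F2 [simp]: "0 \<in> F2 R"
  by (simp add: F2_def)

lemma F2_add [simp]: "x \<in> F2 R \<Longrightarrow> y \<in> F2 R \<Longrightarrow> x + y \<in> F2 R"
  by (simp add: F2_def)

lemma subspace_F2 [simp]: "fun_vs.subspace (F2 R)"
  by (simp add: f2_subspace_iff)

lemma F2_mono: "k \<le> R \<Longrightarrow> F2 k \<subseteq> F2 R"
  by (auto simp: F2_def)

lemma unitv_in_F2 [simp]: "unitv k \<in> F2 R \<longleftrightarrow> k < R"
  by (auto simp: F2_def unitv_def not_le)

lemma F2_0 [simp]: "F2 0 = {0}"
  by (auto simp: F2_def)

lemma F2_Suc_cases:
  assumes "c \<in> F2 (Suc k)"
  obtains "c \<in> F2 k" | c' where "c' \<in> F2 k" "c = c' + unitv k"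
proof (cases "c k")
  case zero
  have "c i = 0" if "i \<ge> k" for i
    using assms zero that by (cases "i = k") (auto simp: F2_def)
  then have "c \<in> F2 k" by (simp add: F2_def)
  then show ?thesis using that by blast
next
  case one
  have "(c + unitv k) i = 0" if "i \<ge> k" for i
    using assms one that by (cases "i = k") (auto simp: F2_def unitv_def)
  then have "c + unitv k \<in> F2 k" by (simp add: F2_def)
  moreover have "c = (c + unitv k) + unitv k" by (simp add: add.assoc)
  ultimately show ?thesis using that by blast
qed

text \<open>Coefficients are vectors of \<open>F2 R\<close>, so a matrix acting on tuples is itself
  a tuple \<open>b\<close> with entries in \<open>F2 R\<close>, and composition of actions is
  \<open>lincomb_lincomb\<close>.\<close>

definition lincomb :: "nat \<Rightarrow> (nat \<Rightarrow> f2vec) \<Rightarrow> f2vec \<Rightarrow> f2vec" where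
  "lincomb R v c = (\<Sum>k<R. fun_scale (c k) (v k))"

lemma lincomb_0 [simp]: "lincomb R v 0 = 0"
  by (simp add: lincomb_def)

lemma lincomb_add: "lincomb R v (c + c') = lincomb R v c + lincomb R v c'"
  by (simp add: lincomb_def fun_vs.scale_left_distrib sum.distrib)

lemma lincomb_chi: "D \<subseteq> {..<R} \<Longrightarrow> lincomb R v (chi D) = (\<Sum>k\<in>D. v k)"
proof -
  assume D: "D \<subseteq> {..<R}"
  have "lincomb R v (chi D) = (\<Sum>k<R. if k \<in> D then v k else 0)"
    unfolding lincomb_def by (intro sum.cong) (auto simp: chi_def)
  also have "\<dots> = (\<Sum>k\<in>D. v k)"
    using D by (simp flip: sum.inter_restrict add: Int_absorb1)
  finally show ?thesis .
qed

lemma lincomb_unitv [simp]: "k < R \<Longrightarrow> lincomb R v (unitv k) = v k"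
  using lincomb_chi[of "{k}" R v] by simp

lemma lincomb_cong: "(\<And>k. k < R \<Longrightarrow> v k = v' k) \<Longrightarrow> lincomb R v c = lincomb R v' c"
  by (simp add: lincomb_def)

lemma sum_unitv: "finite D \<Longrightarrow> (\<Sum>k\<in>D. unitv k) = chi D"
  by (induction D rule: finite_induct) (auto simp: fun_eq_iff chi_def unitv_def)

lemma lincomb_unitv_id: "c \<in> F2 R \<Longrightarrow> lincomb R unitv c = c"
  by (auto simp: F2_chi lincomb_chi sum_unitv finite_subset)

lemma lincomb_F2: "c \<in> F2 k \<Longrightarrow> k \<le> R \<Longrightarrow> lincomb R v c = lincomb k v c"
  unfolding lincomb_def by (rule sum.mono_neutral_right) (auto simp: F2_def)

lemma subspace_sum_in: 
  "fun_vs.subspace (W::f2vec set) \<Longrightarrow> (\<And>k. k \<in> A \<Longrightarrow> f k \<in> W) \<Longrightarrow> (\<Sum>k\<in>A. f k) \<in> W"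
  by (rule fun_vs.subspace_sum)

lemma lincomb_in_subspace:
  assumes "fun_vs.subspace W" "\<And>k. k < R \<Longrightarrow> c k = 1 \<Longrightarrow> v k \<in> W"
  shows "lincomb R v c \<in> W"
  unfolding lincomb_def
proof (rule subspace_sum_in[OF assms(1)])
  fix k assume "k \<in> {..<R}"
  then show "fun_scale (c k) (v k) \<in> W"
    using assms by (cases "c k") (auto simp: f2_subspace_iff)
qed

lemma additive_lincomb:
  fixes h :: "f2vec \<Rightarrow> f2vec"
  assumes "h 0 = 0" "\<And>x y. h (x + y) = h x + h y"
  shows "h (lincomb R b c) = lincomb R (\<lambda>k. h (b k)) c"
proof -
  have *: "h (\<Sum>k\<in>A. f k) = (\<Sum>k\<in>A. h (f k))" if "finite A" for A and f :: "nat \<Rightarrow> f2vec"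
    using that by (induction A rule: finite_induct) (metis sum.empty assms(1), metis sum.insert assms(2))
  have "h (fun_scale (c k) (b k)) = fun_scale (c k) (h (b k))" for k
    by (cases "c k") (simp_all add: assms)
  then show ?thesis by (simp add: lincomb_def *)
qed

lemma lincomb_lincomb: "lincomb S v (lincomb R b c) = lincomb R (\<lambda>k. lincomb S v (b k)) c"
  by (rule additive_lincomb) (rule lincomb_0, rule lincomb_add)

text \<open>Injectivity on coefficients, as opposed to independence of the set of values, makes a
  tuple with a repeated vector dependent and ignores all entries from index \<open>R\<close>
  on.\<close>

definition indep :: "nat \<Rightarrow> (nat \<Rightarrow> f2vec) \<Rightarrow> bool" where
  "indep R v \<longleftrightarrow> inj_on (lincomb R v) (F2 R)"

lemma indep_iff: "indep R v \<longleftrightarrow> (\<forall>c\<in>F2 R. lincomb R v c = 0 \<longrightarrow> c = 0)"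
proof
  assume "indep R v"
  then show "\<forall>c\<in>F2 R. lincomb R v c = 0 \<longrightarrow> c = 0"
    unfolding indep_def inj_on_def by (metis lincomb_0 zero_in_F2)
next
  assume *: "\<forall>c\<in>F2 R. lincomb R v c = 0 \<longrightarrow> c = 0"
  show "indep R v" unfolding indep_def
  proof (rule inj_onI)
    fix x y assume xy: "x \<in> F2 R" "y \<in> F2 R" "lincomb R v x = lincomb R v y"
    then have "lincomb R v (x + y) = 0" by (simp add: lincomb_add)
    then show "x = y" using * xy by (metis F2_add f2_add_eq_0_iff)
  qed
qed

lemma indepD: "indep R v \<Longrightarrow> D \<subseteq> {..<R} \<Longrightarrow> (\<Sum>k\<in>D. v k) = 0 \<Longrightarrow> D = {}"
  unfolding indep_iff by (metis chi_empty chi_in_F2 chi_inject lincomb_chi)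

lemma indep_sum_inj:
  assumes "indep R v" "D \<subseteq> {..<R}" "E \<subseteq> {..<R}" "(\<Sum>k\<in>D. v k) = (\<Sum>k\<in>E. v k)"
  shows "D = E"
proof -
  have "lincomb R v (chi D) = lincomb R v (chi E)" using assms by (simp add: lincomb_chi)
  then have "chi D = chi E" using assms unfolding indep_def inj_on_def by (metis chi_in_F2)
  then show ?thesis by simp
qed

lemma indep_cong: "(\<And>k. k < R \<Longrightarrow> v k = v' k) \<Longrightarrow> indep R v = indep R v'"
  unfolding indep_iff using lincomb_cong[of R v v'] by auto

lemma indep_mono: "indep R v \<Longrightarrow> k \<le> R \<Longrightarrow> indep k v"
  unfolding indep_iff using lincomb_F2 F2_mono by (metis subsetD)

lemma indep_unitv [simp]: "indep R unitv"
  by (simp add: indep_iff lincomb_unitv_id)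

lemma indep_sequential:
  assumes "\<And>k. k < R \<Longrightarrow> v k \<notin> lincomb k v ` F2 k"
  shows "indep R v"
  using assms
proof (induction R)
  case 0
  then show ?case by (simp add: indep_iff)
next
  case (Suc R)
  then have IH: "indep R v" by simp
  show ?case unfolding indep_iff
  proof (intro ballI impI)
    fix c assume c: "c \<in> F2 (Suc R)" "lincomb (Suc R) v c = 0"
    from c(1) show "c = 0"
    proof (cases rule: F2_Suc_cases)
      case 1
      then show ?thesis using c IH lincomb_F2[of c R "Suc R" v] by (auto simp: indep_iff)
    next
      case (2 c')
      then have "lincomb R v c' + v R = 0"
        using c lincomb_F2[of c' R "Suc R" v] by (simp add: lincomb_add)
      then have "v R = lincomb R v c'" by (metis f2_add_eq_0_iff)
      then show ?thesis using Suc.prems[of R] 2 by auto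
    qed
  qed
qed

lemma card_lincomb_image: "indep R v \<Longrightarrow> k \<le> R \<Longrightarrow> card (lincomb R v ` F2 k) = 2 ^ k"
  unfolding indep_def using card_F2 F2_mono by (metis card_image inj_on_subset)

lemma indep_bij:
  assumes "indep R b" "\<And>k. k < R \<Longrightarrow> b k \<in> F2 R"
  shows "bij_betw (lincomb R b) (F2 R) (F2 R)"
proof -
  have "lincomb R b ` F2 R \<subseteq> F2 R" using assms(2) by (auto intro!: lincomb_in_subspace)
  moreover have "card (lincomb R b ` F2 R) = card (F2 R)"
    using card_lincomb_image[OF assms(1)] by (simp add: card_F2)
  ultimately have "lincomb R b ` F2 R = F2 R" by (simp add: card_subset_eq)
  then show ?thesis using assms(1) by (simp add: bij_betw_def indep_def)
qed

text \<open>An invertible matrix permutes the coefficient space, and composing with a permutation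
  preserves injectivity.\<close>

lemma indep_compose:
  assumes "indep R v" "indep R b" "\<And>k. k < R \<Longrightarrow> b k \<in> F2 R"
  shows "indep R (\<lambda>k. lincomb R v (b k))"
proof -
  have "inj_on (lincomb R v \<circ> lincomb R b) (F2 R)"
    using indep_bij[OF assms(2,3)] assms(1) unfolding indep_def bij_betw_def
    by (intro comp_inj_on) auto
  moreover have "lincomb R v \<circ> lincomb R b = lincomb R (\<lambda>k. lincomb R v (b k))"
    by (auto simp: lincomb_lincomb)
  ultimately show ?thesis by (simp add: indep_def)
qed

lemma indep_permute:
  assumes "\<sigma> permutes {..<R}"
  shows "indep R (\<lambda>k. unitv (\<sigma> k))"
  unfolding indep_iff
proof (intro ballI impI)
  fix c assume "c \<in> F2 R" and 0: "lincomb R (\<lambda>k. unitv (\<sigma> k)) c = 0"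
  then obtain D where D: "D \<subseteq> {..<R}" "c = chi D" by (auto simp: F2_chi)
  have "inj \<sigma>" using assms by (rule permutes_inj)
  then have "(\<Sum>k\<in>D. unitv (\<sigma> k)) = chi (\<sigma> ` D)"
    using D by (subst sum_unitv[symmetric])
      (auto simp: finite_subset sum.reindex inj_on_subset)
  then show "c = 0" using 0 D by (simp add: lincomb_chi) (metis chi_empty chi_inject image_is_empty)
qed

lemma finite_span_f2:
  assumes "finite (B :: f2vec set)"
  shows "fun_vs.span B = (\<lambda>D. \<Sum>v\<in>D. v) ` Pow B"
proof
  show "(\<lambda>D. \<Sum>v\<in>D. v) ` Pow B \<subseteq> fun_vs.span B"
    by (auto intro!: fun_vs.span_sum intro: fun_vs.span_base)
  show "fun_vs.span B \<subseteq> (\<lambda>D. \<Sum>v\<in>D. v) ` Pow B"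
  proof
    fix x assume "x \<in> fun_vs.span B"
    then obtain u where x: "x = (\<Sum>v\<in>B. fun_scale (u v) v)"
      using fun_vs.span_finite[OF assms] by auto
    have "(\<Sum>v\<in>B. fun_scale (u v) v) = (\<Sum>v\<in>B. if v \<in> {v\<in>B. u v = 1} then v else 0)"
    proof (rule sum.cong[OF refl])
      fix v assume "v \<in> B"
      then show "fun_scale (u v) v = (if v \<in> {v\<in>B. u v = 1} then v else 0)"
        by (cases "u v") auto
    qed
    also have "\<dots> = (\<Sum>v\<in>{v\<in>B. u v = 1}. v)"
      using assms by (intro sum.mono_neutral_cong_right) auto
    finally show "x \<in> (\<lambda>D. \<Sum>v\<in>D. v) ` Pow B" using x by blast
  qed
qed

text \<open>Distinct subsets of a basis have distinct sums. Dimensions can thus be traded for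
  cardinalities, which every injective additive map preserves.\<close>

lemma card_subspace:
  assumes "fun_vs.subspace W" "finite (W :: f2vec set)"
  shows "card W = 2 ^ fun_vs.dim W"
proof -
  obtain B where B: "B \<subseteq> W" "fun_vs.independent B" "W \<subseteq> fun_vs.span B" "card B = fun_vs.dim W"
    using fun_vs.basis_exists by blast
  have fin: "finite B" using B assms finite_subset by blast
  have W: "W = fun_vs.span B" using B assms(1) by (meson fun_vs.span_minimal subset_antisym)
  have "inj_on (\<lambda>D. \<Sum>v\<in>D. v) (Pow B)"
  proof (rule inj_onI)
    fix D E assume DE: "D \<in> Pow B" "E \<in> Pow B" "(\<Sum>v\<in>D. v) = (\<Sum>v\<in>E. v)"
    define u :: "f2vec \<Rightarrow> bit" where "u v = (if v \<in> D then 1 else 0) + (if v \<in> E then 1 else 0)" for v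
    have *: "(\<Sum>v\<in>B. fun_scale (if v \<in> X then 1 else 0 :: bit) v) = (\<Sum>v\<in>X. v)" if "X \<subseteq> B" for X
      using fin that by (intro sum.mono_neutral_cong_right) auto
    have "(\<Sum>v\<in>B. fun_scale (u v) v) = (\<Sum>v\<in>D. v) + (\<Sum>v\<in>E. v)"
      unfolding u_def fun_vs.scale_left_distrib sum.distrib using * DE by auto
    then have "(\<Sum>v\<in>B. fun_scale (u v) v) = 0" using DE by simp
    then have "\<forall>v\<in>B. u v = 0" using fun_vs.independentD[OF B(2) fin subset_refl] by blast
    then show "D = E" using DE by (auto simp: u_def split: if_splits)
  qed
  then show ?thesis using W fin B by (metis card_Pow card_image finite_span_f2)
qed

lemma dim_f2_iff:
  assumes "fun_vs.subspace W" "finite (W :: f2vec set)"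
  shows "fun_vs.dim W = k \<longleftrightarrow> card W = 2 ^ k"
  using card_subspace[OF assms] by simp

lemma subspace_F2_finite: "W \<subseteq> F2 n \<Longrightarrow> finite W"
  using finite_subset finite_F2 by blast

section \<open>Correlation on finite sets\<close>

text \<open>Unnormalised covariance under the uniform law on \<open>A\<close>. The norms on the
  right are not centred, because plain sums of squares over the fibres of a partition add up to the
  sum over \<open>A\<close>.\<close>

definition corr_le :: "real \<Rightarrow> 'a set \<Rightarrow> ('a \<Rightarrow> real) \<Rightarrow> ('a \<Rightarrow> real) \<Rightarrow> bool" where
  "corr_le c A f g \<longleftrightarrow>
     \<bar>(\<Sum>x\<in>A. f x * g x) - (\<Sum>x\<in>A. f x) * (\<Sum>x\<in>A. g x) / card A\<bar>
       \<le> c * sqrt (\<Sum>x\<in>A. (f x)\<^sup>2) * sqrt (\<Sum>x\<in>A. (g x)\<^sup>2)"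

lemma corr_le_commute: "corr_le c A f g \<longleftrightarrow> corr_le c A g f"
  unfolding corr_le_def by (simp add: mult.commute mult.left_commute)

lemma cauchy_schwarz_sum:
  fixes f g :: "'a \<Rightarrow> real"
  shows "\<bar>\<Sum>x\<in>A. f x * g x\<bar> \<le> sqrt (\<Sum>x\<in>A. (f x)\<^sup>2) * sqrt (\<Sum>x\<in>A. (g x)\<^sup>2)"
proof -
  have "\<bar>\<Sum>x\<in>A. f x * g x\<bar> \<le> (\<Sum>x\<in>A. \<bar>f x\<bar> * \<bar>g x\<bar>)"
    by (rule order_trans[OF sum_abs]) (simp add: abs_mult)
  also have "\<dots> \<le> L2_set f A * L2_set g A" by (rule L2_set_mult_ineq)
  finally show ?thesis by (simp add: L2_set_def)
qed

text \<open>
  Total covariance splits into the covariance within the fibres of \<open>z\<close> and the covariance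
  between fibre averages.
\<close>

lemma corr_le_fibres:
  fixes f g :: "'a \<Rightarrow> real" and z :: "'a \<Rightarrow> 'b"
  assumes fin: "finite A" and c1: "c1 \<ge> 0" and c2: "c2 \<ge> 0"
    and sub: "\<And>v. v \<in> z ` A \<Longrightarrow> corr_le c1 {x\<in>A. z x = v} f g"
    and bet: "\<And>G. (\<Sum>x\<in>A. G (z x)) = 0 \<Longrightarrow>
      \<bar>\<Sum>x\<in>A. f x * G (z x)\<bar> \<le> c2 * sqrt (\<Sum>x\<in>A. (f x)\<^sup>2) * sqrt (\<Sum>x\<in>A. (G (z x))\<^sup>2)"
  shows "corr_le (c1 + c2) A f g"
proof (cases "A = {}")
  case True
  then show ?thesis by (simp add: corr_le_def)
next
  case False
  define Av where "Av v = {x\<in>A. z x = v}" for v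
  have finv: "finite (Av v)" for v using fin by (simp add: Av_def)
  define sf where "sf v = (\<Sum>x\<in>Av v. f x)" for v
  define sg where "sg v = (\<Sum>x\<in>Av v. g x)" for v
  define m where "m = (\<Sum>x\<in>A. g x) / card A"
  \<comment> \<open>\<open>G\<close> is the centred fibre average of \<open>g\<close>. Averaging
    over fibres is an orthogonal projection, which is the reason for \<open>G2\<close>.\<close>
  define G where "G v = sg v / card (Av v) - m" for v
  have grp: "(\<Sum>v\<in>z ` A. \<Sum>x\<in>Av v. h x) = (\<Sum>x\<in>A. h x)" for h :: "'a \<Rightarrow> real"
    unfolding Av_def using fin by (intro sum.group) auto
  have cpos: "card (Av v) > 0" if "v \<in> z ` A" for v
    using that fin by (auto simp: Av_def card_gt_0_iff)
  have grpG: "(\<Sum>x\<in>A. h x * k (z x)) = (\<Sum>v\<in>z ` A. (\<Sum>x\<in>Av v. h x) * k v)"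
    for h :: "'a \<Rightarrow> real" and k :: "'b \<Rightarrow> real"
  proof -
    have "(\<Sum>x\<in>A. h x * k (z x)) = (\<Sum>v\<in>z ` A. \<Sum>x\<in>Av v. h x * k (z x))"
      by (simp add: grp)
    also have "\<dots> = (\<Sum>v\<in>z ` A. (\<Sum>x\<in>Av v. h x) * k v)"
      unfolding sum_distrib_right by (intro sum.cong) (auto simp: Av_def)
    finally show ?thesis .
  qed
  have cA: "card A > 0" using fin False by (simp add: card_gt_0_iff)
  have cardA: "(\<Sum>v\<in>z ` A. real (card (Av v))) = card A"
    using grp[of "\<lambda>_. 1"] by simp
  have sgA: "(\<Sum>v\<in>z ` A. sg v) = (\<Sum>x\<in>A. g x)" unfolding sg_def by (rule grp)
  have G0: "(\<Sum>x\<in>A. G (z x)) = 0"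
  proof -
    have "(\<Sum>x\<in>A. G (z x)) = (\<Sum>v\<in>z ` A. card (Av v) * G v)"
      using grpG[of "\<lambda>_. 1" G] by simp
    also have "\<dots> = (\<Sum>v\<in>z ` A. sg v - card (Av v) * m)"
      using cpos by (intro sum.cong) (auto simp: G_def field_simps)
    also have "\<dots> = 0"
      unfolding sum_subtractf sgA sum_distrib_right[symmetric] cardA using cA by (simp add: m_def)
    finally show ?thesis .
  qed
  have G2: "(\<Sum>x\<in>A. (G (z x))\<^sup>2) \<le> (\<Sum>x\<in>A. (g x)\<^sup>2)"
  proof -
    have "(\<Sum>x\<in>A. (G (z x))\<^sup>2) = (\<Sum>x\<in>A. G (z x) * G (z x))" by (simp add: power2_eq_square)
    also have "\<dots> = (\<Sum>x\<in>A. g x * G (z x))"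
    proof -
      have "(\<Sum>x\<in>A. g x * G (z x)) = (\<Sum>v\<in>z ` A. sg v * G v)"
        unfolding sg_def by (rule grpG)
      also have "\<dots> = (\<Sum>v\<in>z ` A. card (Av v) * (G v + m) * G v)"
        using cpos by (intro sum.cong) (auto simp: G_def)
      also have "\<dots> = (\<Sum>v\<in>z ` A. card (Av v) * (G v * G v)) + m * (\<Sum>v\<in>z ` A. card (Av v) * G v)"
        by (simp add: algebra_simps sum.distrib sum_distrib_left)
      also have "\<dots> = (\<Sum>x\<in>A. G (z x) * G (z x)) + m * (\<Sum>x\<in>A. G (z x))"
        using grpG[of "\<lambda>_. 1" G] grpG[of "\<lambda>_. 1" "\<lambda>v. G v * G v"] by simp
      finally show ?thesis using G0 by simp
    qed
    also have "\<dots> \<le> \<bar>\<Sum>x\<in>A. g x * G (z x)\<bar>" by simp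
    also have "\<dots> \<le> sqrt (\<Sum>x\<in>A. (g x)\<^sup>2) * sqrt (\<Sum>x\<in>A. (G (z x))\<^sup>2)"
      by (rule cauchy_schwarz_sum)
    finally have le: "(\<Sum>x\<in>A. (G (z x))\<^sup>2) \<le> sqrt (\<Sum>x\<in>A. (g x)\<^sup>2) * sqrt (\<Sum>x\<in>A. (G (z x))\<^sup>2)" .
    define s where "s = sqrt (\<Sum>x\<in>A. (G (z x))\<^sup>2)"
    define t where "t = sqrt (\<Sum>x\<in>A. (g x)\<^sup>2)"
    have st: "s \<ge> 0" "t \<ge> 0" "(\<Sum>x\<in>A. (G (z x))\<^sup>2) = s\<^sup>2" "(\<Sum>x\<in>A. (g x)\<^sup>2) = t\<^sup>2"
      by (simp_all add: s_def t_def sum_nonneg)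
    have "s\<^sup>2 \<le> t * s" using le st(1) unfolding t_def[symmetric] st(3) by simp
    then have "s \<le> t" using st by (cases "s = 0") (auto simp: power2_eq_square)
    then show ?thesis unfolding st(3,4) using st by (intro power_mono) auto
  qed
  have split: "(\<Sum>x\<in>A. f x * g x) - (\<Sum>x\<in>A. f x) * (\<Sum>x\<in>A. g x) / card A =
    (\<Sum>v\<in>z ` A. (\<Sum>x\<in>Av v. f x * g x) - sf v * sg v / card (Av v)) + (\<Sum>x\<in>A. f x * G (z x))"
  proof -
    have "(\<Sum>x\<in>A. f x * G (z x)) = (\<Sum>v\<in>z ` A. sf v * G v)" unfolding sf_def by (rule grpG)
    also have "\<dots> = (\<Sum>v\<in>z ` A. sf v * sg v / card (Av v)) - (\<Sum>v\<in>z ` A. sf v) * m"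
      by (simp add: G_def algebra_simps sum_subtractf sum_distrib_left)
    finally show ?thesis
      by (simp add: sum_subtractf grp sf_def m_def)
  qed
  have "\<bar>\<Sum>v\<in>z ` A. (\<Sum>x\<in>Av v. f x * g x) - sf v * sg v / card (Av v)\<bar>
      \<le> (\<Sum>v\<in>z ` A. c1 * sqrt (\<Sum>x\<in>Av v. (f x)\<^sup>2) * sqrt (\<Sum>x\<in>Av v. (g x)\<^sup>2))"
    using sub unfolding corr_le_def Av_def[symmetric] sf_def sg_def
    by (intro order_trans[OF sum_abs] sum_mono) auto
  also have "\<dots> = c1 * (\<Sum>v\<in>z ` A. sqrt (\<Sum>x\<in>Av v. (f x)\<^sup>2) * sqrt (\<Sum>x\<in>Av v. (g x)\<^sup>2))"
    by (simp add: sum_distrib_left mult.assoc)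
  also have "\<dots> \<le> c1 * (sqrt (\<Sum>v\<in>z ` A. (sqrt (\<Sum>x\<in>Av v. (f x)\<^sup>2))\<^sup>2)
      * sqrt (\<Sum>v\<in>z ` A. (sqrt (\<Sum>x\<in>Av v. (g x)\<^sup>2))\<^sup>2))"
    by (intro mult_left_mono c1 order_trans[OF abs_ge_self cauchy_schwarz_sum])
  also have "\<dots> = c1 * (sqrt (\<Sum>x\<in>A. (f x)\<^sup>2) * sqrt (\<Sum>x\<in>A. (g x)\<^sup>2))"
    by (simp add: sum_nonneg grp)
  finally have 1: "\<bar>\<Sum>v\<in>z ` A. (\<Sum>x\<in>Av v. f x * g x) - sf v * sg v / card (Av v)\<bar>
      \<le> c1 * (sqrt (\<Sum>x\<in>A. (f x)\<^sup>2) * sqrt (\<Sum>x\<in>A. (g x)\<^sup>2))" .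
  have "\<bar>\<Sum>x\<in>A. f x * G (z x)\<bar> \<le> c2 * sqrt (\<Sum>x\<in>A. (f x)\<^sup>2) * sqrt (\<Sum>x\<in>A. (G (z x))\<^sup>2)"
    by (rule bet[OF G0])
  also have "\<dots> \<le> c2 * sqrt (\<Sum>x\<in>A. (f x)\<^sup>2) * sqrt (\<Sum>x\<in>A. (g x)\<^sup>2)"
    using G2 c2 by (intro mult_left_mono mult_nonneg_nonneg) (auto simp: sum_nonneg)
  finally have 2: "\<bar>\<Sum>x\<in>A. f x * G (z x)\<bar> \<le> c2 * (sqrt (\<Sum>x\<in>A. (f x)\<^sup>2) * sqrt (\<Sum>x\<in>A. (g x)\<^sup>2))"
    by (simp add: mult.assoc)
  show ?thesis
    unfolding corr_le_def split using abs_triangle_ineq 1 2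
    by (smt (verit, best) distrib_right mult.assoc)
qed

text \<open>Bessel's inequality for the almost orthogonal translates of \<open>g\<close>.\<close>

lemma almost_orthogonal_bound:
  fixes f g :: "'a \<Rightarrow> real"
  assumes fin: "finite I" "I \<noteq> {}" and \<kappa>: "\<kappa> \<ge> 0"
    and bij: "\<And>c. c \<in> I \<Longrightarrow> bij_betw (\<theta> c) A A"
    and inv: "\<And>c x. c \<in> I \<Longrightarrow> x \<in> A \<Longrightarrow> f (\<theta> c x) = f x"
    and orth: "\<And>c c'. c \<in> I \<Longrightarrow> c' \<in> I \<Longrightarrow> c \<noteq> c' \<Longrightarrow>
      (\<Sum>x\<in>A. g (\<theta> c x) * g (\<theta> c' x)) \<le> \<kappa> * (\<Sum>x\<in>A. (g x)\<^sup>2)"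
  shows "\<bar>\<Sum>x\<in>A. f x * g x\<bar>
    \<le> sqrt (1 / card I + \<kappa>) * sqrt (\<Sum>x\<in>A. (f x)\<^sup>2) * sqrt (\<Sum>x\<in>A. (g x)\<^sup>2)"
proof -
  define N where "N = real (card I)"
  have N: "N > 0" using fin by (simp add: N_def card_gt_0_iff)
  define S where "S = (\<Sum>x\<in>A. (g x)\<^sup>2)"
  have S0: "S \<ge> 0" by (simp add: S_def sum_nonneg)
  have re: "(\<Sum>x\<in>A. h (\<theta> c x)) = (\<Sum>x\<in>A. h x)" if "c \<in> I" for c and h :: "'a \<Rightarrow> real"
    by (rule sum.reindex_bij_betw[OF bij[OF that]])
  \<comment> \<open>Since \<open>f\<close> is invariant, \<open>g\<close> may be replaced by any
    translate and therefore by the average of all of them, whose norm is small by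
    \<open>orth\<close>.\<close>
  have each: "(\<Sum>x\<in>A. f x * g (\<theta> c x)) = (\<Sum>x\<in>A. f x * g x)" if "c \<in> I" for c
    using re[OF that, of "\<lambda>x. f x * g x"] inv[OF that] by (simp cong: sum.cong)
  have "(\<Sum>c\<in>I. \<Sum>x\<in>A. f x * g (\<theta> c x)) = (\<Sum>c\<in>I. \<Sum>x\<in>A. f x * g x)"
    by (rule sum.cong[OF refl]) (rule each)
  then have "N * (\<Sum>x\<in>A. f x * g x) = (\<Sum>c\<in>I. \<Sum>x\<in>A. f x * g (\<theta> c x))"
    by (simp add: N_def)
  also have "\<dots> = (\<Sum>x\<in>A. f x * (\<Sum>c\<in>I. g (\<theta> c x)))"
    by (subst sum.swap) (simp add: sum_distrib_left)
  finally have *: "N * (\<Sum>x\<in>A. f x * g x) = (\<Sum>x\<in>A. f x * (\<Sum>c\<in>I. g (\<theta> c x)))" .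
  have "(\<Sum>x\<in>A. (\<Sum>c\<in>I. g (\<theta> c x))\<^sup>2) = (\<Sum>c\<in>I. \<Sum>c'\<in>I. \<Sum>x\<in>A. g (\<theta> c x) * g (\<theta> c' x))"
    unfolding power2_eq_square sum_product
    by (subst sum.swap, rule sum.cong[OF refl], subst sum.swap) simp
  also have "\<dots> \<le> (\<Sum>c\<in>I. \<Sum>c'\<in>I. (if c = c' then S else 0) + \<kappa> * S)"
  proof (intro sum_mono)
    fix c c' assume c: "c \<in> I" "c' \<in> I"
    show "(\<Sum>x\<in>A. g (\<theta> c x) * g (\<theta> c' x)) \<le> (if c = c' then S else 0) + \<kappa> * S"
    proof (cases "c = c'")
      case True
      then have "(\<Sum>x\<in>A. g (\<theta> c x) * g (\<theta> c' x)) = S"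
        using re[OF c(1), of "\<lambda>x. (g x)\<^sup>2"] by (simp add: S_def power2_eq_square)
      then show ?thesis using True \<kappa> S0 by simp
    next
      case False
      then show ?thesis using orth[OF c] by (simp add: S_def)
    qed
  qed
  also have "\<dots> = N * S + N * N * (\<kappa> * S)"
    using fin by (simp add: sum.distrib N_def algebra_simps)
  also have "\<dots> = N\<^sup>2 * ((1 / N + \<kappa>) * S)"
    using N by (simp add: field_simps power2_eq_square)
  finally have sq: "(\<Sum>x\<in>A. (\<Sum>c\<in>I. g (\<theta> c x))\<^sup>2) \<le> N\<^sup>2 * ((1 / N + \<kappa>) * S)" .
  have "N * \<bar>\<Sum>x\<in>A. f x * g x\<bar> = \<bar>\<Sum>x\<in>A. f x * (\<Sum>c\<in>I. g (\<theta> c x))\<bar>"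
    using N by (simp add: abs_mult flip: *)
  also have "\<dots> \<le> sqrt (\<Sum>x\<in>A. (f x)\<^sup>2) * sqrt (\<Sum>x\<in>A. (\<Sum>c\<in>I. g (\<theta> c x))\<^sup>2)"
    by (rule cauchy_schwarz_sum)
  also have "\<dots> \<le> sqrt (\<Sum>x\<in>A. (f x)\<^sup>2) * sqrt (N\<^sup>2 * ((1 / N + \<kappa>) * S))"
    using sq by (intro mult_left_mono) (auto simp: sum_nonneg)
  also have "\<dots> = N * (sqrt (1 / N + \<kappa>) * sqrt (\<Sum>x\<in>A. (f x)\<^sup>2) * sqrt S)"
    using N by (simp add: real_sqrt_mult)
  finally show ?thesis using N by (simp add: N_def S_def)
qed


section \<open>Systems of frames\<close>

text \<open>Over two elements both kinds of transvection are their own inverses, so this criterion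
  settles their invertibility by a direct computation.\<close>

lemma indep_involution:
  assumes "\<And>k. k < R \<Longrightarrow> lincomb R b (b k) = unitv k"
  shows "indep R b"
  unfolding indep_iff
proof (intro ballI impI)
  fix c assume c: "c \<in> F2 R" "lincomb R b c = 0"
  have "lincomb R b (lincomb R b c) = lincomb R unitv c"
    unfolding lincomb_lincomb by (rule lincomb_cong) (rule assms)
  then show "c = 0" using c by (simp add: lincomb_unitv_id)
qed

text \<open>The span of the vectors with index in \<open>C\<close>, written through index sets: for
  independent tuples the representing subset is unique, which makes intersections of spans
  computable.\<close>

definition ssums :: "(nat \<Rightarrow> f2vec) \<Rightarrow> nat set \<Rightarrow> f2vec set" where
  "ssums v C = (\<lambda>D. \<Sum>k\<in>D. v k) ` Pow C"

lemma sum_symdiff: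
  assumes "finite D" "finite E"
  shows "(\<Sum>k\<in>sym_diff D E. v k) = (\<Sum>k\<in>D. v k) + (\<Sum>k\<in>E. v k :: f2vec)"
proof -
  have "(\<Sum>k\<in>D. v k) + (\<Sum>k\<in>E. v k) =
      ((\<Sum>k\<in>D - E. v k) + (\<Sum>k\<in>D \<inter> E. v k)) + ((\<Sum>k\<in>E - D. v k) + (\<Sum>k\<in>D \<inter> E. v k))"
    using assms sum.Int_Diff[of D v E] sum.Int_Diff[of E v D] by (simp add: Int_commute add.commute)
  also have "\<dots> = (\<Sum>k\<in>D - E. v k) + (\<Sum>k\<in>E - D. v k)"
    by (metis add.assoc add.commute f2_add_left_self)
  also have "\<dots> = (\<Sum>k\<in>sym_diff D E. v k)"
    using assms by (intro sum.union_disjoint[symmetric]) auto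
  finally show ?thesis by simp
qed

lemma subspace_ssums: "finite C \<Longrightarrow> fun_vs.subspace (ssums v C)"
  unfolding f2_subspace_iff
proof (intro conjI ballI)
  show "0 \<in> ssums v C" unfolding ssums_def by (rule image_eqI[of _ _ "{}"]) auto
next
  fix x y assume "finite C" "x \<in> ssums v C" "y \<in> ssums v C"
  then obtain D E where DE: "D \<subseteq> C" "E \<subseteq> C" "x = (\<Sum>k\<in>D. v k)" "y = (\<Sum>k\<in>E. v k)"
    by (auto simp: ssums_def)
  then have "x + y = (\<Sum>k\<in>sym_diff D E. v k)"
    using \<open>finite C\<close> by (simp add: sum_symdiff finite_subset)
  then show "x + y \<in> ssums v C" using DE unfolding ssums_def by blast
qed

lemma ssums_base: "k \<in> C \<Longrightarrow> v k \<in> ssums v C"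
  unfolding ssums_def by (rule image_eqI[of _ _ "{k}"]) auto

lemma ssums_minimal:
  "fun_vs.subspace W \<Longrightarrow> (\<And>k. k \<in> C \<Longrightarrow> v k \<in> W) \<Longrightarrow> ssums v C \<subseteq> W"
  by (auto simp: ssums_def intro!: subspace_sum_in)

lemma ssums_mono: "C \<subseteq> D \<Longrightarrow> ssums v C \<subseteq> ssums v D"
  by (auto simp: ssums_def)

lemma ssums_inter:
  assumes "indep R v" "C \<subseteq> {..<R}" "D \<subseteq> {..<R}"
  shows "ssums v C \<inter> ssums v D = ssums v (C \<inter> D)"
proof
  show "ssums v C \<inter> ssums v D \<subseteq> ssums v (C \<inter> D)"
  proof
    fix x assume "x \<in> ssums v C \<inter> ssums v D"
    then obtain E F where EF: "E \<subseteq> C" "F \<subseteq> D" "x = sum v E" "x = sum v F"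
      by (auto simp: ssums_def)
    then have "E = F" using assms by (intro indep_sum_inj[of R v]) auto
    then show "x \<in> ssums v (C \<inter> D)" using EF by (auto simp: ssums_def)
  qed
qed (simp add: ssums_mono)

lemma lincomb_image_ssums: "k \<le> R \<Longrightarrow> lincomb R v ` F2 k = ssums v {..<k}"
proof -
  assume "k \<le> R"
  then have *: "lincomb R v (chi D) = sum v D" if "D \<subseteq> {..<k}" for D
    using that by (intro lincomb_chi) auto
  have "lincomb R v ` F2 k = (\<lambda>D. lincomb R v (chi D)) ` Pow {..<k}"
    by (simp add: F2_eq_image image_image)
  also have "\<dots> = ssums v {..<k}" unfolding ssums_def using * by (intro image_cong) auto
  finally show ?thesis .
qed

text \<open>Frames are indexed by \<open>\<Omega>\<close> instead of being collected in a set, so a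
  frame may occur repeatedly and a product of index sets is again an index set. Invariance asks only
  for a bijection of indices for each invertible matrix, without compatibility between different
  matrices.\<close>

locale frame_system =
  fixes \<Omega> :: "'a set" and V :: "'a \<Rightarrow> nat \<Rightarrow> f2vec" and R n :: nat
  assumes fin_\<Omega>: "finite \<Omega>" and ne_\<Omega>: "\<Omega> \<noteq> {}"
    and V_F2: "\<omega> \<in> \<Omega> \<Longrightarrow> k < R \<Longrightarrow> V \<omega> k \<in> F2 n"
    and V_indep: "\<omega> \<in> \<Omega> \<Longrightarrow> indep R (V \<omega>)"
    and V_GL: "indep R b \<Longrightarrow> (\<And>k. k < R \<Longrightarrow> b k \<in> F2 R) \<Longrightarrow>
      \<exists>\<theta>. bij_betw \<theta> \<Omega> \<Omega> \<and> (\<forall>\<omega>\<in>\<Omega>. \<forall>k<R. V (\<theta> \<omega>) k = lincomb R (V \<omega>) (b k))"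
begin

definition cls :: "nat set \<Rightarrow> 'a \<Rightarrow> 'a set" where
  "cls C \<omega>0 = {\<omega>\<in>\<Omega>. \<forall>k\<in>C. V \<omega> k = V \<omega>0 k}"

text \<open>Permutation invariance makes the positions \<open>j\<close> and \<open>i\<close>
  exchangeable, so one function and one norm suffice. The conditioning is on the exact vectors at
  \<open>C\<close>, a finer event than the span on which a link conditions.\<close>

definition expanding :: "real \<Rightarrow> bool" where
  "expanding lam \<longleftrightarrow> (\<forall>C j i. C \<subseteq> {..<R} \<and> j < R \<and> i < R \<and> j \<noteq> i \<and> j \<notin> C \<and> i \<notin> C \<longrightarrow>
     (\<forall>\<omega>0\<in>\<Omega>. \<forall>F :: f2vec \<Rightarrow> real. (\<Sum>\<omega>\<in>cls C \<omega>0. F (V \<omega> j)) = 0 \<longrightarrow>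
        \<bar>\<Sum>\<omega>\<in>cls C \<omega>0. F (V \<omega> j) * F (V \<omega> i)\<bar> \<le> lam * (\<Sum>\<omega>\<in>cls C \<omega>0. (F (V \<omega> j))\<^sup>2)))"

lemma finite_cls [simp]: "finite (cls C \<omega>)"
  using fin_\<Omega> by (simp add: cls_def)

lemma V_inj: "\<omega> \<in> \<Omega> \<Longrightarrow> D \<subseteq> {..<R} \<Longrightarrow> E \<subseteq> {..<R} \<Longrightarrow> sum (V \<omega>) D = sum (V \<omega>) E \<Longrightarrow> D = E"
  using indep_sum_inj V_indep by blast

lemma permute:
  assumes "\<sigma> permutes {..<R}"
  obtains \<theta> where "bij_betw \<theta> \<Omega> \<Omega>" "\<And>\<omega> k. \<omega> \<in> \<Omega> \<Longrightarrow> k < R \<Longrightarrow> V (\<theta> \<omega>) k = V \<omega> (\<sigma> k)"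
proof -
  have s: "\<sigma> k < R" if "k < R" for k using permutes_in_image[OF assms, of k] that by simp
  obtain \<theta> where "bij_betw \<theta> \<Omega> \<Omega>" "\<forall>\<omega>\<in>\<Omega>. \<forall>k<R. V (\<theta> \<omega>) k = lincomb R (V \<omega>) (unitv (\<sigma> k))"
    using V_GL[OF indep_permute[OF assms]] s by auto
  then show ?thesis using that[of \<theta>] s by auto
qed

lemma transvection:
  assumes "j < R" "D \<subseteq> {..<R}" "j \<notin> D"
  obtains \<theta> where "bij_betw \<theta> \<Omega> \<Omega>"
    "\<And>\<omega> k. \<omega> \<in> \<Omega> \<Longrightarrow> k < R \<Longrightarrow> V (\<theta> \<omega>) k = (if k = j then V \<omega> j + sum (V \<omega>) D else V \<omega> k)"
proof -
  define b where "b k = (if k = j then chi (insert j D) else unitv k)" for k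
  have finD: "finite D" using assms finite_subset by blast
  have sub: "insert j D \<subseteq> {..<R}" using assms by auto
  have bD: "sum b D = chi D"
    using assms finD by (subst sum_unitv[symmetric]) (auto simp: b_def intro!: sum.cong)
  have ins: "chi (insert j D) = unitv j + chi D"
    using assms finD by (simp flip: sum_unitv)
  have "lincomb R b (b k) = unitv k" if "k < R" for k
  proof (cases "k = j")
    case True
    have "lincomb R b (chi (insert j D)) = b j + chi D"
      using assms finD sub by (simp add: lincomb_chi bD)
    also have "\<dots> = unitv j" by (simp add: b_def ins add.assoc)
    finally show ?thesis using True by (simp add: b_def)
  next
    case False
    then show ?thesis using that by (simp add: b_def)
  qed
  then have "indep R b" by (rule indep_involution)
  moreover have "b k \<in> F2 R" if "k < R" for k using that sub by (auto simp: b_def)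
  ultimately obtain \<theta> where \<theta>: "bij_betw \<theta> \<Omega> \<Omega>"
    "\<forall>\<omega>\<in>\<Omega>. \<forall>k<R. V (\<theta> \<omega>) k = lincomb R (V \<omega>) (b k)"
    using V_GL by blast
  have "lincomb R (V \<omega>) (b k) = (if k = j then V \<omega> j + sum (V \<omega>) D else V \<omega> k)"
    if "k < R" for \<omega> k
    using that assms sub finD by (auto simp: b_def lincomb_chi)
  then show ?thesis using that[of \<theta>] \<theta> by auto
qed

text \<open>Its matrix is the transpose of the one in \<open>transvection\<close>. As both are
  involutions it is also the inverse transpose, which is what leaves tensor sums unchanged when the
  two act on opposite sides.\<close>

lemma dual_transvection:
  assumes "j < R" "D \<subseteq> {..<R}" "j \<notin> D"
  obtains \<theta> where "bij_betw \<theta> \<Omega> \<Omega>"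
    "\<And>\<omega> k. \<omega> \<in> \<Omega> \<Longrightarrow> k < R \<Longrightarrow> V (\<theta> \<omega>) k = (if k \<in> D then V \<omega> k + V \<omega> j else V \<omega> k)"
proof -
  define b where "b k = (if k \<in> D then unitv k + unitv j else unitv k)" for k
  have "lincomb R b (b k) = unitv k" if "k < R" for k
    using that assms by (auto simp: b_def lincomb_add add.assoc)
  then have "indep R b" by (rule indep_involution)
  moreover have "b k \<in> F2 R" if "k < R" for k using that assms by (auto simp: b_def)
  ultimately obtain \<theta> where \<theta>: "bij_betw \<theta> \<Omega> \<Omega>"
    "\<forall>\<omega>\<in>\<Omega>. \<forall>k<R. V (\<theta> \<omega>) k = lincomb R (V \<omega>) (b k)"
    using V_GL by blast
  have "lincomb R (V \<omega>) (b k) = (if k \<in> D then V \<omega> k + V \<omega> j else V \<omega> k)"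
    if "k < R" for \<omega> k
    using that assms by (auto simp: b_def lincomb_add)
  then show ?thesis using that[of \<theta>] \<theta> by auto
qed

text \<open>The conditional law given the vectors indexed by \<open>C\<close> depends on their span only.\<close>

lemma cls_transfer:
  assumes C: "C \<subseteq> {..<R}" and \<omega>: "\<omega>1 \<in> \<Omega>" "\<omega>2 \<in> \<Omega>"
    and span: "\<And>k. k \<in> C \<Longrightarrow> V \<omega>2 k \<in> ssums (V \<omega>1) C"
  obtains \<theta> where "bij_betw \<theta> (cls C \<omega>1) (cls C \<omega>2)"
    "\<And>\<omega> k. \<omega> \<in> cls C \<omega>1 \<Longrightarrow> k < R \<Longrightarrow> k \<notin> C \<Longrightarrow> V (\<theta> \<omega>) k = V \<omega> k"
proof -
  have finC: "finite C" using C finite_subset by blast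
  have "\<forall>k\<in>C. \<exists>D. D \<subseteq> C \<and> V \<omega>2 k = sum (V \<omega>1) D"
    using span by (auto simp: ssums_def)
  then obtain D where D: "\<And>k. k \<in> C \<Longrightarrow> D k \<subseteq> C" "\<And>k. k \<in> C \<Longrightarrow> V \<omega>2 k = sum (V \<omega>1) (D k)"
    by metis
  \<comment> \<open>\<open>b\<close> expresses the vectors of \<open>\<omega>2\<close> at
    \<open>C\<close> through those of \<open>\<omega>1\<close> at \<open>C\<close> and is the
    identity elsewhere, so its action carries one class to the other and leaves the remaining
    vectors alone.\<close>
  define b where "b k = (if k \<in> C then chi (D k) else unitv k)" for k
  have bF2: "b k \<in> F2 R" if "k < R" for k using that D C by (auto simp: b_def)
  have outside: "sum b E k = chi E k" if "finite E" "k \<notin> C" for E k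
  proof -
    have "sum b E k = (\<Sum>l\<in>E. b l k)" by (rule sum_fun_apply)
    also have "\<dots> = (\<Sum>l\<in>E. unitv l k)"
      using D that by (intro sum.cong) (auto simp: b_def chi_def unitv_def)
    also have "\<dots> = chi E k" using that by (simp add: sum_fun_apply flip: sum_unitv)
    finally show ?thesis .
  qed
  have inside: "lincomb R (V \<omega>1) (sum b E) = sum (V \<omega>2) E" if "E \<subseteq> C" for E
  proof -
    have "lincomb R (V \<omega>1) (sum b E) = lincomb R (V \<omega>1) (lincomb R b (chi E))"
      using that C by (simp add: lincomb_chi)
    also have "\<dots> = (\<Sum>k\<in>E. lincomb R (V \<omega>1) (b k))"
      using that C by (subst lincomb_lincomb) (simp add: lincomb_chi)
    also have "\<dots> = sum (V \<omega>2) E"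
    proof (rule sum.cong[OF refl])
      fix k assume "k \<in> E"
      then have k: "k \<in> C" using that by auto
      then have "D k \<subseteq> {..<R}" using D C by blast
      then show "lincomb R (V \<omega>1) (b k) = V \<omega>2 k"
        using D(2)[OF k] k by (simp add: b_def lincomb_chi)
    qed
    finally show ?thesis .
  qed
  \<comment> \<open>By \<open>outside\<close> a dependency of \<open>b\<close> involves only indices
    of \<open>C\<close>, and there it would be a dependency of the frame
    \<open>\<omega>2\<close>.\<close>
  have ind: "indep R b" unfolding indep_iff
  proof (intro ballI impI)
    fix c assume "c \<in> F2 R" "lincomb R b c = 0"
    then obtain E where E: "E \<subseteq> {..<R}" "c = chi E" "sum b E = 0"
      by (auto simp: F2_chi lincomb_chi)
    have finE: "finite E" using E finite_subset by blast
    have "E \<subseteq> C"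
    proof
      fix k assume "k \<in> E"
      then show "k \<in> C" using outside[OF finE, of k] E by (auto simp: chi_def)
    qed
    then have "sum (V \<omega>2) E = 0" using inside[of E] E by simp
    then have "E = {}" using indepD[OF V_indep[OF \<omega>(2)]] E by blast
    then show "c = 0" using E by simp
  qed
  obtain \<theta> where \<theta>: "bij_betw \<theta> \<Omega> \<Omega>" "\<And>\<omega> k. \<omega> \<in> \<Omega> \<Longrightarrow> k < R \<Longrightarrow> V (\<theta> \<omega>) k = lincomb R (V \<omega>) (b k)"
    using V_GL[OF ind bF2] by blast
  have out: "V (\<theta> \<omega>) k = V \<omega> k" if "\<omega> \<in> \<Omega>" "k < R" "k \<notin> C" for \<omega> k
    using \<theta>(2)[OF that(1,2)] that by (simp add: b_def)
  have into: "\<theta> \<omega> \<in> cls C \<omega>2" if "\<omega> \<in> cls C \<omega>1" for \<omega>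
  proof -
    have \<omega>': "\<omega> \<in> \<Omega>" "\<And>k. k \<in> C \<Longrightarrow> V \<omega> k = V \<omega>1 k" using that by (auto simp: cls_def)
    have "V (\<theta> \<omega>) k = V \<omega>2 k" if k: "k \<in> C" for k
    proof -
      have "D k \<subseteq> {..<R}" using D C k by blast
      then have "V (\<theta> \<omega>) k = sum (V \<omega>) (D k)"
        using \<theta>(2)[OF \<omega>'(1), of k] k C by (auto simp: b_def lincomb_chi)
      also have "\<dots> = sum (V \<omega>1) (D k)" using D k \<omega>'(2) by (intro sum.cong) auto
      finally show ?thesis using D k by simp
    qed
    then show ?thesis using \<theta>(1) \<omega>'(1) by (auto simp: cls_def bij_betw_def)
  qed
  \<comment> \<open>The inverse of \<open>b\<close> expresses coordinate vectors of \<open>C\<close>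
    through rows of \<open>b\<close> in \<open>C\<close>, so the vectors at \<open>C\<close> before
    the action can be read off from those after it.\<close>
  have onto: "\<omega> \<in> cls C \<omega>1" if \<omega>': "\<omega> \<in> \<Omega>" "\<theta> \<omega> \<in> cls C \<omega>2" for \<omega>
  proof -
    have "V \<omega> k = V \<omega>1 k" if k: "k \<in> C" for k
    proof -
      have "unitv k \<in> lincomb R b ` F2 R"
        using indep_bij[OF ind bF2] k C by (auto simp: bij_betw_def)
      then obtain E where E: "E \<subseteq> {..<R}" "unitv k = sum b E"
        by (auto simp: F2_chi lincomb_chi)
      have finE: "finite E" using E finite_subset by blast
      have EC: "E \<subseteq> C"
      proof
        fix l assume l: "l \<in> E"
        show "l \<in> C"
        proof (rule ccontr)
          assume "l \<notin> C"
          then have "unitv k l = 1" using outside[OF finE, of l] l E by (simp add: chi_def)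
          then show False using k \<open>l \<notin> C\<close> by (auto simp: unitv_def split: if_splits)
        qed
      qed
      have "V \<omega> k = lincomb R (V \<omega>) (lincomb R b (chi E))"
        using E k C by (simp add: lincomb_chi flip: E(2)) auto
      also have "\<dots> = (\<Sum>l\<in>E. lincomb R (V \<omega>) (b l))"
        using E by (subst lincomb_lincomb) (simp add: lincomb_chi)
      also have "\<dots> = (\<Sum>l\<in>E. V (\<theta> \<omega>) l)"
        using E \<theta>(2)[OF \<omega>'(1)] by (intro sum.cong) auto
      also have "\<dots> = sum (V \<omega>2) E" using \<omega>'(2) EC by (intro sum.cong) (auto simp: cls_def)
      also have "\<dots> = lincomb R (V \<omega>1) (unitv k)" using inside[OF EC] E(2) by simp
      also have "\<dots> = V \<omega>1 k" using k C by auto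
      finally show ?thesis .
    qed
    then show ?thesis using \<omega>' by (simp add: cls_def)
  qed
  have "bij_betw \<theta> (cls C \<omega>1) (cls C \<omega>2)"
    unfolding bij_betw_def
  proof
    show "inj_on \<theta> (cls C \<omega>1)"
      using \<theta>(1) by (auto simp: bij_betw_def cls_def intro: inj_on_subset)
    show "\<theta> ` cls C \<omega>1 = cls C \<omega>2"
    proof
      show "cls C \<omega>2 \<subseteq> \<theta> ` cls C \<omega>1"
      proof
        fix \<omega>' assume \<omega>': "\<omega>' \<in> cls C \<omega>2"
        then obtain \<omega> where "\<omega> \<in> \<Omega>" "\<omega>' = \<theta> \<omega>"
          using \<theta>(1) by (auto simp: bij_betw_def cls_def)
        then show "\<omega>' \<in> \<theta> ` cls C \<omega>1" using onto \<omega>' by blast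
      qed
    qed (use into in auto)
  qed
  then show ?thesis using that[of \<theta>] out by (auto simp: cls_def)
qed

text \<open>A permutation moves \<open>C\<close> to an initial segment and \<open>j\<close>,
  \<open>i\<close> to the two indices after it, so only the configuration that occurs in a link has
  to be checked.\<close>

lemma expandingI:
  assumes "\<And>i \<omega>0 F. i + 2 \<le> R \<Longrightarrow> \<omega>0 \<in> \<Omega> \<Longrightarrow> (\<Sum>\<omega>\<in>cls {..<i} \<omega>0. F (V \<omega> i)) = (0::real) \<Longrightarrow>
     \<bar>\<Sum>\<omega>\<in>cls {..<i} \<omega>0. F (V \<omega> i) * F (V \<omega> (Suc i))\<bar> \<le> lam * (\<Sum>\<omega>\<in>cls {..<i} \<omega>0. (F (V \<omega> i))\<^sup>2)"
  shows "expanding lam"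
  unfolding expanding_def
proof (intro allI impI ballI)
  fix C j i \<omega>0 and F :: "f2vec \<Rightarrow> real"
  assume h: "C \<subseteq> {..<R} \<and> j < R \<and> i < R \<and> j \<noteq> i \<and> j \<notin> C \<and> i \<notin> C" and \<omega>0: "\<omega>0 \<in> \<Omega>"
    and 0: "(\<Sum>\<omega>\<in>cls C \<omega>0. F (V \<omega> j)) = 0"
  define c where "c = card C"
  have finC: "finite C" using h finite_subset by blast
  have "c + 2 = card (insert j (insert i C))" using h finC by (simp add: c_def)
  also have "\<dots> \<le> card {..<R}" using h by (intro card_mono) auto
  finally have cR: "c + 2 \<le> R" by simp
  obtain h1 where h1: "bij_betw h1 {..<c} C"
    unfolding c_def using finC by (metis ex_bij_betw_nat_finite atLeast0LessThan)
  define h2 where "h2 k = (if k < c then h1 k else if k = c then j else i)" for k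
  have h2: "bij_betw h2 {..<c + 2} (insert j (insert i C))"
  proof -
    have "inj_on h2 {..<c + 2}"
      using h1 h by (auto simp: inj_on_def h2_def bij_betw_def)
    moreover have "h2 ` {..<c + 2} = insert j (insert i C)"
    proof -
      have "{..<c + 2} = insert c (insert (Suc c) {..<c})" by auto
      moreover have "h2 ` {..<c} = C" using h1 by (auto simp: h2_def bij_betw_def)
      ultimately show ?thesis by (auto simp: h2_def)
    qed
    ultimately show ?thesis by (simp add: bij_betw_def)
  qed
  have "\<exists>h3. bij_betw h3 ({..<R} - {..<c + 2}) ({..<R} - insert j (insert i C))"
  proof (rule finite_same_card_bij)
    have "card ({..<R} - insert j (insert i C)) = R - (c + 2)"
      using h finC by (subst card_Diff_subset) (auto simp: c_def)
    then show "card ({..<R} - {..<c + 2}) = card ({..<R} - insert j (insert i C))"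
      using cR by (simp add: card_Diff_subset)
  qed auto
  then obtain h3 where h3: "bij_betw h3 ({..<R} - {..<c + 2}) ({..<R} - insert j (insert i C))" ..
  define \<sigma> where "\<sigma> k = (if k \<in> {..<c + 2} then h2 k else if k \<in> {..<R} - {..<c + 2} then h3 k else k)" for k
  have "bij_betw \<sigma> ({..<c + 2} \<union> ({..<R} - {..<c + 2})) (insert j (insert i C) \<union> ({..<R} - insert j (insert i C)))"
  proof (rule bij_betw_combine)
    show "bij_betw \<sigma> {..<c + 2} (insert j (insert i C))"
      using h2 by (rule bij_betw_cong[THEN iffD1, rotated]) (auto simp: \<sigma>_def)
    show "bij_betw \<sigma> ({..<R} - {..<c + 2}) ({..<R} - insert j (insert i C))"
      using h3 by (rule bij_betw_cong[THEN iffD1, rotated]) (auto simp: \<sigma>_def)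
  qed auto
  moreover have "{..<c + 2} \<union> ({..<R} - {..<c + 2}) = {..<R}" using cR by auto
  moreover have "insert j (insert i C) \<union> ({..<R} - insert j (insert i C)) = {..<R}" using h by auto
  ultimately have "bij_betw \<sigma> {..<R} {..<R}" by simp
  moreover have "\<sigma> k = k" if "k \<notin> {..<R}" for k using that cR by (auto simp: \<sigma>_def)
  ultimately have perm: "\<sigma> permutes {..<R}" by (rule bij_imp_permutes)
  obtain \<theta> where \<theta>: "bij_betw \<theta> \<Omega> \<Omega>" "\<And>\<omega> k. \<omega> \<in> \<Omega> \<Longrightarrow> k < R \<Longrightarrow> V (\<theta> \<omega>) k = V \<omega> (\<sigma> k)"
    using permute[OF perm] by blast
  have \<sigma>C: "\<sigma> ` {..<c} = C" using h1 by (auto simp: \<sigma>_def h2_def bij_betw_def)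
  have \<sigma>c: "\<sigma> c = j" "\<sigma> (Suc c) = i" by (auto simp: \<sigma>_def h2_def)
  have iff: "\<theta> \<omega> \<in> cls {..<c} (\<theta> \<omega>0) \<longleftrightarrow> \<omega> \<in> cls C \<omega>0" if "\<omega> \<in> \<Omega>" for \<omega>
  proof -
    have "\<theta> \<omega> \<in> \<Omega>" using \<theta>(1) that by (auto simp: bij_betw_def)
    moreover have "(\<forall>k\<in>{..<c}. V (\<theta> \<omega>) k = V (\<theta> \<omega>0) k) \<longleftrightarrow> (\<forall>k\<in>C. V \<omega> k = V \<omega>0 k)"
      using \<theta>(2)[OF that] \<theta>(2)[OF \<omega>0] cR by (auto simp flip: \<sigma>C)
    ultimately show ?thesis using that by (simp add: cls_def)
  qed
  have bij: "bij_betw \<theta> (cls C \<omega>0) (cls {..<c} (\<theta> \<omega>0))"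
    unfolding bij_betw_def
  proof
    show "inj_on \<theta> (cls C \<omega>0)"
      using \<theta>(1) by (auto simp: bij_betw_def cls_def intro: inj_on_subset)
    show "\<theta> ` cls C \<omega>0 = cls {..<c} (\<theta> \<omega>0)"
    proof (intro equalityI subsetI)
      fix x assume "x \<in> \<theta> ` cls C \<omega>0"
      then show "x \<in> cls {..<c} (\<theta> \<omega>0)" using iff by (auto simp: cls_def)
    next
      fix x assume x: "x \<in> cls {..<c} (\<theta> \<omega>0)"
      then obtain \<omega> where "\<omega> \<in> \<Omega>" "x = \<theta> \<omega>" using \<theta>(1) by (auto simp: bij_betw_def cls_def)
      then show "x \<in> \<theta> ` cls C \<omega>0" using iff x by blast
    qed
  qed
  have tr: "(\<Sum>\<omega>\<in>cls {..<c} (\<theta> \<omega>0). H (V \<omega> c) (V \<omega> (Suc c))) = (\<Sum>\<omega>\<in>cls C \<omega>0. H (V \<omega> j) (V \<omega> i))"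
    for H :: "f2vec \<Rightarrow> f2vec \<Rightarrow> real"
  proof -
    have "(\<Sum>\<omega>\<in>cls {..<c} (\<theta> \<omega>0). H (V \<omega> c) (V \<omega> (Suc c))) =
      (\<Sum>\<omega>\<in>cls C \<omega>0. H (V (\<theta> \<omega>) c) (V (\<theta> \<omega>) (Suc c)))"
      by (rule sum.reindex_bij_betw[OF bij, symmetric])
    also have "\<dots> = (\<Sum>\<omega>\<in>cls C \<omega>0. H (V \<omega> j) (V \<omega> i))"
      using \<theta>(2) cR \<sigma>c by (intro sum.cong) (auto simp: cls_def)
    finally show ?thesis .
  qed
  have "\<theta> \<omega>0 \<in> \<Omega>" using \<theta>(1) \<omega>0 by (auto simp: bij_betw_def)
  then show "\<bar>\<Sum>\<omega>\<in>cls C \<omega>0. F (V \<omega> j) * F (V \<omega> i)\<bar> \<le> lam * (\<Sum>\<omega>\<in>cls C \<omega>0. (F (V \<omega> j))\<^sup>2)"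
    using assms[OF cR, of "\<theta> \<omega>0" F] 0 tr[of "\<lambda>x y. F x"] tr[of "\<lambda>x y. F x * F y"]
      tr[of "\<lambda>x y. (F x)\<^sup>2"] by simp
qed

end

section \<open>Tensor products of systems\<close>

declare plus_fun_apply [simp del] zero_fun_apply [simp del]

lemmas f2_apply = plus_fun_apply zero_fun_apply

lemma corr_le_const:
  assumes "\<And>x. x \<in> A \<Longrightarrow> f x = k" "c \<ge> 0"
  shows "corr_le c A f g"
proof -
  have "(\<Sum>x\<in>A. f x * g x) = k * (\<Sum>x\<in>A. g x)" "(\<Sum>x\<in>A. f x) = card A * k"
    using assms(1) by (simp_all add: sum_distrib_left)
  moreover have "card A = 0 \<Longrightarrow> (\<Sum>x\<in>A. g x) = 0"
    by (metis card_eq_0_iff sum.empty sum.infinite)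
  ultimately have "(\<Sum>x\<in>A. f x * g x) - (\<Sum>x\<in>A. f x) * (\<Sum>x\<in>A. g x) / card A = 0"
    by (cases "card A = 0") auto
  then show ?thesis using assms(2) by (simp add: corr_le_def sum_nonneg)
qed

lemma bij_betw_invariant:
  assumes "bij_betw \<Theta> X X" "A \<subseteq> X" "\<And>x. x \<in> X \<Longrightarrow> \<Theta> x \<in> A \<longleftrightarrow> x \<in> A"
  shows "bij_betw \<Theta> A A"
  unfolding bij_betw_def
proof
  show "inj_on \<Theta> A" using assms by (meson bij_betw_def inj_on_subset)
  show "\<Theta> ` A = A"
  proof (intro equalityI subsetI)
    fix y assume "y \<in> A"
    then have "y \<in> \<Theta> ` X" using assms by (auto simp: bij_betw_def)
    then obtain x where "x \<in> X" "y = \<Theta> x" by blast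
    then show "y \<in> \<Theta> ` A" using assms(3) \<open>y \<in> A\<close> by blast
  qed (use assms in auto)
qed

text \<open>Sampling without replacement is negatively correlated. The constant total must be zero
  because every summand has mean zero; multiplying it by \<open>g e0\<close> and summing shows that
  a positive multiple of \<open>\<kappa>\<close> is minus a sum of squares.\<close>

lemma orbit_negative_correlation:
  fixes g :: "'i \<Rightarrow> 'a \<Rightarrow> real"
  assumes fin: "finite A" "finite I" "e0 \<in> I" "e1 \<in> I" "e0 \<noteq> e1"
    and const: "\<And>x. x \<in> A \<Longrightarrow> (\<Sum>E\<in>I. g E x) = \<gamma>"
    and zero: "\<And>E. E \<in> I \<Longrightarrow> (\<Sum>x\<in>A. g E x) = 0"
    and same: "\<And>E. E \<in> I \<Longrightarrow> E \<noteq> e0 \<Longrightarrow> (\<Sum>x\<in>A. g e0 x * g E x) = \<kappa>"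
  shows "\<kappa> \<le> 0"
proof -
  have "\<gamma> * card A = (\<Sum>x\<in>A. \<Sum>E\<in>I. g E x)" using const by simp
  also have "\<dots> = 0" by (subst sum.swap) (simp add: zero)
  finally have \<gamma>: "\<gamma> = 0 \<or> A = {}" using fin by auto
  have "(\<Sum>x\<in>A. (g e0 x)\<^sup>2) + (\<Sum>E\<in>I - {e0}. \<Sum>x\<in>A. g e0 x * g E x) = (\<Sum>E\<in>I. \<Sum>x\<in>A. g e0 x * g E x)"
    using fin by (subst sum.remove[of I e0]) (auto simp: power2_eq_square)
  also have "\<dots> = (\<Sum>x\<in>A. g e0 x * (\<Sum>E\<in>I. g E x))"
    by (subst sum.swap) (simp add: sum_distrib_left)
  also have "\<dots> = 0" using \<gamma> const by auto
  finally have "(\<Sum>x\<in>A. (g e0 x)\<^sup>2) + card (I - {e0}) * \<kappa> = 0" using same by simp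
  moreover have "(\<Sum>x\<in>A. (g e0 x)\<^sup>2) \<ge> 0" by (simp add: sum_nonneg)
  moreover have "card (I - {e0}) > 0" using fin card_gt_0_iff by blast
  ultimately show ?thesis
    by (smt (verit) mult_pos_pos of_nat_0_less_iff)
qed

text \<open>The functional dual to \<open>v j\<close> extends to the whole space, and over two
  elements a functional on \<open>F2 n\<close> is the sum of the coordinates in some set.\<close>

lemma dual_coordinates:
  assumes "indep R v" "\<And>k. k < R \<Longrightarrow> v k \<in> F2 n" "j < R"
  obtains Bs where "Bs \<subseteq> {..<n}" "\<And>i. i < R \<Longrightarrow> (\<Sum>b\<in>Bs. v i b) = (if i = j then 1 else 0)"
proof -
  interpret vp: vector_space_pair "fun_scale :: bit \<Rightarrow> f2vec \<Rightarrow> f2vec" "times :: bit \<Rightarrow> bit \<Rightarrow> bit"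
    by unfold_locales (simp_all add: algebra_simps)
  have inj: "inj_on v {..<R}"
  proof (rule inj_onI)
    fix a b assume "a \<in> {..<R}" "b \<in> {..<R}" "v a = v b"
    then show "a = b" using indep_sum_inj[OF assms(1), of "{a}" "{b}"] by auto
  qed
  have "fun_vs.independent (v ` {..<R})"
  proof
    assume "fun_vs.dependent (v ` {..<R})"
    then obtain u where u: "\<exists>x\<in>v ` {..<R}. u x \<noteq> (0::bit)" "(\<Sum>x\<in>v ` {..<R}. fun_scale (u x) x) = 0"
      using fun_vs.dependent_finite[of "v ` {..<R}"] by auto
    define c where "c k = (if k < R then u (v k) else 0)" for k
    have "lincomb R v c = (\<Sum>k<R. fun_scale (u (v k)) (v k))"
      unfolding lincomb_def by (intro sum.cong) (auto simp: c_def)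
    also have "\<dots> = 0" using u(2) inj by (simp add: sum.reindex)
    finally have "lincomb R v c = 0" .
    moreover have "c \<in> F2 R" by (simp add: F2_def c_def)
    ultimately have "c = 0" using assms(1) by (simp add: indep_iff)
    then show False using u(1) by (auto simp: c_def fun_eq_iff f2_apply split: if_splits)
  qed
  then obtain g where g: "Vector_Spaces.linear fun_scale times g"
    "\<forall>x\<in>v ` {..<R}. g x = (if x = v j then 1 else 0)"
    using vp.linear_independent_extend[of "v ` {..<R}" "\<lambda>x. if x = v j then 1 else 0"] by blast
  interpret g: Vector_Spaces.linear "fun_scale :: bit \<Rightarrow> f2vec \<Rightarrow> f2vec" times g by (rule g(1))
  define Bs where "Bs = {b. b < n \<and> g (unitv b) = 1}"
  have "(\<Sum>b\<in>Bs. v i b) = (if i = j then 1 else 0)" if "i < R" for i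
  proof -
    have "v i = (\<Sum>b<n. fun_scale (v i b) (unitv b))"
      using lincomb_unitv_id[OF assms(2)[OF that]] by (simp add: lincomb_def)
    then have "g (v i) = g (\<Sum>b<n. fun_scale (v i b) (unitv b))" by simp
    also have "\<dots> = (\<Sum>b<n. v i b * g (unitv b))" by (simp add: g.sum g.scale)
    also have "\<dots> = (\<Sum>b<n. if b \<in> Bs then v i b else 0)"
      by (intro sum.cong) (auto simp: Bs_def)
    also have "\<dots> = (\<Sum>b\<in>Bs. v i b)"
      by (subst sum.inter_restrict[symmetric]) (auto simp: Bs_def intro!: sum.cong)
    finally have "(\<Sum>b\<in>Bs. v i b) = (if v i = v j then 1 else 0)" using g(2) that by auto
    then show ?thesis using that inj assms(3) by (auto dest: inj_onD)
  qed
  then show ?thesis using that[of Bs] by (auto simp: Bs_def)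
qed

section \<open>Flattened tensors and their contractions\<close>

definition tens :: "nat \<Rightarrow> f2vec \<Rightarrow> f2vec \<Rightarrow> f2vec" where
  "tens n p q = (\<lambda>k. p (k div n) * q (k mod n))"

lemma tens_add_left: "tens n (p + p') q = tens n p q + tens n p' q"
  by (simp add: tens_def fun_eq_iff f2_apply distrib_right)

lemma tens_add_right: "tens n p (q + q') = tens n p q + tens n p q'"
  by (simp add: tens_def fun_eq_iff f2_apply distrib_left)

lemma tens_0 [simp]: "tens n 0 q = 0" "tens n p 0 = 0"
  by (simp_all add: tens_def fun_eq_iff f2_apply)

lemma tens_F2:
  assumes "p \<in> F2 n"
  shows "tens n p q \<in> F2 (n * n)"
proof -
  have "p (k div n) * q (k mod n) = 0" if "k \<ge> n * n" for k
  proof -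
    have "k div n \<ge> n" if "n > 0"
      using \<open>k \<ge> n * n\<close> that by (simp add: less_eq_div_iff_mult_less_eq)
    then have "p (k div n) = 0" using assms by (cases "n = 0") (auto simp: F2_def)
    then show ?thesis by simp
  qed
  then show ?thesis by (simp add: F2_def tens_def)
qed

lemma tens_apply: "b < n \<Longrightarrow> tens n p q (a * n + b) = p a * q b"
  by (simp add: tens_def)

text \<open>Reads the flattened tensor as an \<open>n\<close> by \<open>n\<close> matrix and applies
  the functional given by \<open>Bs\<close> to every row; on a pure tensor it evaluates the second
  factor and leaves a multiple of the first.\<close>

definition contract_right :: "nat \<Rightarrow> nat set \<Rightarrow> f2vec \<Rightarrow> f2vec" where
  "contract_right n Bs M = (\<lambda>a. if a < n then \<Sum>b\<in>Bs. M (a * n + b) else 0)"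

definition contract_left :: "nat \<Rightarrow> nat set \<Rightarrow> f2vec \<Rightarrow> f2vec" where
  "contract_left n As M = (\<lambda>b. if b < n then \<Sum>a\<in>As. M (a * n + b) else 0)"

lemma contract_right_sum: "contract_right n Bs (\<Sum>k\<in>S. f k) = (\<Sum>k\<in>S. contract_right n Bs (f k))"
proof (induction S rule: infinite_finite_induct)
  case (insert x S)
  have "contract_right n Bs (u + w) = contract_right n Bs u + contract_right n Bs w" for u w
    by (simp add: contract_right_def fun_eq_iff f2_apply sum.distrib)
  then show ?case using insert by simp
qed (simp_all add: contract_right_def fun_eq_iff f2_apply)

lemma contract_left_sum: "contract_left n As (\<Sum>k\<in>S. f k) = (\<Sum>k\<in>S. contract_left n As (f k))"
proof (induction S rule: infinite_finite_induct)
  case (insert x S)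
  have "contract_left n As (u + w) = contract_left n As u + contract_left n As w" for u w
    by (simp add: contract_left_def fun_eq_iff f2_apply sum.distrib)
  then show ?case using insert by simp
qed (simp_all add: contract_left_def fun_eq_iff f2_apply)

lemma contract_right_tens:
  assumes "p \<in> F2 n" "Bs \<subseteq> {..<n}"
  shows "contract_right n Bs (tens n p q) = fun_scale (\<Sum>b\<in>Bs. q b) p"
proof
  fix a
  have "(\<Sum>b\<in>Bs. tens n p q (a * n + b)) = (\<Sum>b\<in>Bs. p a * q b)"
    using assms by (intro sum.cong) (auto simp: tens_apply)
  then show "contract_right n Bs (tens n p q) a = fun_scale (\<Sum>b\<in>Bs. q b) p a"
    using assms by (auto simp: contract_right_def fun_scale_def F2_def sum_distrib_left mult.commute)
qed

lemma contract_left_tens: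
  assumes "q \<in> F2 n"
  shows "contract_left n As (tens n p q) = fun_scale (\<Sum>a\<in>As. p a) q"
proof
  fix b
  have "(\<Sum>a\<in>As. tens n p q (a * n + b)) = (\<Sum>a\<in>As. p a * q b)" if "b < n"
    using that by (intro sum.cong) (auto simp: tens_apply)
  then show "contract_left n As (tens n p q) b = fun_scale (\<Sum>a\<in>As. p a) q b"
    using assms by (auto simp: contract_left_def fun_scale_def F2_def sum_distrib_right)
qed

text \<open>\<open>\<phi>\<close> labels the old indices. Equal fibres over all subsets let
  bijections of labels lift to permutations of indices, provide \<open>s\<close> spare indices for
  every label, and force \<open>R = 2 ^ d * s\<close>.\<close>

locale tensor_step = frame_system \<Omega> V R n for \<Omega> :: "'a set" and V R n +
  fixes d s :: nat and \<phi> :: "nat \<Rightarrow> nat set" and lam :: real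
  assumes \<phi>: "\<And>j. j < R \<Longrightarrow> \<phi> j \<subseteq> {..<d}"
    and fibres: "\<And>A. A \<subseteq> {..<d} \<Longrightarrow> card {j. j < R \<and> \<phi> j = A} = s"
    and lam0: "lam \<ge> 0" and exp: "expanding lam"
begin

definition P :: "'a \<times> 'a \<Rightarrow> nat \<Rightarrow> f2vec" where "P \<omega> = V (fst \<omega>)"
definition Q :: "'a \<times> 'a \<Rightarrow> nat \<Rightarrow> f2vec" where "Q \<omega> = V (snd \<omega>)"

abbreviation "\<Omega>2 \<equiv> \<Omega> \<times> \<Omega>"

text \<open>As a matrix this is the left tuple times the transpose of the right one; for independent
  tuples its rank is \<open>card S\<close>.\<close>

definition K :: "nat set \<Rightarrow> 'a \<times> 'a \<Rightarrow> f2vec" where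
  "K S \<omega> = (\<Sum>k\<in>S. tens n (P \<omega> k) (Q \<omega> k))"

definition tset :: "nat \<Rightarrow> nat set" where "tset a = {j. j < R \<and> a \<in> \<phi> j}"

definition W :: "'a \<times> 'a \<Rightarrow> nat \<Rightarrow> f2vec" where "W \<omega> a = K (tset a) \<omega>"

lemma tset_sub: "tset a \<subseteq> {..<R}"
  by (auto simp: tset_def)

lemma P_F2: "\<omega> \<in> \<Omega>2 \<Longrightarrow> k < R \<Longrightarrow> P \<omega> k \<in> F2 n"
  and Q_F2: "\<omega> \<in> \<Omega>2 \<Longrightarrow> k < R \<Longrightarrow> Q \<omega> k \<in> F2 n"
  and P_indep: "\<omega> \<in> \<Omega>2 \<Longrightarrow> indep R (P \<omega>)"
  and Q_indep: "\<omega> \<in> \<Omega>2 \<Longrightarrow> indep R (Q \<omega>)"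
  by (auto simp: P_def Q_def V_F2 V_indep)

lemma K_symdiff: "S \<subseteq> {..<R} \<Longrightarrow> T \<subseteq> {..<R} \<Longrightarrow> K (sym_diff S T) \<omega> = K S \<omega> + K T \<omega>"
  unfolding K_def by (intro sum_symdiff) (auto intro: finite_subset)

lemma K_F2: "\<omega> \<in> \<Omega>2 \<Longrightarrow> S \<subseteq> {..<R} \<Longrightarrow> K S \<omega> \<in> F2 (n * n)"
  unfolding K_def by (intro subspace_sum_in) (auto intro!: tens_F2 P_F2)

lemma contract_right_K:
  assumes "\<omega> \<in> \<Omega>2" "S \<subseteq> {..<R}" "Bs \<subseteq> {..<n}"
  shows "contract_right n Bs (K S \<omega>) = (\<Sum>k\<in>S. fun_scale (\<Sum>b\<in>Bs. Q \<omega> k b) (P \<omega> k))"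
  unfolding K_def contract_right_sum using assms
  by (intro sum.cong) (auto simp: contract_right_tens P_F2)

lemma contract_left_K:
  assumes "\<omega> \<in> \<Omega>2" "S \<subseteq> {..<R}"
  shows "contract_left n As (K S \<omega>) = (\<Sum>k\<in>S. fun_scale (\<Sum>a\<in>As. P \<omega> k a) (Q \<omega> k))"
  unfolding K_def contract_left_sum using assms
  by (intro sum.cong) (auto simp: contract_left_tens Q_F2)

lemma scaled_sum_ssums: "finite S \<Longrightarrow> (\<Sum>k\<in>S. fun_scale (c k) (v k)) \<in> ssums v S"
proof (intro subspace_sum_in subspace_ssums)
  fix k assume "finite S" "k \<in> S"
  then show "fun_scale (c k) (v k) \<in> ssums v S"
    using subspace_ssums[of S v] by (cases "c k") (auto simp: ssums_base f2_subspace_iff)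
qed auto

lemma P_span:
  assumes "\<omega> \<in> \<Omega>2" "\<omega>' \<in> \<Omega>2" "S \<subseteq> {..<R}" "K S \<omega> = K S \<omega>'" "j \<in> S"
  shows "P \<omega>' j \<in> ssums (P \<omega>) S"
proof -
  have finS: "finite S" using assms finite_subset by blast
  obtain Bs where Bs: "Bs \<subseteq> {..<n}" "\<And>i. i < R \<Longrightarrow> (\<Sum>b\<in>Bs. Q \<omega>' i b) = (if i = j then 1 else 0)"
    using dual_coordinates[OF Q_indep[OF assms(2)] Q_F2[OF assms(2)], of j] assms by blast
  have "contract_right n Bs (K S \<omega>') = (\<Sum>k\<in>S. if k = j then P \<omega>' k else 0)"
    unfolding contract_right_K[OF assms(2,3) Bs(1)]
    using Bs(2) assms(3) by (intro sum.cong) auto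
  also have "\<dots> = P \<omega>' j" using assms(5) finS by simp
  finally have "P \<omega>' j = contract_right n Bs (K S \<omega>)" using assms(4) by simp
  also have "\<dots> \<in> ssums (P \<omega>) S"
    unfolding contract_right_K[OF assms(1,3) Bs(1)] by (rule scaled_sum_ssums[OF finS])
  finally show ?thesis .
qed

lemma Q_span:
  assumes "\<omega> \<in> \<Omega>2" "\<omega>' \<in> \<Omega>2" "S \<subseteq> {..<R}" "K S \<omega> = K S \<omega>'" "j \<in> S"
  shows "Q \<omega>' j \<in> ssums (Q \<omega>) S"
proof -
  have finS: "finite S" using assms finite_subset by blast
  obtain As where As: "As \<subseteq> {..<n}" "\<And>i. i < R \<Longrightarrow> (\<Sum>a\<in>As. P \<omega>' i a) = (if i = j then 1 else 0)"
    using dual_coordinates[OF P_indep[OF assms(2)] P_F2[OF assms(2)], of j] assms by blast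
  have "contract_left n As (K S \<omega>') = (\<Sum>k\<in>S. if k = j then Q \<omega>' k else 0)"
    unfolding contract_left_K[OF assms(2,3)]
    using As(2) assms(3) by (intro sum.cong) auto
  also have "\<dots> = Q \<omega>' j" using assms(5) finS by simp
  finally have "Q \<omega>' j = contract_left n As (K S \<omega>)" using assms(4) by simp
  also have "\<dots> \<in> ssums (Q \<omega>) S"
    unfolding contract_left_K[OF assms(1,3)] by (rule scaled_sum_ssums[OF finS])
  finally show ?thesis .
qed

text \<open>The functional dual to \<open>P \<omega>' j\<close> takes the value 1 on the equal
  vector \<open>P \<omega> j\<close>, so the contraction keeps \<open>Q \<omega> j\<close> with
  coefficient 1. Once the left vector is known, the right one is confined to a coset.\<close>

lemma Q_affine:
  assumes "\<omega> \<in> \<Omega>2" "\<omega>' \<in> \<Omega>2" "S \<subseteq> {..<R}" "K S \<omega> = K S \<omega>'" "j \<in> S" "P \<omega> j = P \<omega>' j"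
  shows "Q \<omega>' j + Q \<omega> j \<in> ssums (Q \<omega>) (S - {j})"
proof -
  have finS: "finite S" using assms finite_subset by blast
  obtain As where As: "As \<subseteq> {..<n}" "\<And>i. i < R \<Longrightarrow> (\<Sum>a\<in>As. P \<omega>' i a) = (if i = j then 1 else 0)"
    using dual_coordinates[OF P_indep[OF assms(2)] P_F2[OF assms(2)], of j] assms by blast
  have "contract_left n As (K S \<omega>') = (\<Sum>k\<in>S. if k = j then Q \<omega>' k else 0)"
    unfolding contract_left_K[OF assms(2,3)]
    using As(2) assms(3) by (intro sum.cong) auto
  also have "\<dots> = Q \<omega>' j" using assms(5) finS by simp
  finally have "Q \<omega>' j = contract_left n As (K S \<omega>)" using assms(4) by simp
  also have "\<dots> = fun_scale (\<Sum>a\<in>As. P \<omega> j a) (Q \<omega> j) +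
      (\<Sum>k\<in>S - {j}. fun_scale (\<Sum>a\<in>As. P \<omega> k a) (Q \<omega> k))"
    unfolding contract_left_K[OF assms(1,3)] using finS assms(5) by (rule sum.remove)
  also have "(\<Sum>a\<in>As. P \<omega> j a) = 1" using As(2)[of j] assms by auto
  finally have "Q \<omega>' j + Q \<omega> j = (\<Sum>k\<in>S - {j}. fun_scale (\<Sum>a\<in>As. P \<omega> k a) (Q \<omega> k))"
    by (metis add.commute f2_add_left_self fun_scale_bit(2))
  also have "\<dots> \<in> ssums (Q \<omega>) (S - {j})" using finS by (intro scaled_sum_ssums) auto
  finally show ?thesis .
qed

text \<open>This lets the conditioning be split into pieces cut out of the given sets. The
  discrepancy over \<open>S \<inter> T\<close> equals the one over \<open>S - T\<close>, so its
  columns lie in the spans of left vectors over two disjoint index sets, and these meet only in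
  0.\<close>

lemma K_inter:
  assumes \<omega>: "\<omega> \<in> \<Omega>2" "\<omega>' \<in> \<Omega>2" and S: "S \<subseteq> {..<R}" "T \<subseteq> {..<R}"
    and eq: "K S \<omega> = K S \<omega>'" "K T \<omega> = K T \<omega>'"
  shows "K (S \<inter> T) \<omega> = K (S \<inter> T) \<omega>'"
proof -
  define A where "A = S \<inter> T"
  define B where "B = S - T"
  have AB: "A \<subseteq> {..<R}" "B \<subseteq> {..<R}" "finite A" "finite B"
    using S by (auto simp: A_def B_def intro: finite_subset)
  have eqU: "K (sym_diff S T) \<omega> = K (sym_diff S T) \<omega>'" using eq S by (simp add: K_symdiff)
  have PA: "P \<omega>' j \<in> ssums (P \<omega>) A" if "j \<in> A" for j
    using P_span[OF \<omega> S(1) eq(1), of j] P_span[OF \<omega> S(2) eq(2), of j] that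
      ssums_inter[OF P_indep[OF \<omega>(1)] S] by (auto simp: A_def)
  \<comment> \<open>\<open>S - T\<close> is the intersection of \<open>S\<close> with the symmetric
    difference, over which the sums agree by additivity.\<close>
  have PB: "P \<omega>' j \<in> ssums (P \<omega>) B" if "j \<in> B" for j
  proof -
    have "S \<inter> sym_diff S T = B" "sym_diff S T \<subseteq> {..<R}" using S by (auto simp: B_def)
    then show ?thesis
      using P_span[OF \<omega> S(1) eq(1), of j] P_span[OF \<omega> _ eqU, of j] that
        ssums_inter[OF P_indep[OF \<omega>(1)] S(1), of "sym_diff S T"] by (auto simp: B_def)
  qed
  have col: "contract_right n {b} (K X \<omega> + K X \<omega>') \<in> ssums (P \<omega>) X"
    if "b < n" "X \<subseteq> {..<R}" "finite X" "\<And>j. j \<in> X \<Longrightarrow> P \<omega>' j \<in> ssums (P \<omega>) X" for b X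
  proof -
    have "contract_right n {b} (K X \<omega> + K X \<omega>') = contract_right n {b} (K X \<omega>) + contract_right n {b} (K X \<omega>')"
      by (simp add: contract_right_def fun_eq_iff f2_apply)
    moreover have "contract_right n {b} (K X \<omega>) \<in> ssums (P \<omega>) X"
      using that \<omega> by (subst contract_right_K) (auto intro: scaled_sum_ssums)
    moreover have "contract_right n {b} (K X \<omega>') \<in> ssums (P \<omega>) X"
    proof -
      have "contract_right n {b} (K X \<omega>') \<in> ssums (P \<omega>') X"
        using that \<omega> by (subst contract_right_K) (auto intro: scaled_sum_ssums)
      then show ?thesis using ssums_minimal[OF subspace_ssums[OF that(3)]] that(4) by blast
    qed
    ultimately show ?thesis using subspace_ssums[OF that(3), of "P \<omega>"] by (simp add: f2_subspace_iff)
  qed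
  define M where "M = K A \<omega> + K A \<omega>'"
  have "K S x = K A x + K B x" for x
  proof -
    have "S = sym_diff A B" by (auto simp: A_def B_def)
    then show ?thesis using AB by (metis K_symdiff)
  qed
  then have "K A \<omega> + K B \<omega> = K A \<omega>' + K B \<omega>'" using eq by simp
  then have MB: "M = K B \<omega> + K B \<omega>'"
    unfolding M_def by (metis add.assoc add.commute f2_add_left_self)
  have zero: "contract_right n {b} M = 0" if "b < n" for b
  proof -
    have "contract_right n {b} M \<in> ssums (P \<omega>) A"
      unfolding M_def using col[OF that AB(1,3) PA] by blast
    moreover have "contract_right n {b} M \<in> ssums (P \<omega>) B"
      unfolding MB using col[OF that AB(2,4) PB] by blast
    ultimately have "contract_right n {b} M \<in> ssums (P \<omega>) (A \<inter> B)"
      using ssums_inter[OF P_indep[OF \<omega>(1)] AB(1,2)] by blast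
    moreover have "A \<inter> B = {}" by (auto simp: A_def B_def)
    ultimately show ?thesis by (simp add: ssums_def)
  qed
  have "M \<in> F2 (n * n)" using K_F2 \<omega> AB by (simp add: M_def)
  moreover have "M k = 0" if "k < n * n" for k
  proof -
    have n: "n > 0" using that by (cases n) auto
    then have b: "k mod n < n" and a: "k div n < n" using that by (auto simp: less_mult_imp_div_less)
    have "contract_right n {k mod n} M (k div n) = M k" using a by (simp add: contract_right_def)
    then show ?thesis using zero[OF b] by (simp add: f2_apply)
  qed
  ultimately have "M = 0" by (auto simp: F2_def fun_eq_iff f2_apply) (metis not_less)
  then show ?thesis unfolding M_def A_def by (simp add: f2_add_eq_0_iff)
qed

section \<open>Pairs of transvections that fix the tensor sums\<close>

lemma two_sided:
  assumes "j < R" "D \<subseteq> {..<R}" "j \<notin> D"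
  obtains \<Theta> where "bij_betw \<Theta> \<Omega>2 \<Omega>2"
    "\<And>\<omega> k. \<omega> \<in> \<Omega>2 \<Longrightarrow> k < R \<Longrightarrow> P (\<Theta> \<omega>) k = (if k = j then P \<omega> j + sum (P \<omega>) D else P \<omega> k)"
    "\<And>\<omega> k. \<omega> \<in> \<Omega>2 \<Longrightarrow> k < R \<Longrightarrow> Q (\<Theta> \<omega>) k = (if k \<in> D then Q \<omega> k + Q \<omega> j else Q \<omega> k)"
proof -
  obtain \<theta>1 where 1: "bij_betw \<theta>1 \<Omega> \<Omega>" "\<And>\<omega> k. \<omega> \<in> \<Omega> \<Longrightarrow> k < R \<Longrightarrow>
      V (\<theta>1 \<omega>) k = (if k = j then V \<omega> j + sum (V \<omega>) D else V \<omega> k)"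
    using transvection[OF assms] by blast
  obtain \<theta>2 where 2: "bij_betw \<theta>2 \<Omega> \<Omega>" "\<And>\<omega> k. \<omega> \<in> \<Omega> \<Longrightarrow> k < R \<Longrightarrow>
      V (\<theta>2 \<omega>) k = (if k \<in> D then V \<omega> k + V \<omega> j else V \<omega> k)"
    using dual_transvection[OF assms] by blast
  show ?thesis
    by (rule that[of "map_prod \<theta>1 \<theta>2"]) (use 1 2 in \<open>auto simp: P_def Q_def intro: bij_betw_map_prod\<close>)
qed

lemma two_sided_swap:
  assumes "j < R" "D \<subseteq> {..<R}" "j \<notin> D"
  obtains \<Theta> where "bij_betw \<Theta> \<Omega>2 \<Omega>2"
    "\<And>\<omega> k. \<omega> \<in> \<Omega>2 \<Longrightarrow> k < R \<Longrightarrow> Q (\<Theta> \<omega>) k = (if k = j then Q \<omega> j + sum (Q \<omega>) D else Q \<omega> k)"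
    "\<And>\<omega> k. \<omega> \<in> \<Omega>2 \<Longrightarrow> k < R \<Longrightarrow> P (\<Theta> \<omega>) k = (if k \<in> D then P \<omega> k + P \<omega> j else P \<omega> k)"
proof -
  obtain \<theta>1 where 1: "bij_betw \<theta>1 \<Omega> \<Omega>" "\<And>\<omega> k. \<omega> \<in> \<Omega> \<Longrightarrow> k < R \<Longrightarrow>
      V (\<theta>1 \<omega>) k = (if k = j then V \<omega> j + sum (V \<omega>) D else V \<omega> k)"
    using transvection[OF assms] by blast
  obtain \<theta>2 where 2: "bij_betw \<theta>2 \<Omega> \<Omega>" "\<And>\<omega> k. \<omega> \<in> \<Omega> \<Longrightarrow> k < R \<Longrightarrow>
      V (\<theta>2 \<omega>) k = (if k \<in> D then V \<omega> k + V \<omega> j else V \<omega> k)"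
    using dual_transvection[OF assms] by blast
  show ?thesis
    by (rule that[of "map_prod \<theta>2 \<theta>1"]) (use 1 2 in \<open>auto simp: P_def Q_def intro: bij_betw_map_prod\<close>)
qed

text \<open>The new left vector at \<open>j\<close> and the new right vectors at \<open>D\<close>
  contribute the same terms \<open>m (p k) (q j)\<close> for \<open>k \<in> D\<close>, and these
  cancel in characteristic two. The product is abstract so that the version with exchanged factors
  is an instance.\<close>

lemma sum_transvection:
  fixes p q :: "nat \<Rightarrow> f2vec"
  assumes "finite S" "j \<in> S" "D \<subseteq> S" "j \<notin> D"
    and "\<And>k. k \<in> S \<Longrightarrow> p' k = (if k = j then p j + sum p D else p k)"
    and "\<And>k. k \<in> S \<Longrightarrow> q' k = (if k \<in> D then q k + q j else q k)"
    and add: "\<And>x y z. m (x + y) z = m x z + m y (z :: f2vec)" "\<And>x y z. m x (y + z) = m x y + m x z"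
    and zero: "\<And>z. m (0::f2vec) z = (0::f2vec)"
  shows "(\<Sum>k\<in>S. m (p' k) (q' k)) = (\<Sum>k\<in>S. m (p k) (q k))"
proof -
  have finD: "finite D" using assms finite_subset by blast
  have ms: "m (sum p D) z = (\<Sum>k\<in>D. m (p k) z)" for z
    using finD by (induction D rule: finite_induct) (simp_all add: add zero)
  have "(\<Sum>k\<in>S. m (p' k) (q' k)) =
    (\<Sum>k\<in>S. m (p k) (q k) + ((if k = j then m (sum p D) (q j) else 0) + (if k \<in> D then m (p k) (q j) else 0)))"
  proof (rule sum.cong[OF refl])
    fix k assume k: "k \<in> S"
    show "m (p' k) (q' k) = m (p k) (q k) +
       ((if k = j then m (sum p D) (q j) else 0) + (if k \<in> D then m (p k) (q j) else 0))"
      using assms(4) by (auto simp: assms(5,6)[OF k] add)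
  qed
  also have "\<dots> = (\<Sum>k\<in>S. m (p k) (q k)) + (m (sum p D) (q j) + (\<Sum>k\<in>D. m (p k) (q j)))"
  proof -
    have "(\<Sum>k\<in>S. if k = j then m (sum p D) (q j) else 0) = m (sum p D) (q j)"
      using assms by simp
    moreover have "(\<Sum>k\<in>S. if k \<in> D then m (p k) (q j) else 0) = (\<Sum>k\<in>D. m (p k) (q j))"
      using assms by (simp add: Int_absorb1 flip: sum.inter_restrict)
    ultimately show ?thesis by (simp add: sum.distrib)
  qed
  also have "\<dots> = (\<Sum>k\<in>S. m (p k) (q k))" by (simp add: ms)
  finally show ?thesis .
qed

lemma K_two_sided:
  assumes "S \<subseteq> {..<R}" "insert j D \<subseteq> S \<or> insert j D \<inter> S = {}" "j \<notin> D"
    and "\<And>k. k < R \<Longrightarrow> P \<omega>' k = (if k = j then P \<omega> j + sum (P \<omega>) D else P \<omega> k)"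
    and "\<And>k. k < R \<Longrightarrow> Q \<omega>' k = (if k \<in> D then Q \<omega> k + Q \<omega> j else Q \<omega> k)"
  shows "K S \<omega>' = K S \<omega>"
  using assms(2)
proof
  assume sub: "insert j D \<subseteq> S"
  show ?thesis unfolding K_def
    by (rule sum_transvection[where j = j and D = D])
      (use assms sub in \<open>auto simp: tens_add_left tens_add_right intro: finite_subset\<close>)
next
  assume dis: "insert j D \<inter> S = {}"
  show ?thesis unfolding K_def
  proof (rule sum.cong[OF refl])
    fix k assume "k \<in> S"
    then have "k < R" "k \<noteq> j" "k \<notin> D" using dis assms(1) by auto
    then show "tens n (P \<omega>' k) (Q \<omega>' k) = tens n (P \<omega> k) (Q \<omega> k)" by (simp add: assms(4,5))
  qed
qed

lemma K_two_sided_swap: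
  assumes "S \<subseteq> {..<R}" "insert j D \<subseteq> S \<or> insert j D \<inter> S = {}" "j \<notin> D"
    and "\<And>k. k < R \<Longrightarrow> Q \<omega>' k = (if k = j then Q \<omega> j + sum (Q \<omega>) D else Q \<omega> k)"
    and "\<And>k. k < R \<Longrightarrow> P \<omega>' k = (if k \<in> D then P \<omega> k + P \<omega> j else P \<omega> k)"
  shows "K S \<omega>' = K S \<omega>"
  using assms(2)
proof
  assume sub: "insert j D \<subseteq> S"
  show ?thesis unfolding K_def
    by (rule sum_transvection[where j = j and D = D and m = "\<lambda>x y. tens n y x"])
      (use assms sub in \<open>auto simp: tens_add_left tens_add_right intro: finite_subset\<close>)
next
  assume dis: "insert j D \<inter> S = {}"
  show ?thesis unfolding K_def
  proof (rule sum.cong[OF refl])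
    fix k assume "k \<in> S"
    then have "k < R" "k \<noteq> j" "k \<notin> D" using dis assms(1) by auto
    then show "tens n (P \<omega>' k) (Q \<omega>' k) = tens n (P \<omega> k) (Q \<omega> k)" by (simp add: assms(4,5))
  qed
qed

end

text \<open>Double counting: exchanging the first component of an element with a member of its cell
  is an involution, so the average over \<open>A\<close> equals the common average over a
  cell.\<close>

lemma expectation_by_cells:
  assumes fin: "finite A"
    and cls: "\<And>p. finite (cl p)" "\<And>p p'. p' \<in> cl p \<Longrightarrow> p \<in> cl p'"
    and closed: "\<And>p q p'. (p, q) \<in> A \<Longrightarrow> p' \<in> cl p \<Longrightarrow> (p', q) \<in> A"
    and N: "\<And>\<omega>. \<omega> \<in> A \<Longrightarrow> real (card (cl (fst \<omega>))) = N"
    and \<Phi>: "\<And>\<omega>. \<omega> \<in> A \<Longrightarrow> (\<Sum>p\<in>cl (fst \<omega>). h p) = \<Phi>"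
  shows "N * (\<Sum>\<omega>\<in>A. h (fst \<omega>)) = card A * (\<Phi> :: real)"
proof -
  define X where "X = (SIGMA \<omega>:A. cl (fst \<omega>))"
  have "card A * \<Phi> = (\<Sum>\<omega>\<in>A. \<Sum>p\<in>cl (fst \<omega>). h p)" by (simp add: \<Phi>)
  also have "\<dots> = (\<Sum>(\<omega>, p)\<in>X. h p)" unfolding X_def using fin cls by (subst sum.Sigma) auto
  also have "\<dots> = (\<Sum>(\<omega>, p)\<in>X. h (fst \<omega>))"
    by (rule sum.reindex_bij_witness[where i = "\<lambda>(\<omega>, p). ((p, snd \<omega>), fst \<omega>)"
          and j = "\<lambda>(\<omega>, p). ((p, snd \<omega>), fst \<omega>)"])
      (auto simp: X_def intro: closed cls(2))
  also have "\<dots> = (\<Sum>\<omega>\<in>A. \<Sum>p\<in>cl (fst \<omega>). h (fst \<omega>))"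
    unfolding X_def using fin cls by (subst sum.Sigma) auto
  also have "\<dots> = N * (\<Sum>\<omega>\<in>A. h (fst \<omega>))" by (simp add: N sum_distrib_left)
  finally show ?thesis by simp
qed

section \<open>Expansion under conditioning that fixes only spans\<close>

context frame_system
begin

text \<open>\<open>A\<close> is a union of classes in its first component, and over these the
  vectors at \<open>C\<close> vary inside one fixed span. By \<open>cls_transfer\<close> all the
  classes have the same joint law at \<open>j\<close> and \<open>i\<close>, so the bound for one
  class is a bound for \<open>A\<close>.\<close>

lemma expanding_fst:
  fixes A :: "('a \<times> 'b) set"
  assumes exp: "expanding lam" and fin: "finite A" and A: "fst ` A \<subseteq> \<Omega>"
    and C: "C \<subseteq> {..<R}" "j < R" "i < R" "j \<noteq> i" "j \<notin> C" "i \<notin> C"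
    and closed: "\<And>p q p'. (p, q) \<in> A \<Longrightarrow> p' \<in> cls C p \<Longrightarrow> (p', q) \<in> A"
    and span: "\<And>\<omega> \<omega>' k. \<omega> \<in> A \<Longrightarrow> \<omega>' \<in> A \<Longrightarrow> k \<in> C \<Longrightarrow> V (fst \<omega>') k \<in> ssums (V (fst \<omega>)) C"
    and zero: "(\<Sum>\<omega>\<in>A. G (V (fst \<omega>) j)) = (0::real)"
  shows "\<bar>\<Sum>\<omega>\<in>A. G (V (fst \<omega>) j) * G (V (fst \<omega>) i)\<bar> \<le> lam * (\<Sum>\<omega>\<in>A. (G (V (fst \<omega>) j))\<^sup>2)"
proof (cases "A = {}")
  case False
  then obtain \<omega>0 where \<omega>0: "\<omega>0 \<in> A" by blast
  then have p0: "fst \<omega>0 \<in> \<Omega>" using A by auto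
  define N where "N = real (card (cls C (fst \<omega>0)))"
  have same: "(\<Sum>p\<in>cls C (fst \<omega>). H (V p j) (V p i)) = (\<Sum>p\<in>cls C (fst \<omega>0). H (V p j) (V p i))"
    if \<omega>: "\<omega> \<in> A" for \<omega> and H :: "f2vec \<Rightarrow> f2vec \<Rightarrow> real"
  proof -
    have "fst \<omega> \<in> \<Omega>" using \<omega> A by auto
    then obtain \<theta> where \<theta>: "bij_betw \<theta> (cls C (fst \<omega>0)) (cls C (fst \<omega>))"
      "\<And>p k. p \<in> cls C (fst \<omega>0) \<Longrightarrow> k < R \<Longrightarrow> k \<notin> C \<Longrightarrow> V (\<theta> p) k = V p k"
      using cls_transfer[OF C(1) p0, of "fst \<omega>"] span[OF \<omega>0 \<omega>] by metis
    have "(\<Sum>p\<in>cls C (fst \<omega>). H (V p j) (V p i)) = (\<Sum>p\<in>cls C (fst \<omega>0). H (V (\<theta> p) j) (V (\<theta> p) i))"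
      by (rule sum.reindex_bij_betw[OF \<theta>(1), symmetric])
    also have "\<dots> = (\<Sum>p\<in>cls C (fst \<omega>0). H (V p j) (V p i))"
      using \<theta>(2) C by (intro sum.cong) auto
    finally show ?thesis .
  qed
  have Nc: "real (card (cls C (fst \<omega>))) = N" if "\<omega> \<in> A" for \<omega>
    using same[OF that, of "\<lambda>_ _. 1"] by (simp add: N_def)
  have av: "N * (\<Sum>\<omega>\<in>A. H (V (fst \<omega>) j) (V (fst \<omega>) i)) =
      card A * (\<Sum>p\<in>cls C (fst \<omega>0). H (V p j) (V p i))" for H :: "f2vec \<Rightarrow> f2vec \<Rightarrow> real"
  proof (rule expectation_by_cells[where cl = "\<lambda>p. if p \<in> \<Omega> then cls C p else {}", OF fin])
    fix p q p' assume "(p, q) \<in> A" "p' \<in> (if p \<in> \<Omega> then cls C p else {})"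
    then show "(p', q) \<in> A" using closed by (auto split: if_splits)
  next
    fix \<omega> assume \<omega>: "\<omega> \<in> A"
    then have "fst \<omega> \<in> \<Omega>" using A by auto
    then show "real (card (if fst \<omega> \<in> \<Omega> then cls C (fst \<omega>) else {})) = N"
      "(\<Sum>p\<in>(if fst \<omega> \<in> \<Omega> then cls C (fst \<omega>) else {}). H (V p j) (V p i)) =
        (\<Sum>p\<in>cls C (fst \<omega>0). H (V p j) (V p i))"
      using Nc[OF \<omega>] same[OF \<omega>] by auto
  qed (auto simp: cls_def fin_\<Omega> split: if_splits)
  have N0: "N > 0"
    unfolding N_def using p0 by (simp add: card_gt_0_iff) (auto simp: cls_def)
  have A0: "card A > 0" using fin False by (simp add: card_gt_0_iff)
  have "(\<Sum>p\<in>cls C (fst \<omega>0). G (V p j)) = 0"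
    using av[of "\<lambda>x y. G x"] zero A0 by simp
  then have "\<bar>\<Sum>p\<in>cls C (fst \<omega>0). G (V p j) * G (V p i)\<bar> \<le> lam * (\<Sum>p\<in>cls C (fst \<omega>0). (G (V p j))\<^sup>2)"
    using exp C p0 unfolding expanding_def by blast
  then have "card A * \<bar>\<Sum>p\<in>cls C (fst \<omega>0). G (V p j) * G (V p i)\<bar>
      \<le> lam * (card A * (\<Sum>p\<in>cls C (fst \<omega>0). (G (V p j))\<^sup>2))"
    using A0 by (simp add: algebra_simps)
  then have "\<bar>N * (\<Sum>\<omega>\<in>A. G (V (fst \<omega>) j) * G (V (fst \<omega>) i))\<bar> \<le> lam * (N * (\<Sum>\<omega>\<in>A. (G (V (fst \<omega>) j))\<^sup>2))"
    using av[of "\<lambda>x y. G x * G y"] av[of "\<lambda>x y. (G x)\<^sup>2"] by (simp add: abs_mult)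
  then have "N * \<bar>\<Sum>\<omega>\<in>A. G (V (fst \<omega>) j) * G (V (fst \<omega>) i)\<bar> \<le> N * (lam * (\<Sum>\<omega>\<in>A. (G (V (fst \<omega>) j))\<^sup>2))"
    using N0 by (simp add: abs_mult algebra_simps)
  then show ?thesis using N0 by simp
qed simp

lemma expanding_snd:
  fixes A :: "('b \<times> 'a) set"
  assumes exp: "expanding lam" and fin: "finite A" and A: "snd ` A \<subseteq> \<Omega>"
    and C: "C \<subseteq> {..<R}" "j < R" "i < R" "j \<noteq> i" "j \<notin> C" "i \<notin> C"
    and closed: "\<And>p q q'. (p, q) \<in> A \<Longrightarrow> q' \<in> cls C q \<Longrightarrow> (p, q') \<in> A"
    and span: "\<And>\<omega> \<omega>' k. \<omega> \<in> A \<Longrightarrow> \<omega>' \<in> A \<Longrightarrow> k \<in> C \<Longrightarrow> V (snd \<omega>') k \<in> ssums (V (snd \<omega>)) C"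
    and zero: "(\<Sum>\<omega>\<in>A. G (V (snd \<omega>) j)) = (0::real)"
  shows "\<bar>\<Sum>\<omega>\<in>A. G (V (snd \<omega>) j) * G (V (snd \<omega>) i)\<bar> \<le> lam * (\<Sum>\<omega>\<in>A. (G (V (snd \<omega>) j))\<^sup>2)"
proof -
  have inj: "inj_on prod.swap A" by simp
  have re: "(\<Sum>\<omega>\<in>prod.swap ` A. h (fst \<omega>)) = (\<Sum>\<omega>\<in>A. h (snd \<omega>))" for h :: "'a \<Rightarrow> real"
    by (simp add: sum.reindex[OF inj])
  have "\<bar>\<Sum>\<omega>\<in>prod.swap ` A. G (V (fst \<omega>) j) * G (V (fst \<omega>) i)\<bar>
      \<le> lam * (\<Sum>\<omega>\<in>prod.swap ` A. (G (V (fst \<omega>) j))\<^sup>2)"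
  proof (rule expanding_fst[OF exp _ _ C])
    show "finite (prod.swap ` A)" using fin by simp
    show "fst ` prod.swap ` A \<subseteq> \<Omega>" using A by (auto simp: image_image)
    show "(\<Sum>\<omega>\<in>prod.swap ` A. G (V (fst \<omega>) j)) = 0" using zero re[of "\<lambda>p. G (V p j)"] by simp
  qed (use closed span in auto)
  then show ?thesis
    using re[of "\<lambda>p. G (V p j) * G (V p i)"] re[of "\<lambda>p. (G (V p j))\<^sup>2"] by simp
qed

end

section \<open>Revealing vectors of the left tuple\<close>

context tensor_step
begin

text \<open>A state of the revealing process: the first \<open>i\<close> new vectors are conditioned
  on, and the old vectors with index in \<open>Z\<close> are known on both sides. \<open>CP\<close>
  is the intermediate state in which the left vector at \<open>j\<close> is known and the right one
  may still vary.\<close>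

definition CC :: "nat \<Rightarrow> nat set \<Rightarrow> 'a \<times> 'a \<Rightarrow> ('a \<times> 'a) set" where
  "CC i Z \<omega>0 = {\<omega>\<in>\<Omega>2. (\<forall>a<i. K (tset a) \<omega> = K (tset a) \<omega>0) \<and>
     (\<forall>k\<in>Z. P \<omega> k = P \<omega>0 k \<and> Q \<omega> k = Q \<omega>0 k)}"

definition CP :: "nat \<Rightarrow> nat set \<Rightarrow> nat \<Rightarrow> 'a \<times> 'a \<Rightarrow> ('a \<times> 'a) set" where
  "CP i Z j \<omega>0 = {\<omega>\<in>CC i Z \<omega>0. P \<omega> j = P \<omega>0 j}"

text \<open>The atom containing \<open>j\<close> of the set algebra generated by the sets
  \<open>tset a\<close> with \<open>a < i\<close>; the new vectors conditioned on do not distinguish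
  its indices.\<close>

definition blk :: "nat \<Rightarrow> nat \<Rightarrow> nat set" where
  "blk i j = {k. k < R \<and> \<phi> k \<inter> {..<i} = \<phi> j \<inter> {..<i}}"

lemma CC_sub: "CC i Z \<omega>0 \<subseteq> \<Omega>2" and CP_sub: "CP i Z j \<omega>0 \<subseteq> CC i Z \<omega>0"
  by (auto simp: CC_def CP_def)

lemma finite_CC [simp]: "finite (CC i Z \<omega>0)" and finite_CP [simp]: "finite (CP i Z j \<omega>0)"
  using fin_\<Omega> finite_subset[OF CC_sub[of i Z \<omega>0]] by (auto simp: CP_def)

text \<open>The index sets with agreeing sums are closed under intersection, by
  \<open>K_inter\<close>, and hence under difference. An atom with nonempty trace below
  \<open>i\<close> lies in some \<open>tset a0\<close> and is cut out of it; the remaining atom lies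
  in none of these sets and stays free.\<close>

lemma CC_K_eq:
  assumes \<omega>: "\<omega> \<in> CC i Z \<omega>0" "\<omega>' \<in> CC i Z \<omega>0" and j: "j < R" "\<phi> j \<inter> {..<i} \<noteq> {}"
    and Z: "Z \<subseteq> {..<R}"
  shows "K (blk i j - Z) \<omega> = K (blk i j - Z) \<omega>'"
proof -
  have \<omega>2: "\<omega> \<in> \<Omega>2" "\<omega>' \<in> \<Omega>2" using \<omega> CC_sub by blast+
  define DD where "DD = {S. S \<subseteq> {..<R} \<and> K S \<omega> = K S \<omega>'}"
  have int: "S \<inter> T \<in> DD" if "S \<in> DD" "T \<in> DD" for S T
    using that K_inter[OF \<omega>2] by (auto simp: DD_def)
  have dif: "S - T \<in> DD" if ST: "S \<in> DD" "T \<in> DD" for S T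
  proof -
    have "S - T = sym_diff S (S \<inter> T)" by auto
    moreover have "S \<inter> T \<in> DD" by (rule int[OF ST])
    ultimately show ?thesis using ST K_symdiff[of S "S \<inter> T"] by (auto simp: DD_def)
  qed
  have ts: "tset a \<in> DD" if "a < i" for a
    using \<omega> that tset_sub by (auto simp: DD_def CC_def)
  obtain a0 where a0: "a0 < i" "a0 \<in> \<phi> j" using j by auto
  have "{k\<in>tset a0. \<forall>a<m. a \<in> \<phi> k \<longleftrightarrow> a \<in> \<phi> j} \<in> DD" if "m \<le> i" for m
    using that
  proof (induction m)
    case 0
    then show ?case using ts[OF a0(1)] by simp
  next
    case (Suc m)
    let ?S = "{k\<in>tset a0. \<forall>a<m. a \<in> \<phi> k \<longleftrightarrow> a \<in> \<phi> j}"
    have S: "?S \<in> DD" "tset m \<in> DD" using Suc ts by auto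
    have "{k\<in>tset a0. \<forall>a<Suc m. a \<in> \<phi> k \<longleftrightarrow> a \<in> \<phi> j} =
        (if m \<in> \<phi> j then ?S \<inter> tset m else ?S - tset m)"
      by (auto simp: less_Suc_eq tset_def)
    then show ?case using int[OF S] dif[OF S] by simp
  qed
  from this[of i] have "{k\<in>tset a0. \<forall>a<i. a \<in> \<phi> k \<longleftrightarrow> a \<in> \<phi> j} \<in> DD" by simp
  moreover have "{k\<in>tset a0. \<forall>a<i. a \<in> \<phi> k \<longleftrightarrow> a \<in> \<phi> j} = blk i j"
    using a0 by (auto simp: tset_def blk_def)
  ultimately have b: "blk i j \<in> DD" by simp
  have "Z \<in> DD"
    using \<omega> Z by (auto simp: DD_def CC_def K_def intro!: sum.cong)
  from dif[OF b this] show ?thesis by (simp add: DD_def)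
qed

lemma blk_sub: "blk i j \<subseteq> {..<R}"
  by (auto simp: blk_def)

lemma blk_tset: "S \<subseteq> blk i j \<Longrightarrow> a < i \<Longrightarrow> S \<subseteq> tset a \<or> S \<inter> tset a = {}"
  by (cases "a \<in> \<phi> j") (auto simp: blk_def tset_def)

text \<open>The indices of a transvection inside one block lie all inside or all outside each
  \<open>tset a\<close> that is conditioned on, so every such tensor sum, and with it the event, is
  preserved.\<close>

lemma CC_two_sided:
  assumes Z: "Z \<subseteq> {..<R}" and jD: "insert j D \<subseteq> blk i j0 - Z" "j \<notin> D"
  obtains \<Theta> where "bij_betw \<Theta> (CC i Z \<omega>0) (CC i Z \<omega>0)"
    "\<And>\<omega> k. \<omega> \<in> CC i Z \<omega>0 \<Longrightarrow> k < R \<Longrightarrow> P (\<Theta> \<omega>) k = (if k = j then P \<omega> j + sum (P \<omega>) D else P \<omega> k)"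
    "\<And>\<omega> T. \<omega> \<in> CC i Z \<omega>0 \<Longrightarrow> T \<subseteq> {..<R} \<Longrightarrow> insert j D \<subseteq> T \<or> insert j D \<inter> T = {} \<Longrightarrow> K T (\<Theta> \<omega>) = K T \<omega>"
proof -
  have jD': "j < R" "D \<subseteq> {..<R}" "insert j D \<subseteq> blk i j0" using jD blk_sub by blast+
  obtain \<Theta> where \<Theta>: "bij_betw \<Theta> \<Omega>2 \<Omega>2"
    "\<And>\<omega> k. \<omega> \<in> \<Omega>2 \<Longrightarrow> k < R \<Longrightarrow> P (\<Theta> \<omega>) k = (if k = j then P \<omega> j + sum (P \<omega>) D else P \<omega> k)"
    "\<And>\<omega> k. \<omega> \<in> \<Omega>2 \<Longrightarrow> k < R \<Longrightarrow> Q (\<Theta> \<omega>) k = (if k \<in> D then Q \<omega> k + Q \<omega> j else Q \<omega> k)"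
    using two_sided[OF jD'(1,2) jD(2)] by blast
  have KT: "K T (\<Theta> \<omega>) = K T \<omega>"
    if "\<omega> \<in> \<Omega>2" "T \<subseteq> {..<R}" "insert j D \<subseteq> T \<or> insert j D \<inter> T = {}" for \<omega> T
    using K_two_sided[OF that(2,3) jD(2) \<Theta>(2)[OF that(1)] \<Theta>(3)[OF that(1)]] by blast
  have "bij_betw \<Theta> (CC i Z \<omega>0) (CC i Z \<omega>0)"
  proof (rule bij_betw_invariant[OF \<Theta>(1) CC_sub])
    fix \<omega> assume \<omega>: "\<omega> \<in> \<Omega>2"
    have 1: "\<Theta> \<omega> \<in> \<Omega>2" using \<Theta>(1) \<omega> by (auto simp: bij_betw_def)
    have 2: "K (tset a) (\<Theta> \<omega>) = K (tset a) \<omega>" if "a < i" for a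
      using KT[OF \<omega> tset_sub] blk_tset[OF jD'(3) that] by blast
    have 3: "P (\<Theta> \<omega>) k = P \<omega> k" "Q (\<Theta> \<omega>) k = Q \<omega> k" if "k \<in> Z" for k
    proof -
      have "k < R" "k \<noteq> j" "k \<notin> D" using that jD Z by auto
      then show "P (\<Theta> \<omega>) k = P \<omega> k" "Q (\<Theta> \<omega>) k = Q \<omega> k" using \<Theta>(2,3)[OF \<omega>] by simp_all
    qed
    show "\<Theta> \<omega> \<in> CC i Z \<omega>0 \<longleftrightarrow> \<omega> \<in> CC i Z \<omega>0"
      using 1 \<omega> unfolding CC_def by (simp add: 2 3)
  qed
  moreover have "\<omega> \<in> \<Omega>2" if "\<omega> \<in> CC i Z \<omega>0" for \<omega> using that CC_sub by blast
  ultimately show ?thesis using that[of \<Theta>] \<Theta>(2) KT by simp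
qed

text \<open>Exchanging the sides changes left vectors only at \<open>D\<close>, so the revealed left
  vector survives as long as \<open>j1 \<notin> D\<close>.\<close>

lemma CP_two_sided_swap:
  assumes Z: "Z \<subseteq> {..<R}" and jD: "insert j D \<subseteq> blk i j0 - Z" "j \<notin> D" and j1: "j1 < R" "j1 \<notin> D"
  obtains \<Theta> where "bij_betw \<Theta> (CP i Z j1 \<omega>0) (CP i Z j1 \<omega>0)"
    "\<And>\<omega> k. \<omega> \<in> CP i Z j1 \<omega>0 \<Longrightarrow> k < R \<Longrightarrow> Q (\<Theta> \<omega>) k = (if k = j then Q \<omega> j + sum (Q \<omega>) D else Q \<omega> k)"
    "\<And>\<omega> T. \<omega> \<in> CP i Z j1 \<omega>0 \<Longrightarrow> T \<subseteq> {..<R} \<Longrightarrow> insert j D \<subseteq> T \<or> insert j D \<inter> T = {} \<Longrightarrow> K T (\<Theta> \<omega>) = K T \<omega>"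
proof -
  have jD': "j < R" "D \<subseteq> {..<R}" "insert j D \<subseteq> blk i j0" using jD blk_sub by blast+
  obtain \<Theta> where \<Theta>: "bij_betw \<Theta> \<Omega>2 \<Omega>2"
    "\<And>\<omega> k. \<omega> \<in> \<Omega>2 \<Longrightarrow> k < R \<Longrightarrow> Q (\<Theta> \<omega>) k = (if k = j then Q \<omega> j + sum (Q \<omega>) D else Q \<omega> k)"
    "\<And>\<omega> k. \<omega> \<in> \<Omega>2 \<Longrightarrow> k < R \<Longrightarrow> P (\<Theta> \<omega>) k = (if k \<in> D then P \<omega> k + P \<omega> j else P \<omega> k)"
    using two_sided_swap[OF jD'(1,2) jD(2)] by blast
  have KT: "K T (\<Theta> \<omega>) = K T \<omega>"
    if "\<omega> \<in> \<Omega>2" "T \<subseteq> {..<R}" "insert j D \<subseteq> T \<or> insert j D \<inter> T = {}" for \<omega> T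
    using K_two_sided_swap[OF that(2,3) jD(2) \<Theta>(2)[OF that(1)] \<Theta>(3)[OF that(1)]] by blast
  have CPs: "CP i Z j1 \<omega>0 \<subseteq> \<Omega>2" using CC_sub CP_sub by blast
  have "bij_betw \<Theta> (CP i Z j1 \<omega>0) (CP i Z j1 \<omega>0)"
  proof (rule bij_betw_invariant[OF \<Theta>(1) CPs])
    fix \<omega> assume \<omega>: "\<omega> \<in> \<Omega>2"
    have 1: "\<Theta> \<omega> \<in> \<Omega>2" using \<Theta>(1) \<omega> by (auto simp: bij_betw_def)
    have 2: "K (tset a) (\<Theta> \<omega>) = K (tset a) \<omega>" if "a < i" for a
      using KT[OF \<omega> tset_sub] blk_tset[OF jD'(3) that] by blast
    have 3: "P (\<Theta> \<omega>) k = P \<omega> k" "Q (\<Theta> \<omega>) k = Q \<omega> k" if "k \<in> Z" for k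
    proof -
      have "k < R" "k \<noteq> j" "k \<notin> D" using that jD Z by auto
      then show "P (\<Theta> \<omega>) k = P \<omega> k" "Q (\<Theta> \<omega>) k = Q \<omega> k" using \<Theta>(2,3)[OF \<omega>] by simp_all
    qed
    have 4: "P (\<Theta> \<omega>) j1 = P \<omega> j1" using \<Theta>(3)[OF \<omega> j1(1)] j1(2) by simp
    show "\<Theta> \<omega> \<in> CP i Z j1 \<omega>0 \<longleftrightarrow> \<omega> \<in> CP i Z j1 \<omega>0"
      using 1 \<omega> unfolding CC_def CP_def by (simp add: 2 3 4)
  qed
  moreover have "\<omega> \<in> \<Omega>2" if "\<omega> \<in> CP i Z j1 \<omega>0" for \<omega> using that CPs by blast
  ultimately show ?thesis using that[of \<Theta>] \<Theta>(2) KT by simp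
qed

text \<open>A transvection at \<open>k\<close> inside the block turns the left vector at
  \<open>k\<close> into the sum over \<open>E\<close> and moves no other left vector;
  \<open>E\<close> may contain \<open>j\<close>.\<close>

lemma P_shift:
  assumes Z: "Z \<subseteq> {..<R}" and E: "E \<subseteq> blk i j0 - Z" "k \<in> E" and j: "j < R" "j \<noteq> k"
  shows "(\<Sum>\<omega>\<in>CC i Z \<omega>0. H (P \<omega> j) (sum (P \<omega>) E)) = (\<Sum>\<omega>\<in>CC i Z \<omega>0. H (P \<omega> j) (P \<omega> k) :: real)"
proof -
  have h: "insert k (E - {k}) \<subseteq> blk i j0 - Z" "k \<notin> E - {k}" using E by blast+
  have "E \<subseteq> {..<R}" using E(1) blk_sub[of i j0] by blast
  then have finE: "finite E" and kR: "k < R" using E(2) finite_subset[of E "{..<R}"] by auto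
  obtain \<Theta> where \<Theta>: "bij_betw \<Theta> (CC i Z \<omega>0) (CC i Z \<omega>0)"
    "\<And>\<omega> l. \<omega> \<in> CC i Z \<omega>0 \<Longrightarrow> l < R \<Longrightarrow> P (\<Theta> \<omega>) l = (if l = k then P \<omega> k + sum (P \<omega>) (E - {k}) else P \<omega> l)"
    "\<And>\<omega> T. \<omega> \<in> CC i Z \<omega>0 \<Longrightarrow> T \<subseteq> {..<R} \<Longrightarrow>
      insert k (E - {k}) \<subseteq> T \<or> insert k (E - {k}) \<inter> T = {} \<Longrightarrow> K T (\<Theta> \<omega>) = K T \<omega>"
    by (rule CC_two_sided[OF Z h, where ?\<omega>0.0 = \<omega>0]) (rule that)
  have "(\<Sum>\<omega>\<in>CC i Z \<omega>0. H (P \<omega> j) (P \<omega> k)) = (\<Sum>\<omega>\<in>CC i Z \<omega>0. H (P (\<Theta> \<omega>) j) (P (\<Theta> \<omega>) k))"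
    by (rule sum.reindex_bij_betw[OF \<Theta>(1), of "\<lambda>\<omega>. H (P \<omega> j) (P \<omega> k)", symmetric])
  also have "\<dots> = (\<Sum>\<omega>\<in>CC i Z \<omega>0. H (P \<omega> j) (sum (P \<omega>) E))"
  proof (rule sum.cong[OF refl])
    fix \<omega> assume \<omega>: "\<omega> \<in> CC i Z \<omega>0"
    have "P (\<Theta> \<omega>) k = sum (P \<omega>) E"
      unfolding sum.remove[OF finE E(2), of "P \<omega>"] using \<Theta>(2)[OF \<omega> kR] by (simp only: refl if_True)
    moreover have "P (\<Theta> \<omega>) j = P \<omega> j" using \<Theta>(2)[OF \<omega> j(1)] j(2) by simp
    ultimately show "H (P (\<Theta> \<omega>) j) (P (\<Theta> \<omega>) k) = H (P \<omega> j) (sum (P \<omega>) E)" by simp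
  qed
  finally show ?thesis by simp
qed

text \<open>In the block whose labels avoid \<open>{..<i}\<close> the expansion of the old system
  applies directly. In any other block the tensor sum is fixed, hence also the span of its left
  vectors; they are exchangeable among the nonzero elements of a fixed space, which makes them
  negatively correlated. An upper bound without absolute value is what Bessel's inequality
  requires.\<close>

lemma P_pair:
  assumes Z: "Z \<subseteq> {..<R}" and j: "j < R" "j \<notin> Z" and k: "k \<in> blk i j - Z" "k \<noteq> j"
    and zero: "(\<Sum>\<omega>\<in>CC i Z \<omega>0. G (P \<omega> j)) = (0::real)"
  shows "(\<Sum>\<omega>\<in>CC i Z \<omega>0. G (P \<omega> j) * G (P \<omega> k)) \<le> lam * (\<Sum>\<omega>\<in>CC i Z \<omega>0. (G (P \<omega> j))\<^sup>2)"
proof -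
  define A where "A = CC i Z \<omega>0"
  define B where "B = blk i j - Z"
  have B: "B \<subseteq> {..<R}" "finite B" "j \<in> B" "k \<in> B"
    using j k blk_sub by (auto simp: B_def blk_def intro: finite_subset)
  show ?thesis
  proof (cases "\<phi> j \<inter> {..<i} = {}")
    case True
    \<comment> \<open>Every index outside \<open>B\<close> is revealed or lies in some
      \<open>tset a\<close> with \<open>a < i\<close>. So the event depends on the left tuple only
      through the vectors at \<open>C\<close>, and it keeps their span fixed.\<close>
    define C where "C = {..<R} - B"
    have tC: "tset a \<subseteq> C" if "a < i" for a
      using that True by (auto simp: tset_def C_def B_def blk_def)
    have ZC: "Z \<subseteq> C" using Z by (auto simp: C_def B_def)
    have "\<bar>\<Sum>\<omega>\<in>A. G (V (fst \<omega>) j) * G (V (fst \<omega>) k)\<bar> \<le> lam * (\<Sum>\<omega>\<in>A. (G (V (fst \<omega>) j))\<^sup>2)"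
    proof (rule expanding_fst[OF exp, where C = C])
      show "fst ` A \<subseteq> \<Omega>" using CC_sub[of i Z \<omega>0] by (auto simp: A_def)
      show "(\<Sum>\<omega>\<in>A. G (V (fst \<omega>) j)) = 0" using zero by (simp add: A_def P_def)
    next
      fix p q p' assume pq: "(p, q) \<in> A" "p' \<in> cls C p"
      have eq: "V p' l = V p l" if "l \<in> C" for l using pq that by (auto simp: cls_def)
      have "K (tset a) (p', q) = K (tset a) (p, q)" if "a < i" for a
        unfolding K_def using tC[OF that] eq by (intro sum.cong) (auto simp: P_def Q_def)
      then show "(p', q) \<in> A"
        using pq eq ZC by (auto simp: A_def CC_def P_def Q_def cls_def)
    next
      fix \<omega> \<omega>' l assume \<omega>: "\<omega> \<in> A" "\<omega>' \<in> A" and l: "l \<in> C"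
      have \<omega>2: "\<omega> \<in> \<Omega>2" "\<omega>' \<in> \<Omega>2" using \<omega> CC_sub unfolding A_def by blast+
      show "V (fst \<omega>') l \<in> ssums (V (fst \<omega>)) C"
      proof (cases "l \<in> Z")
        case True
        then have "V (fst \<omega>') l = V (fst \<omega>) l" using \<omega> by (auto simp: A_def CC_def P_def)
        then show ?thesis using ssums_base[OF l] by metis
      next
        case False
        then obtain a where a: "a < i" "l \<in> tset a"
          using l \<open>\<phi> j \<inter> {..<i} = {}\<close> by (auto simp: C_def B_def blk_def tset_def)
        have "K (tset a) \<omega> = K (tset a) \<omega>'" using \<omega> a by (auto simp: A_def CC_def)
        then have "P \<omega>' l \<in> ssums (P \<omega>) (tset a)" using P_span[OF \<omega>2 tset_sub] a by blast
        then show ?thesis using ssums_mono[OF tC[OF a(1)]] by (auto simp: P_def)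
      qed
    qed (use B j k in \<open>auto simp: A_def C_def\<close>)
    then show ?thesis by (simp add: A_def P_def)
  next
    case False
    have shift: "(\<Sum>\<omega>\<in>A. H (P \<omega> l') (sum (P \<omega>) E)) = (\<Sum>\<omega>\<in>A. H (P \<omega> l') (P \<omega> l) :: real)"
      if "E \<subseteq> B" "l \<in> E" "l' < R" "l' \<noteq> l" for H E l l'
      unfolding A_def by (rule P_shift[OF Z, of E i j]) (use that in \<open>auto simp: B_def\<close>)
    have pair: "(\<Sum>\<omega>\<in>A. H (P \<omega> l') (P \<omega> l)) = (\<Sum>\<omega>\<in>A. H (P \<omega> l') (P \<omega> m) :: real)"
      if "l \<in> B" "m \<in> B" "l' < R" "l' \<noteq> l" "l' \<noteq> m" for H l m l'
      using shift[of "{l, m}" l l' H] shift[of "{l, m}" m l' H] that by simp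
    \<comment> \<open>Every nonempty sum over \<open>B\<close> has the law of
      \<open>P \<omega> j\<close>; the sum over \<open>{j, l}\<close> serves to compare the two
      single vectors.\<close>
    have zeroE: "(\<Sum>\<omega>\<in>A. G (sum (P \<omega>) E)) = 0" if E: "E \<subseteq> B" "E \<noteq> {}" for E
    proof (cases "E = {j}")
      case True
      then show ?thesis using zero by (simp add: A_def)
    next
      case False
      then obtain l where l: "l \<in> E" "l \<noteq> j" using E by blast
      have lR: "l < R" "l \<in> B" using l E B by auto
      have "(\<Sum>\<omega>\<in>A. G (sum (P \<omega>) E)) = (\<Sum>\<omega>\<in>A. G (P \<omega> l))"
        using shift[of E l j "\<lambda>_. G"] E l j by simp
      also have "\<dots> = (\<Sum>\<omega>\<in>A. G (sum (P \<omega>) {j, l}))"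
        using shift[of "{j, l}" l j "\<lambda>_. G"] lR l j B by simp
      also have "\<dots> = (\<Sum>\<omega>\<in>A. G (P \<omega> j))"
        using shift[of "{j, l}" j l "\<lambda>_. G"] lR l j B by simp
      finally show ?thesis using zero by (simp add: A_def)
    qed
    show ?thesis
    proof (cases "A = {}")
      case True
      then show ?thesis by (simp add: A_def)
    next
      case A_ne: False
      then obtain \<omega>1 where \<omega>1: "\<omega>1 \<in> A" by blast
      have sp: "ssums (P \<omega>) B \<subseteq> ssums (P \<omega>') B" if \<omega>: "\<omega> \<in> A" "\<omega>' \<in> A" for \<omega> \<omega>'
      proof (rule ssums_minimal[OF subspace_ssums[OF B(2)]])
        fix l assume l: "l \<in> B"
        have \<omega>2: "\<omega> \<in> \<Omega>2" "\<omega>' \<in> \<Omega>2" using \<omega> CC_sub unfolding A_def by blast+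
        have "K B \<omega>' = K B \<omega>"
          unfolding B_def using CC_K_eq \<omega> j False Z unfolding A_def by blast
        then show "P \<omega> l \<in> ssums (P \<omega>') B" using P_span[OF \<omega>2(2,1) B(1)] l by blast
      qed
      have const: "(\<Sum>E\<in>Pow B - {{}}. G (sum (P \<omega>) E)) = (\<Sum>t\<in>ssums (P \<omega>1) B - {0}. G t)"
        if \<omega>: "\<omega> \<in> A" for \<omega>
      proof -
        have \<omega>2: "\<omega> \<in> \<Omega>2" using \<omega> CC_sub unfolding A_def by blast
        have inj: "inj_on (sum (P \<omega>)) (Pow B)"
          using indep_sum_inj[OF P_indep[OF \<omega>2]] B by (intro inj_onI) (metis Pow_iff subset_trans)
        have "sum (P \<omega>) ` (Pow B - {{}}) = ssums (P \<omega>) B - {0}"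
          unfolding ssums_def using inj
          by (subst inj_on_image_set_diff[of _ "Pow B"]) auto
        moreover have "ssums (P \<omega>) B = ssums (P \<omega>1) B" using sp \<omega> \<omega>1 by blast
        ultimately show ?thesis
          using inj by (subst sum.reindex[of "sum (P \<omega>)" "Pow B - {{}}" G, symmetric, unfolded o_def])
            (auto intro: inj_on_subset)
      qed
      have "(\<Sum>\<omega>\<in>A. G (P \<omega> j) * G (P \<omega> k)) \<le> 0"
      proof (rule orbit_negative_correlation[where I = "Pow B - {{}}" and ?e0.0 = "{j}" and ?e1.0 = "{k}"
            and g = "\<lambda>E \<omega>. G (sum (P \<omega>) E)" and A = A])
        fix E assume E: "E \<in> Pow B - {{}}" "E \<noteq> {j}"
        then obtain l where l: "l \<in> E" "l \<noteq> j" by blast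
        have lB: "l \<in> B" using l E by blast
        have "(\<Sum>\<omega>\<in>A. G (P \<omega> j) * G (sum (P \<omega>) E)) = (\<Sum>\<omega>\<in>A. G (P \<omega> j) * G (P \<omega> l))"
          using shift[of E l j "\<lambda>x y. G x * G y"] l j E by auto
        also have "\<dots> = (\<Sum>\<omega>\<in>A. G (P \<omega> j) * G (P \<omega> k))"
          using pair[of l k j "\<lambda>x y. G x * G y"] lB B l j k by auto
        finally show "(\<Sum>\<omega>\<in>A. G (sum (P \<omega>) {j}) * G (sum (P \<omega>) E)) = (\<Sum>\<omega>\<in>A. G (P \<omega> j) * G (P \<omega> k))"
          by simp
      qed (use B k zeroE const in \<open>auto simp: A_def\<close>)
      moreover have "0 \<le> lam * (\<Sum>\<omega>\<in>A. (G (P \<omega> j))\<^sup>2)" using lam0 by (simp add: sum_nonneg)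
      ultimately show ?thesis by (simp add: A_def)
    qed
  qed
qed

text \<open>The subsets of \<open>S - {j}\<close> give at least \<open>2 ^ s\<close> transvections
  that move \<open>P \<omega> j\<close> and fix \<open>K T\<close>. Two translates differ by a
  nonempty sum over the block, so \<open>P_pair\<close> bounds their correlation and Bessel's
  inequality applies.\<close>

lemma P_step:
  assumes Z: "Z \<subseteq> {..<R}" and S: "j \<in> S" "S \<subseteq> blk i j - Z" "card S > s"
    and T: "T \<subseteq> {..<R}" "S \<subseteq> T \<or> S \<inter> T = {}"
    and zero: "(\<Sum>\<omega>\<in>CC i Z \<omega>0. G (P \<omega> j)) = (0::real)"
  shows "\<bar>\<Sum>\<omega>\<in>CC i Z \<omega>0. F (K T \<omega>) * G (P \<omega> j)\<bar> \<le> sqrt (1 / 2 ^ s + lam) *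
     sqrt (\<Sum>\<omega>\<in>CC i Z \<omega>0. (F (K T \<omega>))\<^sup>2) * sqrt (\<Sum>\<omega>\<in>CC i Z \<omega>0. (G (P \<omega> j))\<^sup>2)"
proof -
  define A where "A = CC i Z \<omega>0"
  have SR: "S \<subseteq> {..<R}" using S(2) blk_sub[of i j] by blast
  have j: "j < R" "j \<notin> Z" using S(1,2) SR by auto
  have finS: "finite S" using SR finite_subset by auto
  have "\<forall>D\<in>Pow (S - {j}). \<exists>\<Theta>. bij_betw \<Theta> A A \<and>
    (\<forall>\<omega>\<in>A. \<forall>k<R. P (\<Theta> \<omega>) k = (if k = j then P \<omega> j + sum (P \<omega>) D else P \<omega> k)) \<and>
    (\<forall>\<omega>\<in>A. K T (\<Theta> \<omega>) = K T \<omega>)"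
  proof
    fix D assume "D \<in> Pow (S - {j})"
    then have DS: "insert j D \<subseteq> S" "j \<notin> D" using S(1) by blast+
    then have jD: "insert j D \<subseteq> blk i j - Z" "j \<notin> D" "insert j D \<subseteq> T \<or> insert j D \<inter> T = {}"
      using S(2) T(2) by blast+
    obtain \<Theta> where "bij_betw \<Theta> A A"
      "\<And>\<omega> k. \<omega> \<in> A \<Longrightarrow> k < R \<Longrightarrow> P (\<Theta> \<omega>) k = (if k = j then P \<omega> j + sum (P \<omega>) D else P \<omega> k)"
      "\<And>\<omega> T. \<omega> \<in> A \<Longrightarrow> T \<subseteq> {..<R} \<Longrightarrow> insert j D \<subseteq> T \<or> insert j D \<inter> T = {} \<Longrightarrow> K T (\<Theta> \<omega>) = K T \<omega>"
      unfolding A_def using CC_two_sided[OF Z jD(1,2), of \<omega>0] by blast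
    then show "\<exists>\<Theta>. bij_betw \<Theta> A A \<and>
      (\<forall>\<omega>\<in>A. \<forall>k<R. P (\<Theta> \<omega>) k = (if k = j then P \<omega> j + sum (P \<omega>) D else P \<omega> k)) \<and>
      (\<forall>\<omega>\<in>A. K T (\<Theta> \<omega>) = K T \<omega>)"
      using jD(3) T(1) by blast
  qed
  from bchoice[OF this] obtain \<Theta> where \<Theta>0: "\<forall>D\<in>Pow (S - {j}). bij_betw (\<Theta> D) A A \<and>
    (\<forall>\<omega>\<in>A. \<forall>k<R. P (\<Theta> D \<omega>) k = (if k = j then P \<omega> j + sum (P \<omega>) D else P \<omega> k)) \<and>
    (\<forall>\<omega>\<in>A. K T (\<Theta> D \<omega>) = K T \<omega>)" by blast
  have \<Theta>: "bij_betw (\<Theta> D) A A"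
    "\<omega> \<in> A \<Longrightarrow> k < R \<Longrightarrow> P (\<Theta> D \<omega>) k = (if k = j then P \<omega> j + sum (P \<omega>) D else P \<omega> k)"
    "\<omega> \<in> A \<Longrightarrow> K T (\<Theta> D \<omega>) = K T \<omega>" if "D \<subseteq> S - {j}" for D \<omega> k
    using \<Theta>0 that by blast+
  have "\<bar>\<Sum>\<omega>\<in>A. F (K T \<omega>) * G (P \<omega> j)\<bar> \<le> sqrt (1 / card (Pow (S - {j})) + lam) *
     sqrt (\<Sum>\<omega>\<in>A. (F (K T \<omega>))\<^sup>2) * sqrt (\<Sum>\<omega>\<in>A. (G (P \<omega> j))\<^sup>2)"
  proof (rule almost_orthogonal_bound[where \<theta> = \<Theta>])
    fix D D' assume D: "D \<in> Pow (S - {j})" "D' \<in> Pow (S - {j})" "D \<noteq> D'"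
    define E where "E = sym_diff D D'"
    have E: "E \<subseteq> S - {j}" "E \<noteq> {}" using D by (auto simp: E_def)
    have finD: "finite D" "finite D'" "finite E" using D finS E by (auto intro: finite_subset)
    obtain k where k: "k \<in> E" using E by blast
    have kB: "k \<in> blk i j - Z" "k \<noteq> j" using k E S by auto
    have EB: "insert j E \<subseteq> blk i j - Z" using E S by auto
    \<comment> \<open>Seen from the frame moved by \<open>D\<close>, the one moved by
      \<open>D'\<close> has its vector at \<open>j\<close> shifted by the sum over the symmetric
      difference, so reindexing removes one of the two translations.\<close>
    have "(\<Sum>\<omega>\<in>A. G (P (\<Theta> D \<omega>) j) * G (P (\<Theta> D' \<omega>) j)) =
        (\<Sum>\<omega>\<in>A. G (P (\<Theta> D \<omega>) j) * G (sum (P (\<Theta> D \<omega>)) (insert j E)))"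
    proof (rule sum.cong[OF refl])
      fix \<omega> assume \<omega>: "\<omega> \<in> A"
      have "sum (P (\<Theta> D \<omega>)) E = sum (P \<omega>) E"
      proof (rule sum.cong[OF refl])
        fix l assume "l \<in> E"
        then have "l < R" "l \<noteq> j" using E SR by auto
        then show "P (\<Theta> D \<omega>) l = P \<omega> l" using \<Theta>(2)[of D \<omega> l] D \<omega> by auto
      qed
      also have "\<dots> = sum (P \<omega>) D + sum (P \<omega>) D'" unfolding E_def by (rule sum_symdiff[OF finD(1,2)])
      finally have "sum (P (\<Theta> D \<omega>)) (insert j E) = (P \<omega> j + sum (P \<omega>) D) + (sum (P \<omega>) D + sum (P \<omega>) D')"
        using \<Theta>(2)[of D \<omega> j] D(1) \<omega> j E(1) finD(3) by (subst sum.insert) auto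
      also have "\<dots> = P \<omega> j + sum (P \<omega>) D'" by (simp add: add.assoc)
      also have "\<dots> = P (\<Theta> D' \<omega>) j" using \<Theta>(2)[of D' \<omega> j] D \<omega> j by auto
      finally show "G (P (\<Theta> D \<omega>) j) * G (P (\<Theta> D' \<omega>) j) = G (P (\<Theta> D \<omega>) j) * G (sum (P (\<Theta> D \<omega>)) (insert j E))"
        by simp
    qed
    also have "\<dots> = (\<Sum>\<omega>\<in>A. G (P \<omega> j) * G (sum (P \<omega>) (insert j E)))"
      using D by (intro sum.reindex_bij_betw \<Theta>(1)) auto
    also have "\<dots> = (\<Sum>\<omega>\<in>A. G (P \<omega> j) * G (P \<omega> k))"
      unfolding A_def using P_shift[OF Z EB, of k j "\<lambda>x y. G x * G y" \<omega>0] k j kB by auto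
    also have "\<dots> \<le> lam * (\<Sum>\<omega>\<in>A. (G (P \<omega> j))\<^sup>2)"
      unfolding A_def by (rule P_pair[OF Z j kB zero])
    finally show "(\<Sum>\<omega>\<in>A. G (P (\<Theta> D \<omega>) j) * G (P (\<Theta> D' \<omega>) j)) \<le> lam * (\<Sum>\<omega>\<in>A. (G (P \<omega> j))\<^sup>2)" .
  qed (use finS lam0 \<Theta> in auto)
  also have "\<dots> \<le> sqrt (1 / 2 ^ s + lam) *
     sqrt (\<Sum>\<omega>\<in>A. (F (K T \<omega>))\<^sup>2) * sqrt (\<Sum>\<omega>\<in>A. (G (P \<omega> j))\<^sup>2)"
  proof -
    have "card (S - {j}) \<ge> s" using S finS by simp
    then have "(2::real) ^ s \<le> 2 ^ card (S - {j})" by (intro power_increasing) auto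
    then have "1 / real (card (Pow (S - {j}))) \<le> 1 / 2 ^ s"
      using finS by (simp add: card_Pow frac_le)
    then show ?thesis by (intro mult_right_mono) (auto simp: sum_nonneg)
  qed
  finally show ?thesis by (simp add: A_def)
qed

end

section \<open>Revealing vectors of the right tuple once the left one is known\<close>

context tensor_step
begin

text \<open>Unlike in \<open>P_shift\<close>, the set \<open>E\<close> must avoid \<open>j\<close>:
  the companion action adds \<open>P \<omega> k\<close> to the left vectors at
  \<open>E - {k}\<close>, and the left vector at \<open>j\<close> is already revealed.\<close>

lemma Q_shift:
  assumes Z: "Z \<subseteq> {..<R}" and E: "E \<subseteq> blk i j - Z - {j}" "k \<in> E" and j: "j < R"
  shows "(\<Sum>\<omega>\<in>CP i Z j \<omega>0. H (Q \<omega> j) (sum (Q \<omega>) E)) = (\<Sum>\<omega>\<in>CP i Z j \<omega>0. H (Q \<omega> j) (Q \<omega> k) :: real)"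
proof -
  have h: "insert k (E - {k}) \<subseteq> blk i j - Z" "k \<notin> E - {k}" "j \<notin> E - {k}" "j \<noteq> k" using E by blast+
  have "E \<subseteq> {..<R}" using E(1) blk_sub[of i j] by blast
  then have finE: "finite E" and kR: "k < R" using E(2) finite_subset[of E "{..<R}"] by auto
  obtain \<Theta> where \<Theta>: "bij_betw \<Theta> (CP i Z j \<omega>0) (CP i Z j \<omega>0)"
    "\<And>\<omega> l. \<omega> \<in> CP i Z j \<omega>0 \<Longrightarrow> l < R \<Longrightarrow> Q (\<Theta> \<omega>) l = (if l = k then Q \<omega> k + sum (Q \<omega>) (E - {k}) else Q \<omega> l)"
    "\<And>\<omega> T. \<omega> \<in> CP i Z j \<omega>0 \<Longrightarrow> T \<subseteq> {..<R} \<Longrightarrow>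
      insert k (E - {k}) \<subseteq> T \<or> insert k (E - {k}) \<inter> T = {} \<Longrightarrow> K T (\<Theta> \<omega>) = K T \<omega>"
    by (rule CP_two_sided_swap[OF Z h(1,2) j h(3), where ?\<omega>0.0 = \<omega>0]) (rule that)
  have "(\<Sum>\<omega>\<in>CP i Z j \<omega>0. H (Q \<omega> j) (Q \<omega> k)) = (\<Sum>\<omega>\<in>CP i Z j \<omega>0. H (Q (\<Theta> \<omega>) j) (Q (\<Theta> \<omega>) k))"
    by (rule sum.reindex_bij_betw[OF \<Theta>(1), of "\<lambda>\<omega>. H (Q \<omega> j) (Q \<omega> k)", symmetric])
  also have "\<dots> = (\<Sum>\<omega>\<in>CP i Z j \<omega>0. H (Q \<omega> j) (sum (Q \<omega>) E))"
  proof (rule sum.cong[OF refl])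
    fix \<omega> assume \<omega>: "\<omega> \<in> CP i Z j \<omega>0"
    have "Q (\<Theta> \<omega>) k = sum (Q \<omega>) E"
      unfolding sum.remove[OF finE E(2), of "Q \<omega>"] using \<Theta>(2)[OF \<omega> kR] by (simp only: refl if_True)
    moreover have "Q (\<Theta> \<omega>) j = Q \<omega> j" using \<Theta>(2)[OF \<omega> j] h(4) by simp
    ultimately show "H (Q (\<Theta> \<omega>) j) (Q (\<Theta> \<omega>) k) = H (Q \<omega> j) (sum (Q \<omega>) E)" by simp
  qed
  finally show ?thesis by simp
qed

lemma Q_translate:
  assumes Z: "Z \<subseteq> {..<R}" and j: "j < R" "j \<notin> Z" and D: "D \<subseteq> blk i j - Z - {j}"
  obtains \<Theta> where "bij_betw \<Theta> (CP i Z j \<omega>0) (CP i Z j \<omega>0)"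
    "\<And>\<omega> l. \<omega> \<in> CP i Z j \<omega>0 \<Longrightarrow> l < R \<Longrightarrow> Q (\<Theta> \<omega>) l = (if l = j then Q \<omega> j + sum (Q \<omega>) D else Q \<omega> l)"
    "\<And>\<omega> T. \<omega> \<in> CP i Z j \<omega>0 \<Longrightarrow> T \<subseteq> {..<R} \<Longrightarrow>
      insert j D \<subseteq> T \<or> insert j D \<inter> T = {} \<Longrightarrow> K T (\<Theta> \<omega>) = K T \<omega>"
proof -
  have h: "insert j D \<subseteq> blk i j - Z" "j \<notin> D" using D j by (auto simp: blk_def)
  show ?thesis
    by (rule CP_two_sided_swap[OF Z h j(1) h(2), where ?\<omega>0.0 = \<omega>0]) (rule that)
qed

text \<open>As in \<open>P_pair\<close>, with one change: since the left vector at \<open>j\<close>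
  is known, a fixed tensor sum confines \<open>Q \<omega> j\<close> to a coset of the span of the
  other right vectors of the block. This coset is now the exchangeable family, and the pair is
  stated through a translate of \<open>Q \<omega> j\<close>.\<close>

lemma Q_pair:
  assumes Z: "Z \<subseteq> {..<R}" and j: "j < R" "j \<notin> Z" and D: "D \<subseteq> blk i j - Z - {j}" "D \<noteq> {}"
    and zero: "(\<Sum>\<omega>\<in>CP i Z j \<omega>0. G (Q \<omega> j)) = (0::real)"
  shows "(\<Sum>\<omega>\<in>CP i Z j \<omega>0. G (Q \<omega> j) * G (Q \<omega> j + sum (Q \<omega>) D)) \<le> lam * (\<Sum>\<omega>\<in>CP i Z j \<omega>0. (G (Q \<omega> j))\<^sup>2)"
proof -
  define A where "A = CP i Z j \<omega>0"
  define B where "B = blk i j - Z"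
  have B: "B \<subseteq> {..<R}" "finite B" "j \<in> B"
    using j blk_sub by (auto simp: B_def blk_def intro: finite_subset)
  have A2: "\<omega> \<in> \<Omega>2" if "\<omega> \<in> A" for \<omega>
    using that CC_sub CP_sub unfolding A_def by blast
  obtain k where k: "k \<in> D" using D by blast
  have kB: "k \<in> B" "k \<noteq> j" "k < R" using k D B by (auto simp: B_def)
  have finD: "finite D" using D B finite_subset[of D B] by (auto simp: B_def)
  show ?thesis
  proof (cases "\<phi> j \<inter> {..<i} = {}")
    case True
    define C where "C = {..<R} - B"
    have tC: "tset a \<subseteq> C" if "a < i" for a
      using that True by (auto simp: tset_def C_def B_def blk_def)
    have ZC: "Z \<subseteq> C" using Z by (auto simp: C_def B_def)
    have kC: "k \<notin> C" using kB by (simp add: C_def)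
    \<comment> \<open>Adding the sum over \<open>D'\<close> to the right vector at \<open>k\<close>
      produces \<open>Q \<omega> j\<close> plus the sum over \<open>D\<close>. As \<open>k\<close>
      lies outside \<open>C\<close>, the event permits this on the right tuple alone.\<close>
    define D' where "D' = insert j (D - {k})"
    have D': "D' \<subseteq> {..<R}" "k \<notin> D'" using D B kB j by (auto simp: D'_def B_def)
    have closed: "(p, q') \<in> A" if pq: "(p, q) \<in> A" "q' \<in> \<Omega>" and eq: "\<And>l. l \<in> C \<Longrightarrow> V q' l = V q l" for p q q'
    proof -
      have "K (tset a) (p, q') = K (tset a) (p, q)" if "a < i" for a
        unfolding K_def using tC[OF that] eq by (intro sum.cong) (auto simp: P_def Q_def)
      then show ?thesis
        using pq eq ZC by (auto simp: A_def CP_def CC_def P_def Q_def)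
    qed
    obtain \<theta> where \<theta>: "bij_betw \<theta> \<Omega> \<Omega>" "\<And>\<omega> l. \<omega> \<in> \<Omega> \<Longrightarrow> l < R \<Longrightarrow>
        V (\<theta> \<omega>) l = (if l = k then V \<omega> k + sum (V \<omega>) D' else V \<omega> l)"
      using transvection[OF kB(3) D'] by blast
    have bij: "bij_betw (map_prod id \<theta>) A A"
    proof (rule bij_betw_invariant[where X = \<Omega>2])
      show "bij_betw (map_prod id \<theta>) \<Omega>2 \<Omega>2" using \<theta>(1) by (intro bij_betw_map_prod) auto
      show "A \<subseteq> \<Omega>2" using A2 by blast
      fix \<omega> assume \<omega>: "\<omega> \<in> \<Omega>2"
      obtain p q where pq: "\<omega> = (p, q)" "p \<in> \<Omega>" "q \<in> \<Omega>" using \<omega> by auto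
      have q': "\<theta> q \<in> \<Omega>" using \<theta>(1) pq by (auto simp: bij_betw_def)
      have eq: "V (\<theta> q) l = V q l" if "l \<in> C" for l
      proof -
        have "l < R" "l \<noteq> k" using that kC by (auto simp: C_def)
        then show ?thesis using \<theta>(2)[OF pq(3)] by simp
      qed
      show "map_prod id \<theta> \<omega> \<in> A \<longleftrightarrow> \<omega> \<in> A"
        using closed[of p q "\<theta> q"] closed[of p "\<theta> q" q] eq q' pq by auto
    qed
    have "(\<Sum>\<omega>\<in>A. G (Q \<omega> j) * G (Q \<omega> k)) =
        (\<Sum>\<omega>\<in>A. G (Q (map_prod id \<theta> \<omega>) j) * G (Q (map_prod id \<theta> \<omega>) k))"
      by (rule sum.reindex_bij_betw[OF bij, of "\<lambda>\<omega>. G (Q \<omega> j) * G (Q \<omega> k)", symmetric])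
    also have "\<dots> = (\<Sum>\<omega>\<in>A. G (Q \<omega> j) * G (Q \<omega> j + sum (Q \<omega>) D))"
    proof (rule sum.cong[OF refl])
      fix \<omega> assume \<omega>: "\<omega> \<in> A"
      have q: "snd \<omega> \<in> \<Omega>" using A2[OF \<omega>] by auto
      have jD: "j \<notin> D - {k}" using D by auto
      have "Q (map_prod id \<theta> \<omega>) k = Q \<omega> k + sum (Q \<omega>) D'"
        using \<theta>(2)[OF q kB(3)] by (simp add: Q_def)
      also have "\<dots> = Q \<omega> k + (Q \<omega> j + sum (Q \<omega>) (D - {k}))"
        unfolding D'_def using finD jD by (subst sum.insert) auto
      also have "\<dots> = Q \<omega> j + (Q \<omega> k + sum (Q \<omega>) (D - {k}))" by (simp only: add.left_commute)
      also have "\<dots> = Q \<omega> j + sum (Q \<omega>) D" by (simp only: sum.remove[OF finD k, symmetric])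
      finally have 1: "Q (map_prod id \<theta> \<omega>) k = Q \<omega> j + sum (Q \<omega>) D" .
      have "Q (map_prod id \<theta> \<omega>) j = Q \<omega> j" using \<theta>(2)[OF q j(1)] kB by (simp add: Q_def)
      then show "G (Q (map_prod id \<theta> \<omega>) j) * G (Q (map_prod id \<theta> \<omega>) k) = G (Q \<omega> j) * G (Q \<omega> j + sum (Q \<omega>) D)"
        by (simp only: 1)
    qed
    finally have eqn: "(\<Sum>\<omega>\<in>A. G (Q \<omega> j) * G (Q \<omega> j + sum (Q \<omega>) D)) = (\<Sum>\<omega>\<in>A. G (Q \<omega> j) * G (Q \<omega> k))"
      by simp
    have "\<bar>\<Sum>\<omega>\<in>A. G (V (snd \<omega>) j) * G (V (snd \<omega>) k)\<bar> \<le> lam * (\<Sum>\<omega>\<in>A. (G (V (snd \<omega>) j))\<^sup>2)"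
    proof (rule expanding_snd[OF exp, where C = C])
      show "snd ` A \<subseteq> \<Omega>" using A2 by auto
      show "(\<Sum>\<omega>\<in>A. G (V (snd \<omega>) j)) = 0" using zero by (simp add: A_def Q_def)
    next
      fix p q q' assume "(p, q) \<in> A" "q' \<in> cls C q"
      then show "(p, q') \<in> A" using closed[of p q q'] by (auto simp: cls_def)
    next
      fix \<omega> \<omega>' l assume \<omega>: "\<omega> \<in> A" "\<omega>' \<in> A" and l: "l \<in> C"
      show "V (snd \<omega>') l \<in> ssums (V (snd \<omega>)) C"
      proof (cases "l \<in> Z")
        case True
        then have "V (snd \<omega>') l = V (snd \<omega>) l" using \<omega> by (auto simp: A_def CC_def CP_def Q_def)
        then show ?thesis using ssums_base[OF l] by metis
      next
        case False
        then obtain a where a: "a < i" "l \<in> tset a"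
          using l \<open>\<phi> j \<inter> {..<i} = {}\<close> by (auto simp: C_def B_def blk_def tset_def)
        have "K (tset a) \<omega> = K (tset a) \<omega>'" using \<omega> a by (auto simp: A_def CP_def CC_def)
        then have "Q \<omega>' l \<in> ssums (Q \<omega>) (tset a)"
          using Q_span[OF A2[OF \<omega>(1)] A2[OF \<omega>(2)] tset_sub] a by blast
        then show ?thesis using ssums_mono[OF tC[OF a(1)]] by (auto simp: Q_def)
      qed
    qed (use B j kB in \<open>auto simp: A_def C_def\<close>)
    then have "(\<Sum>\<omega>\<in>A. G (Q \<omega> j) * G (Q \<omega> k)) \<le> lam * (\<Sum>\<omega>\<in>A. (G (Q \<omega> j))\<^sup>2)" by (simp add: Q_def)
    then show ?thesis unfolding A_def[symmetric] eqn .
  next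
    case False
    have shift: "(\<Sum>\<omega>\<in>A. H (Q \<omega> j) (sum (Q \<omega>) E)) = (\<Sum>\<omega>\<in>A. H (Q \<omega> j) (Q \<omega> l) :: real)"
      if "E \<subseteq> B - {j}" "l \<in> E" for H E l
      unfolding A_def by (rule Q_shift[OF Z]) (use that j in \<open>auto simp: B_def\<close>)
    have pair: "(\<Sum>\<omega>\<in>A. H (Q \<omega> j) (Q \<omega> l)) = (\<Sum>\<omega>\<in>A. H (Q \<omega> j) (Q \<omega> m) :: real)"
      if "l \<in> B - {j}" "m \<in> B - {j}" for H l m
      using shift[of "{l, m}" l H] shift[of "{l, m}" m H] that by simp
    have zeroE: "(\<Sum>\<omega>\<in>A. G (Q \<omega> j + sum (Q \<omega>) E)) = 0" if E: "E \<subseteq> B - {j}" for E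
    proof -
      obtain \<Theta> where \<Theta>: "bij_betw \<Theta> A A"
        "\<And>\<omega> l. \<omega> \<in> A \<Longrightarrow> l < R \<Longrightarrow> Q (\<Theta> \<omega>) l = (if l = j then Q \<omega> j + sum (Q \<omega>) E else Q \<omega> l)"
        using Q_translate[OF Z j, of E i \<omega>0] E unfolding A_def B_def by metis
      have "(\<Sum>\<omega>\<in>A. G (Q \<omega> j + sum (Q \<omega>) E)) = (\<Sum>\<omega>\<in>A. G (Q (\<Theta> \<omega>) j))"
        using \<Theta>(2) j by (intro sum.cong) auto
      also have "\<dots> = (\<Sum>\<omega>\<in>A. G (Q \<omega> j))"
        by (rule sum.reindex_bij_betw[OF \<Theta>(1), of "\<lambda>\<omega>. G (Q \<omega> j)"])
      finally show ?thesis using zero by (simp add: A_def)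
    qed
    show ?thesis
    proof (cases "A = {}")
      case True
      then show ?thesis by (simp add: A_def)
    next
      case A_ne: False
      then obtain \<omega>1 where \<omega>1: "\<omega>1 \<in> A" by blast
      \<comment> \<open>\<open>X \<omega>\<close> is the coset through \<open>Q \<omega> j\<close>.
        To compare two cosets, a translation first carries the given point to position
        \<open>j\<close>, where \<open>Q_affine\<close> applies.\<close>
      define X where "X \<omega> = (\<lambda>E. Q \<omega> j + sum (Q \<omega>) E) ` Pow (B - {j})" for \<omega>
      have sub: "X \<omega>' \<subseteq> X \<omega>" if \<omega>: "\<omega> \<in> A" "\<omega>' \<in> A" for \<omega> \<omega>'
      proof
        fix t assume "t \<in> X \<omega>'"
        then obtain E where E: "E \<subseteq> B - {j}" "t = Q \<omega>' j + sum (Q \<omega>') E" by (auto simp: X_def)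
        obtain \<Theta> where \<Theta>: "bij_betw \<Theta> A A"
          "\<And>\<omega> l. \<omega> \<in> A \<Longrightarrow> l < R \<Longrightarrow> Q (\<Theta> \<omega>) l = (if l = j then Q \<omega> j + sum (Q \<omega>) E else Q \<omega> l)"
          using Q_translate[OF Z j, of E i \<omega>0] E unfolding A_def B_def by metis
        have \<omega>'': "\<Theta> \<omega>' \<in> A" using \<Theta>(1) \<omega> by (auto simp: bij_betw_def)
        have "\<omega> \<in> CC i Z \<omega>0" "\<Theta> \<omega>' \<in> CC i Z \<omega>0" using \<omega> \<omega>'' by (auto simp: A_def CP_def)
        then have "K B \<omega> = K B (\<Theta> \<omega>')" unfolding B_def using CC_K_eq j False Z by blast
        moreover have "P \<omega> j = P (\<Theta> \<omega>') j" using \<omega> \<omega>'' by (auto simp: A_def CP_def)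
        ultimately have "Q (\<Theta> \<omega>') j + Q \<omega> j \<in> ssums (Q \<omega>) (B - {j})"
          using Q_affine[OF A2[OF \<omega>(1)] A2[OF \<omega>''] B(1) _ B(3)] by blast
        then obtain F where F: "F \<subseteq> B - {j}" "t + Q \<omega> j = sum (Q \<omega>) F"
          using \<Theta>(2)[OF \<omega>(2) j(1)] E by (auto simp: ssums_def)
        have "t = Q \<omega> j + sum (Q \<omega>) F" unfolding F(2)[symmetric] by (simp add: add.left_commute)
        then show "t \<in> X \<omega>" using F(1) by (auto simp: X_def)
      qed
      have const: "(\<Sum>E\<in>Pow (B - {j}). G (Q \<omega> j + sum (Q \<omega>) E)) = (\<Sum>t\<in>X \<omega>1. G t)"
        if \<omega>: "\<omega> \<in> A" for \<omega>
      proof -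
        have inj: "inj_on (\<lambda>E. Q \<omega> j + sum (Q \<omega>) E) (Pow (B - {j}))"
        proof (rule inj_onI)
          fix E F assume EF: "E \<in> Pow (B - {j})" "F \<in> Pow (B - {j})" "Q \<omega> j + sum (Q \<omega>) E = Q \<omega> j + sum (Q \<omega>) F"
          then have "sum (Q \<omega>) E = sum (Q \<omega>) F" by simp
          moreover have "E \<subseteq> {..<R}" "F \<subseteq> {..<R}" using EF B by auto
          ultimately show "E = F" using indep_sum_inj[OF Q_indep[OF A2[OF \<omega>]]] by blast
        qed
        have "(\<Sum>t\<in>X \<omega>. G t) = (\<Sum>E\<in>Pow (B - {j}). G (Q \<omega> j + sum (Q \<omega>) E))"
          unfolding X_def by (subst sum.reindex[OF inj]) (simp add: o_def)
        moreover have "X \<omega> = X \<omega>1" using sub \<omega> \<omega>1 by blast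
        ultimately show ?thesis by simp
      qed
      have "(\<Sum>\<omega>\<in>A. G (Q \<omega> j) * G (Q \<omega> j + sum (Q \<omega>) D)) \<le> 0"
      proof (rule orbit_negative_correlation[where I = "Pow (B - {j})" and ?e0.0 = "{}" and ?e1.0 = D
            and g = "\<lambda>E \<omega>. G (Q \<omega> j + sum (Q \<omega>) E)" and A = A])
        fix E assume E: "E \<in> Pow (B - {j})" "E \<noteq> {}"
        then obtain l where l: "l \<in> E" by blast
        have lB: "l \<in> B - {j}" using l E by blast
        have DB: "D \<subseteq> B - {j}" using D by (auto simp: B_def)
        have "(\<Sum>\<omega>\<in>A. G (Q \<omega> j) * G (Q \<omega> j + sum (Q \<omega>) E)) = (\<Sum>\<omega>\<in>A. G (Q \<omega> j) * G (Q \<omega> j + Q \<omega> l))"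
          using shift[of E l "\<lambda>x y. G x * G (x + y)"] l E by auto
        also have "\<dots> = (\<Sum>\<omega>\<in>A. G (Q \<omega> j) * G (Q \<omega> j + Q \<omega> k))"
          using pair[of l k "\<lambda>x y. G x * G (x + y)"] lB kB by auto
        also have "\<dots> = (\<Sum>\<omega>\<in>A. G (Q \<omega> j) * G (Q \<omega> j + sum (Q \<omega>) D))"
          using shift[of D k "\<lambda>x y. G x * G (x + y)"] k DB by auto
        finally show "(\<Sum>\<omega>\<in>A. G (Q \<omega> j + sum (Q \<omega>) {}) * G (Q \<omega> j + sum (Q \<omega>) E)) =
            (\<Sum>\<omega>\<in>A. G (Q \<omega> j) * G (Q \<omega> j + sum (Q \<omega>) D))"
          by simp
      qed (use B D zeroE const in \<open>auto simp: A_def B_def\<close>)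
      moreover have "0 \<le> lam * (\<Sum>\<omega>\<in>A. (G (Q \<omega> j))\<^sup>2)" using lam0 by (simp add: sum_nonneg)
      ultimately show ?thesis by (simp add: A_def)
    qed
  qed
qed

text \<open>The translations of \<open>Q \<omega> j\<close> leave \<open>P \<omega> j\<close> fixed,
  so the argument of \<open>P_step\<close> works inside \<open>CP\<close>.\<close>

lemma Q_step:
  assumes Z: "Z \<subseteq> {..<R}" and S: "j \<in> S" "S \<subseteq> blk i j - Z" "card S > s"
    and T: "T \<subseteq> {..<R}" "S \<subseteq> T \<or> S \<inter> T = {}"
    and zero: "(\<Sum>\<omega>\<in>CP i Z j \<omega>0. G (Q \<omega> j)) = (0::real)"
  shows "\<bar>\<Sum>\<omega>\<in>CP i Z j \<omega>0. F (K T \<omega>) * G (Q \<omega> j)\<bar> \<le> sqrt (1 / 2 ^ s + lam) *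
     sqrt (\<Sum>\<omega>\<in>CP i Z j \<omega>0. (F (K T \<omega>))\<^sup>2) * sqrt (\<Sum>\<omega>\<in>CP i Z j \<omega>0. (G (Q \<omega> j))\<^sup>2)"
proof -
  define A where "A = CP i Z j \<omega>0"
  have SR: "S \<subseteq> {..<R}" using S(2) blk_sub[of i j] by blast
  have j: "j < R" "j \<notin> Z" using S(1,2) SR by auto
  have finS: "finite S" using SR finite_subset by auto
  have "\<forall>D\<in>Pow (S - {j}). \<exists>\<Theta>. bij_betw \<Theta> A A \<and>
    (\<forall>\<omega>\<in>A. \<forall>k<R. Q (\<Theta> \<omega>) k = (if k = j then Q \<omega> j + sum (Q \<omega>) D else Q \<omega> k)) \<and>
    (\<forall>\<omega>\<in>A. K T (\<Theta> \<omega>) = K T \<omega>)"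
  proof
    fix D assume "D \<in> Pow (S - {j})"
    then have DS: "insert j D \<subseteq> S" "D \<subseteq> blk i j - Z - {j}" using S(1,2) by blast+
    then have jD: "insert j D \<subseteq> T \<or> insert j D \<inter> T = {}" using T(2) by blast
    obtain \<Theta> where "bij_betw \<Theta> A A"
      "\<And>\<omega> k. \<omega> \<in> A \<Longrightarrow> k < R \<Longrightarrow> Q (\<Theta> \<omega>) k = (if k = j then Q \<omega> j + sum (Q \<omega>) D else Q \<omega> k)"
      "\<And>\<omega> T. \<omega> \<in> A \<Longrightarrow> T \<subseteq> {..<R} \<Longrightarrow> insert j D \<subseteq> T \<or> insert j D \<inter> T = {} \<Longrightarrow> K T (\<Theta> \<omega>) = K T \<omega>"
      by (rule Q_translate[OF Z j DS(2), where ?\<omega>0.0 = \<omega>0, folded A_def]) (rule that)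
    then show "\<exists>\<Theta>. bij_betw \<Theta> A A \<and>
      (\<forall>\<omega>\<in>A. \<forall>k<R. Q (\<Theta> \<omega>) k = (if k = j then Q \<omega> j + sum (Q \<omega>) D else Q \<omega> k)) \<and>
      (\<forall>\<omega>\<in>A. K T (\<Theta> \<omega>) = K T \<omega>)"
      using jD T(1) by blast
  qed
  from bchoice[OF this] obtain \<Theta> where \<Theta>0: "\<forall>D\<in>Pow (S - {j}). bij_betw (\<Theta> D) A A \<and>
    (\<forall>\<omega>\<in>A. \<forall>k<R. Q (\<Theta> D \<omega>) k = (if k = j then Q \<omega> j + sum (Q \<omega>) D else Q \<omega> k)) \<and>
    (\<forall>\<omega>\<in>A. K T (\<Theta> D \<omega>) = K T \<omega>)" by blast
  have \<Theta>: "bij_betw (\<Theta> D) A A"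
    "\<omega> \<in> A \<Longrightarrow> k < R \<Longrightarrow> Q (\<Theta> D \<omega>) k = (if k = j then Q \<omega> j + sum (Q \<omega>) D else Q \<omega> k)"
    "\<omega> \<in> A \<Longrightarrow> K T (\<Theta> D \<omega>) = K T \<omega>" if "D \<subseteq> S - {j}" for D \<omega> k
    using \<Theta>0 that by blast+
  have "\<bar>\<Sum>\<omega>\<in>A. F (K T \<omega>) * G (Q \<omega> j)\<bar> \<le> sqrt (1 / card (Pow (S - {j})) + lam) *
     sqrt (\<Sum>\<omega>\<in>A. (F (K T \<omega>))\<^sup>2) * sqrt (\<Sum>\<omega>\<in>A. (G (Q \<omega> j))\<^sup>2)"
  proof (rule almost_orthogonal_bound[where \<theta> = \<Theta>])
    fix D D' assume D: "D \<in> Pow (S - {j})" "D' \<in> Pow (S - {j})" "D \<noteq> D'"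
    define E where "E = sym_diff D D'"
    have E: "E \<subseteq> S - {j}" "E \<noteq> {}" using D by (auto simp: E_def)
    have finD: "finite D" "finite D'" "finite E" using D finS E by (auto intro: finite_subset)
    have EB: "E \<subseteq> blk i j - Z - {j}" using E S by auto
    have "(\<Sum>\<omega>\<in>A. G (Q (\<Theta> D \<omega>) j) * G (Q (\<Theta> D' \<omega>) j)) =
        (\<Sum>\<omega>\<in>A. G (Q (\<Theta> D \<omega>) j) * G (Q (\<Theta> D \<omega>) j + sum (Q (\<Theta> D \<omega>)) E))"
    proof (rule sum.cong[OF refl])
      fix \<omega> assume \<omega>: "\<omega> \<in> A"
      have "sum (Q (\<Theta> D \<omega>)) E = sum (Q \<omega>) E"
      proof (rule sum.cong[OF refl])
        fix l assume "l \<in> E"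
        then have "l < R" "l \<noteq> j" using E SR by auto
        then show "Q (\<Theta> D \<omega>) l = Q \<omega> l" using \<Theta>(2)[of D \<omega> l] D \<omega> by auto
      qed
      also have "\<dots> = sum (Q \<omega>) D + sum (Q \<omega>) D'" unfolding E_def by (rule sum_symdiff[OF finD(1,2)])
      finally have "Q (\<Theta> D \<omega>) j + sum (Q (\<Theta> D \<omega>)) E = (Q \<omega> j + sum (Q \<omega>) D) + (sum (Q \<omega>) D + sum (Q \<omega>) D')"
        using \<Theta>(2)[of D \<omega> j] D(1) \<omega> j by auto
      also have "\<dots> = Q \<omega> j + sum (Q \<omega>) D'" by (simp add: add.assoc)
      also have "\<dots> = Q (\<Theta> D' \<omega>) j" using \<Theta>(2)[of D' \<omega> j] D \<omega> j by auto
      finally show "G (Q (\<Theta> D \<omega>) j) * G (Q (\<Theta> D' \<omega>) j) = G (Q (\<Theta> D \<omega>) j) * G (Q (\<Theta> D \<omega>) j + sum (Q (\<Theta> D \<omega>)) E)"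
        by simp
    qed
    also have "\<dots> = (\<Sum>\<omega>\<in>A. G (Q \<omega> j) * G (Q \<omega> j + sum (Q \<omega>) E))"
      using D by (intro sum.reindex_bij_betw[where g = "\<lambda>\<omega>. G (Q \<omega> j) * G (Q \<omega> j + sum (Q \<omega>) E)"] \<Theta>(1)) auto
    also have "\<dots> \<le> lam * (\<Sum>\<omega>\<in>A. (G (Q \<omega> j))\<^sup>2)"
      unfolding A_def by (rule Q_pair[OF Z j EB E(2) zero])
    finally show "(\<Sum>\<omega>\<in>A. G (Q (\<Theta> D \<omega>) j) * G (Q (\<Theta> D' \<omega>) j)) \<le> lam * (\<Sum>\<omega>\<in>A. (G (Q \<omega> j))\<^sup>2)" .
  qed (use finS lam0 \<Theta> in auto)
  also have "\<dots> \<le> sqrt (1 / 2 ^ s + lam) *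
     sqrt (\<Sum>\<omega>\<in>A. (F (K T \<omega>))\<^sup>2) * sqrt (\<Sum>\<omega>\<in>A. (G (Q \<omega> j))\<^sup>2)"
  proof -
    have "card (S - {j}) \<ge> s" using S finS by simp
    then have "(2::real) ^ s \<le> 2 ^ card (S - {j})" by (intro power_increasing) auto
    then have "1 / real (card (Pow (S - {j}))) \<le> 1 / 2 ^ s"
      using finS by (simp add: card_Pow frac_le)
    then show ?thesis by (intro mult_right_mono) (auto simp: sum_nonneg)
  qed
  finally show ?thesis by (simp add: A_def)
qed

text \<open>
  Revealing the frame vectors with index \<open>j\<close>, first on the left and then on the right, costs
  little as long as one of the two sums still contains many unrevealed frame vectors.
\<close>

lemma reveal:
  assumes Z: "Z \<subseteq> {..<R}" and S: "j \<in> S" "S \<subseteq> blk i j - Z" "card S > s"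
    and T: "T \<subseteq> {..<R}" "S \<subseteq> T \<or> S \<inter> T = {}" and c1: "c1 \<ge> 0"
    and IH: "\<And>\<omega>1. \<omega>1 \<in> CC i Z \<omega>0 \<Longrightarrow> corr_le c1 (CC i (insert j Z) \<omega>1) (\<lambda>\<omega>. F (K T \<omega>)) g"
  shows "corr_le (c1 + 2 * sqrt (1 / 2 ^ s + lam)) (CC i Z \<omega>0) (\<lambda>\<omega>. F (K T \<omega>)) g"
proof -
  let ?c = "sqrt (1 / 2 ^ s + lam)"
  have c: "?c \<ge> 0" using lam0 by simp
  have "corr_le (c1 + ?c + ?c) (CC i Z \<omega>0) (\<lambda>\<omega>. F (K T \<omega>)) g"
  proof (rule corr_le_fibres[where z = "\<lambda>\<omega>. P \<omega> j"])
    fix v assume "v \<in> (\<lambda>\<omega>. P \<omega> j) ` CC i Z \<omega>0"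
    then obtain \<omega>1 where \<omega>1: "\<omega>1 \<in> CC i Z \<omega>0" "v = P \<omega>1 j" by auto
    have eq: "{\<omega> \<in> CC i Z \<omega>0. P \<omega> j = v} = CP i Z j \<omega>1"
      using \<omega>1 by (auto simp: CP_def CC_def)
    have "corr_le (c1 + ?c) (CP i Z j \<omega>1) (\<lambda>\<omega>. F (K T \<omega>)) g"
    proof (rule corr_le_fibres[where z = "\<lambda>\<omega>. Q \<omega> j"])
      fix v' assume "v' \<in> (\<lambda>\<omega>. Q \<omega> j) ` CP i Z j \<omega>1"
      then obtain \<omega>2 where \<omega>2: "\<omega>2 \<in> CP i Z j \<omega>1" "v' = Q \<omega>2 j" by auto
      have eq2: "{\<omega> \<in> CP i Z j \<omega>1. Q \<omega> j = v'} = CC i (insert j Z) \<omega>2"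
        using \<omega>2 \<omega>1 by (auto simp: CP_def CC_def)
      have "\<omega>2 \<in> CC i Z \<omega>0" using \<omega>2 \<omega>1 by (auto simp: CP_def CC_def)
      then show "corr_le c1 {\<omega> \<in> CP i Z j \<omega>1. Q \<omega> j = v'} (\<lambda>\<omega>. F (K T \<omega>)) g"
        unfolding eq2 by (rule IH)
    next
      fix G :: "f2vec \<Rightarrow> real" assume "(\<Sum>\<omega>\<in>CP i Z j \<omega>1. G (Q \<omega> j)) = 0"
      then show "\<bar>\<Sum>\<omega>\<in>CP i Z j \<omega>1. F (K T \<omega>) * G (Q \<omega> j)\<bar> \<le> ?c *
        sqrt (\<Sum>\<omega>\<in>CP i Z j \<omega>1. (F (K T \<omega>))\<^sup>2) * sqrt (\<Sum>\<omega>\<in>CP i Z j \<omega>1. (G (Q \<omega> j))\<^sup>2)"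
        by (rule Q_step[OF Z S T])
    qed (use c c1 in auto)
    then show "corr_le (c1 + ?c) {\<omega> \<in> CC i Z \<omega>0. P \<omega> j = v} (\<lambda>\<omega>. F (K T \<omega>)) g" unfolding eq .
  next
    fix G :: "f2vec \<Rightarrow> real" assume "(\<Sum>\<omega>\<in>CC i Z \<omega>0. G (P \<omega> j)) = 0"
    then show "\<bar>\<Sum>\<omega>\<in>CC i Z \<omega>0. F (K T \<omega>) * G (P \<omega> j)\<bar> \<le> ?c *
      sqrt (\<Sum>\<omega>\<in>CC i Z \<omega>0. (F (K T \<omega>))\<^sup>2) * sqrt (\<Sum>\<omega>\<in>CC i Z \<omega>0. (G (P \<omega> j))\<^sup>2)"
      by (rule P_step[OF Z S T])
  qed (use c c1 in auto)
  then show ?thesis by (simp add: algebra_simps)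
qed

text \<open>Supplies the spare indices: their labels agree with that of \<open>j\<close> below
  \<open>i\<close> and have a prescribed trace on \<open>{i, i + 1}\<close>.\<close>

lemma fibre_in_blk:
  assumes "j < R" "i + 2 \<le> d" "X \<subseteq> {i, i + 1}"
  shows "{k. k < R \<and> \<phi> k = (\<phi> j \<inter> {..<i}) \<union> X} \<subseteq> {k \<in> blk i j. \<phi> k \<inter> {i, i + 1} = X}"
    "card {k. k < R \<and> \<phi> k = (\<phi> j \<inter> {..<i}) \<union> X} = s"
proof -
  show "{k. k < R \<and> \<phi> k = (\<phi> j \<inter> {..<i}) \<union> X} \<subseteq> {k \<in> blk i j. \<phi> k \<inter> {i, i + 1} = X}"
    using assms by (auto simp: blk_def)
  have "(\<phi> j \<inter> {..<i}) \<union> X \<subseteq> {..<d}" using assms by auto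
  then show "card {k. k < R \<and> \<phi> k = (\<phi> j \<inter> {..<i}) \<union> X} = s" by (rule fibres)
qed

text \<open>The indices of \<open>tset i\<close> are revealed one by one, those shared with
  \<open>tset (i + 1)\<close> first; the disjunction in the hypothesis records this order. When all
  are revealed, \<open>K (tset i)\<close> is constant and the covariance vanishes, so the total cost
  is that of \<open>m\<close> applications of \<open>reveal\<close>.\<close>

lemma link_correlation:
  assumes i: "i + 2 \<le> d" and Z: "Z \<subseteq> tset i" "Z \<subseteq> tset (i + 1) \<or> tset i \<inter> tset (i + 1) \<subseteq> Z"
    and "card (tset i - Z) = m"
  shows "corr_le (real m * (2 * sqrt (1 / 2 ^ s + lam))) (CC i Z \<omega>0)
    (\<lambda>\<omega>. F (K (tset i) \<omega>)) (\<lambda>\<omega>. H (K (tset (i + 1)) \<omega>))"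
  using Z assms(4)
proof (induction m arbitrary: Z \<omega>0)
  case 0
  then have "tset i \<subseteq> Z" using tset_sub[of i] finite_subset[of "tset i" "{..<R}"] by auto
  then have "F (K (tset i) \<omega>) = F (K (tset i) \<omega>0)" if "\<omega> \<in> CC i Z \<omega>0" for \<omega>
  proof -
    have "K (tset i) \<omega> = K (tset i) \<omega>0"
      unfolding K_def using that \<open>tset i \<subseteq> Z\<close> by (intro sum.cong) (auto simp: CC_def)
    then show ?thesis by simp
  qed
  then show ?case by (rule corr_le_const) (auto simp: lam0)
next
  case (Suc m)
  let ?A = "tset i" and ?B = "tset (i + 1)" and ?c = "sqrt (1 / 2 ^ s + lam)"
  have ZR: "Z \<subseteq> {..<R}" using Suc.prems tset_sub by blast
  have fin: "finite (?A - Z)" using tset_sub[of i] finite_subset[of "?A" "{..<R}"] by auto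
  have c: "?c \<ge> 0" using lam0 by simp
  obtain j where j: "j \<in> ?A - Z" "?A \<inter> ?B \<subseteq> Z \<or> j \<in> ?B"
  proof (cases "?A \<inter> ?B \<subseteq> Z")
    case True
    have "?A - Z \<noteq> {}" using Suc.prems(3) by (metis card.empty nat.distinct(1))
    then show ?thesis using True that by blast
  next
    case False
    then show ?thesis using that by blast
  qed
  have jR: "j < R" using j tset_sub by blast
  have jB: "j \<in> blk i j" using jR by (simp add: blk_def)
  have IH: "corr_le (real m * (2 * ?c)) (CC i (insert j Z) \<omega>1) (\<lambda>\<omega>. F (K ?A \<omega>)) (\<lambda>\<omega>. H (K ?B \<omega>))" for \<omega>1
  proof (rule Suc.IH)
    show "insert j Z \<subseteq> ?A" using Suc.prems j by blast
    show "insert j Z \<subseteq> ?B \<or> ?A \<inter> ?B \<subseteq> insert j Z" using Suc.prems j by blast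
    have "?A - insert j Z = (?A - Z) - {j}" by blast
    then show "card (?A - insert j Z) = m" using Suc.prems(3) j fin by simp
  qed
  have eqc: "real m * (2 * ?c) + 2 * ?c = real (Suc m) * (2 * ?c)" by (simp add: algebra_simps)
  show ?case
  proof (cases "?A \<inter> ?B \<subseteq> Z")
    case False
    \<comment> \<open>A shared index: the sum over \<open>tset i\<close> is the invariant one. The
      spare indices have \<open>i\<close> but not \<open>i + 1\<close> in their label and are
      unrevealed because \<open>Z\<close> still lies in \<open>tset (i + 1)\<close>.\<close>
    define S where "S = (blk i j \<inter> ?A) - Z"
    define X where "X = {k. k < R \<and> \<phi> k = (\<phi> j \<inter> {..<i}) \<union> {i}}"
    have jAB: "j \<in> ?B" using False j by blast
    have ZB: "Z \<subseteq> ?B" using False Suc.prems by blast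
    have X: "X \<subseteq> {k \<in> blk i j. \<phi> k \<inter> {i, i + 1} = {i}}" "card X = s"
      using fibre_in_blk[OF jR i, of "{i}"] by (auto simp: X_def)
    have Xi: "x \<notin> ?B \<and> x \<in> ?A \<and> x \<in> blk i j" if "x \<in> X" for x
      using that X(1) by (auto simp: X_def tset_def)
    have XS: "insert j X \<subseteq> S" "j \<notin> X"
      using Xi jAB ZB j jB by (auto simp: S_def)
    have finS: "finite S" "finite X"
      using blk_sub[of i j] X(1) finite_subset[of S "{..<R}"] finite_subset[of X "{..<R}"] by (auto simp: S_def X_def)
    have "Suc s = card (insert j X)" using XS finS X by simp
    also have "\<dots> \<le> card S" using XS finS by (intro card_mono) auto
    finally have cardS: "card S > s" by simp
    have "corr_le (real m * (2 * ?c) + 2 * ?c) (CC i Z \<omega>0) (\<lambda>\<omega>. F (K ?A \<omega>)) (\<lambda>\<omega>. H (K ?B \<omega>))"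
    proof (rule reveal[OF ZR _ _ cardS tset_sub])
      show "j \<in> S" "S \<subseteq> blk i j - Z" "S \<subseteq> ?A \<or> S \<inter> ?A = {}" using XS by (auto simp: S_def)
    qed (use IH c in auto)
    then show ?thesis unfolding eqc .
  next
    case True
    \<comment> \<open>No shared index is left: \<open>S\<close> avoids \<open>tset (i + 1)\<close>,
      whose sum is now the invariant one, and the two functions exchange roles. The spare indices
      have neither \<open>i\<close> nor \<open>i + 1\<close> in their label and are never revealed,
      as \<open>Z\<close> stays inside \<open>tset i\<close>.\<close>
    define S where "S = (blk i j - ?B) - Z"
    define X where "X = {k. k < R \<and> \<phi> k = (\<phi> j \<inter> {..<i}) \<union> {}}"
    have jnB: "j \<notin> ?B" using True j by blast
    have X: "X \<subseteq> {k \<in> blk i j. \<phi> k \<inter> {i, i + 1} = {}}" "card X = s"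
      using fibre_in_blk[OF jR i, of "{}"] by (auto simp: X_def)
    have XS: "insert j X \<subseteq> S" "j \<notin> X"
      using X(1) jnB Suc.prems(1) j jB by (auto simp: S_def tset_def blk_def)
    have finS: "finite S" "finite X"
      using blk_sub[of i j] X(1) finite_subset[of S "{..<R}"] finite_subset[of X "{..<R}"] by (auto simp: S_def X_def)
    have "Suc s = card (insert j X)" using XS finS X by simp
    also have "\<dots> \<le> card S" using XS finS by (intro card_mono) auto
    finally have cardS: "card S > s" by simp
    have "corr_le (real m * (2 * ?c) + 2 * ?c) (CC i Z \<omega>0) (\<lambda>\<omega>. H (K ?B \<omega>)) (\<lambda>\<omega>. F (K ?A \<omega>))"
    proof (rule reveal[OF ZR _ _ cardS tset_sub])
      show "j \<in> S" "S \<subseteq> blk i j - Z" "S \<subseteq> ?B \<or> S \<inter> ?B = {}" using XS by (auto simp: S_def)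
      fix \<omega>1
      show "corr_le (real m * (2 * ?c)) (CC i (insert j Z) \<omega>1) (\<lambda>\<omega>. H (K ?B \<omega>)) (\<lambda>\<omega>. F (K ?A \<omega>))"
        by (subst corr_le_commute) (rule IH)
    qed (use c in auto)
    then show ?thesis unfolding eqc by (subst corr_le_commute)
  qed
qed

end

section \<open>Invariance and expansion of the tensor system\<close>

lemma sum_F2_one:
  assumes "finite J"
  shows "(\<Sum>a\<in>J. unitv k a) = (if k \<in> J then 1 else 0)"
  using assms by (simp add: unitv_def)

text \<open>A bijection of labels lifts to the indices because all fibres have the same
  size.\<close>

lemma exists_fibre_permutation:
  assumes fib: "\<And>A. A \<subseteq> {..<d} \<Longrightarrow> card {j. j < R \<and> \<phi> j = A} = s"
    and \<phi>: "\<And>j. j < R \<Longrightarrow> \<phi> j \<subseteq> {..<d}"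
    and \<pi>: "\<And>A. A \<subseteq> {..<d} \<Longrightarrow> \<pi> A \<subseteq> {..<d}" "inj_on \<pi> (Pow {..<d::nat})"
  obtains \<sigma> where "\<sigma> permutes {..<R::nat}" "\<And>j. j < R \<Longrightarrow> \<phi> (\<sigma> j) = \<pi> (\<phi> j)"
proof -
  have "\<exists>h. bij_betw h {j. j < R \<and> \<phi> j = A} {j. j < R \<and> \<phi> j = \<pi> A}" if "A \<subseteq> {..<d}" for A
    using that by (intro finite_same_card_bij) (auto simp: fib \<pi>(1))
  then obtain h where h: "\<And>A. A \<subseteq> {..<d} \<Longrightarrow> bij_betw (h A) {j. j < R \<and> \<phi> j = A} {j. j < R \<and> \<phi> j = \<pi> A}"
    by metis
  define \<sigma> where "\<sigma> j = (if j < R then h (\<phi> j) j else j)" for j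
  have \<sigma>: "\<sigma> j < R" "\<phi> (\<sigma> j) = \<pi> (\<phi> j)" if "j < R" for j
    using bij_betwE[OF h[OF \<phi>[OF that]]] that by (auto simp: \<sigma>_def)
  have "inj_on \<sigma> {..<R}"
  proof (rule inj_onI)
    fix j k assume jk: "j \<in> {..<R}" "k \<in> {..<R}" "\<sigma> j = \<sigma> k"
    then have "\<pi> (\<phi> j) = \<pi> (\<phi> k)" using \<sigma>(2)[of j] \<sigma>(2)[of k] by simp
    then have eq: "\<phi> j = \<phi> k" using \<pi>(2) \<phi> jk by (auto dest: inj_onD)
    have "inj_on (h (\<phi> k)) {i. i < R \<and> \<phi> i = \<phi> k}"
      using h[OF \<phi>, of k] jk by (auto simp: bij_betw_def)
    then show "j = k" using jk eq by (auto simp: \<sigma>_def dest: inj_onD)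
  qed
  moreover have "\<sigma> ` {..<R} \<subseteq> {..<R}" using \<sigma> by auto
  ultimately have "bij_betw \<sigma> {..<R} {..<R}"
    by (simp add: bij_betw_def endo_inj_surj)
  then have "\<sigma> permutes {..<R}" by (rule bij_imp_permutes) (simp add: \<sigma>_def)
  then show ?thesis using that \<sigma>(2) by blast
qed

context tensor_step
begin

text \<open>The standard pairing of a label, read as a vector over two elements, with a coefficient
  vector. A combination of new vectors is the tensor sum over the indices whose labels pair to 1
  with its coefficients.\<close>

definition pr :: "nat set \<Rightarrow> f2vec \<Rightarrow> bit" where "pr J c = (\<Sum>a\<in>J. c a)"

definition sup_set :: "f2vec \<Rightarrow> nat set" where "sup_set c = {j. j < R \<and> pr (\<phi> j) c = 1}"

lemma pr_add: "pr J (c + c') = pr J c + pr J c'"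
  by (simp add: pr_def f2_apply sum.distrib)

lemma finite_\<phi>: "j < R \<Longrightarrow> finite (\<phi> j)"
  using \<phi> finite_subset by blast

lemma sup_set_add: "sup_set (c + c') = sym_diff (sup_set c) (sup_set c')"
proof -
  have "x + y = 1 \<longleftrightarrow> (x = 1) \<noteq> (y = 1)" for x y :: bit by (cases x; cases y) auto
  then show ?thesis by (auto simp: sup_set_def pr_add)
qed

lemma sup_set_unitv: "sup_set (unitv a) = tset a"
  by (auto simp: sup_set_def tset_def pr_def sum_F2_one finite_\<phi> split: if_splits)

lemma sup_set_sub: "sup_set c \<subseteq> {..<R}"
  by (auto simp: sup_set_def)

lemma lincomb_W: "c \<in> F2 d \<Longrightarrow> lincomb d (W \<omega>) c = K (sup_set c) \<omega>"
proof -
  have "lincomb d (W \<omega>) (chi D) = K (sup_set (chi D)) \<omega>" if "finite D" "D \<subseteq> {..<d}" for D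
    using that
  proof (induction D rule: finite_induct)
    case empty
    have "sup_set 0 = {}" by (auto simp: sup_set_def pr_def f2_apply)
    then show ?case by (simp add: K_def)
  next
    case (insert a D)
    have "chi (insert a D) = unitv a + chi D" using insert by (simp flip: sum_unitv)
    then have "lincomb d (W \<omega>) (chi (insert a D)) = W \<omega> a + K (sup_set (chi D)) \<omega>"
      and "sup_set (chi (insert a D)) = sym_diff (tset a) (sup_set (chi D))"
      using insert by (simp_all add: lincomb_add sup_set_add sup_set_unitv)
    then show ?case using K_symdiff[OF tset_sub sup_set_sub] by (simp add: W_def[of _ a])
  qed
  moreover assume "c \<in> F2 d"
  ultimately show ?thesis by (auto simp: F2_chi finite_subset)
qed

lemma K_eq_0:
  assumes \<omega>: "\<omega> \<in> \<Omega>2" and S: "S \<subseteq> {..<R}" and 0: "K S \<omega> = 0"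
  shows "S = {}"
proof (rule ccontr)
  assume "S \<noteq> {}"
  then obtain j where j: "j \<in> S" by blast
  have finS: "finite S" using S finite_subset by blast
  obtain Bs where Bs: "Bs \<subseteq> {..<n}" "\<And>i. i < R \<Longrightarrow> (\<Sum>b\<in>Bs. Q \<omega> i b) = (if i = j then 1 else 0)"
    using dual_coordinates[OF Q_indep[OF \<omega>] Q_F2[OF \<omega>], of j] j S by blast
  have "contract_right n Bs (K S \<omega>) = (\<Sum>k\<in>S. if k = j then P \<omega> k else 0)"
    unfolding contract_right_K[OF \<omega> S Bs(1)] using Bs(2) S by (intro sum.cong) auto
  also have "\<dots> = P \<omega> j" using j finS by simp
  also have "contract_right n Bs (K S \<omega>) = 0"
    unfolding 0 by (simp add: contract_right_def fun_eq_iff f2_apply)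
  finally have "P \<omega> j = 0" by simp
  then show False using indepD[OF P_indep[OF \<omega>], of "{j}"] j S by auto
qed

text \<open>The matrix \<open>b\<close> maps a label to the set of those \<open>a\<close> for which
  it pairs to 1 with \<open>b a\<close>, a bijection of the subsets of \<open>{..<d}\<close>. Lifted
  to a permutation of the old indices and applied to both factors at once, it realises
  \<open>b\<close> on the new tuples. Independence holds because every singleton occurs as a
  label.\<close>

lemma tensor_frame_system:
  assumes "s > 0"
  shows "frame_system \<Omega>2 W d (n * n)"
proof
  show "finite \<Omega>2" "\<Omega>2 \<noteq> {}" using fin_\<Omega> ne_\<Omega> by auto
next
  fix \<omega> k assume "\<omega> \<in> \<Omega>2"
  then show "W \<omega> k \<in> F2 (n * n)" unfolding W_def using tset_sub by (rule K_F2)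
next
  fix \<omega> assume \<omega>: "\<omega> \<in> \<Omega>2"
  show "indep d (W \<omega>)" unfolding indep_iff
  proof (intro ballI impI)
    fix c assume c: "c \<in> F2 d" "lincomb d (W \<omega>) c = 0"
    then have emp: "sup_set c = {}" using K_eq_0[OF \<omega> sup_set_sub] by (simp add: lincomb_W)
    show "c = 0"
    proof
      fix a
      show "c a = 0 a"
      proof (cases "a < d")
        case True
        then have "card {j. j < R \<and> \<phi> j = {a}} > 0" using assms fibres[of "{a}"] by simp
        then have "{j. j < R \<and> \<phi> j = {a}} \<noteq> {}" by (metis card.empty less_irrefl)
        then obtain j where "j < R" "\<phi> j = {a}" by blast
        then show ?thesis using emp by (auto simp: sup_set_def pr_def f2_apply)
      next
        case False
        then show ?thesis using c by (simp add: F2_def f2_apply)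
      qed
    qed
  qed
next
  fix b assume b: "indep d b" "\<And>k. k < d \<Longrightarrow> b k \<in> F2 d"
  define \<pi> where "\<pi> J = {a. a < d \<and> pr J (b a) = 1}" for J
  have \<pi>_inj: "inj_on \<pi> (Pow {..<d})"
  proof (rule inj_onI)
    fix J1 J2 assume J: "J1 \<in> Pow {..<d}" "J2 \<in> Pow {..<d}" "\<pi> J1 = \<pi> J2"
    have ba: "pr J1 (b a) = pr J2 (b a)" if "a < d" for a
    proof -
      have "pr J1 (b a) = 1 \<longleftrightarrow> pr J2 (b a) = 1" using J(3) that by (auto simp: \<pi>_def)
      then show ?thesis by (cases "pr J1 (b a)"; cases "pr J2 (b a)") auto
    qed
    have eq: "pr J1 (sum b D) = pr J2 (sum b D)" if "finite D" "D \<subseteq> {..<d}" for D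
      using that by (induction D rule: finite_induct) (auto simp: pr_add ba, simp add: pr_def f2_apply)
    have "(a \<in> J1) = (a \<in> J2)" if a: "a < d" for a
    proof -
      have "unitv a \<in> lincomb d b ` F2 d" using indep_bij[OF b] a by (auto simp: bij_betw_def)
      then obtain D where "D \<subseteq> {..<d}" "unitv a = sum b D" by (auto simp: F2_chi lincomb_chi)
      then have "pr J1 (unitv a) = pr J2 (unitv a)" using eq finite_subset by auto
      moreover have "finite J1" "finite J2" using J(1,2) by (auto intro: finite_subset[of _ "{..<d}"])
      ultimately show ?thesis by (auto simp: pr_def sum_F2_one split: if_splits)
    qed
    then show "J1 = J2" using J by auto
  qed
  have \<pi>_sub: "\<pi> A \<subseteq> {..<d}" for A by (auto simp: \<pi>_def)
  obtain \<sigma> where \<sigma>: "\<sigma> permutes {..<R}" "\<And>j. j < R \<Longrightarrow> \<phi> (\<sigma> j) = \<pi> (\<phi> j)"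
    by (rule exists_fibre_permutation[of d R \<phi> s \<pi>, OF fibres \<phi> \<pi>_sub \<pi>_inj]) (auto intro: that)
  \<comment> \<open>With the inverse permutation the reindexed sum runs over the preimage of
    \<open>tset a\<close> under \<open>\<sigma>\<close>, which is
    \<open>sup_set (b a)\<close>.\<close>
  define \<tau> where "\<tau> = inv \<sigma>"
  have \<tau>: "\<tau> permutes {..<R}" unfolding \<tau>_def using \<sigma>(1) by (rule permutes_inv)
  obtain \<theta> where \<theta>: "bij_betw \<theta> \<Omega> \<Omega>" "\<And>\<omega> k. \<omega> \<in> \<Omega> \<Longrightarrow> k < R \<Longrightarrow> V (\<theta> \<omega>) k = V \<omega> (\<tau> k)"
    using permute[OF \<tau>] by blast
  have "W (map_prod \<theta> \<theta> \<omega>) a = lincomb d (W \<omega>) (b a)" if \<omega>: "\<omega> \<in> \<Omega>2" and a: "a < d" for \<omega> a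
  proof -
    have img: "\<tau> ` tset a = sup_set (b a)"
    proof -
      have "k \<in> sup_set (b a) \<longleftrightarrow> \<sigma> k \<in> tset a" for k
        using \<sigma>(2)[of k] permutes_in_image[OF \<sigma>(1), of k] a by (auto simp: sup_set_def tset_def \<pi>_def)
      then have "sup_set (b a) = \<sigma> -` tset a" by auto
      then show ?thesis using \<sigma>(1) unfolding \<tau>_def by (simp add: bij_vimage_eq_inv_image permutes_bij)
    qed
    have "W (map_prod \<theta> \<theta> \<omega>) a = (\<Sum>k\<in>tset a. tens n (P \<omega> (\<tau> k)) (Q \<omega> (\<tau> k)))"
      unfolding W_def K_def using \<theta>(2) \<omega> tset_sub[of a]
      by (intro sum.cong) (auto simp: P_def Q_def)
    also have "\<dots> = K (\<tau> ` tset a) \<omega>"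
      unfolding K_def using permutes_inj[OF \<tau>] by (subst sum.reindex) (auto intro: inj_on_subset)
    also have "\<dots> = lincomb d (W \<omega>) (b a)" using b(2)[OF a] by (simp add: img lincomb_W)
    finally show ?thesis .
  qed
  moreover have "bij_betw (map_prod \<theta> \<theta>) \<Omega>2 \<Omega>2" using \<theta>(1) by (rule bij_betw_map_prod[OF _ \<theta>(1)])
  ultimately show "\<exists>\<Theta>. bij_betw \<Theta> \<Omega>2 \<Omega>2 \<and> (\<forall>\<omega>\<in>\<Omega>2. \<forall>k<d. W (\<Theta> \<omega>) k = lincomb d (W \<omega>) (b k))"
    by blast
qed

text \<open>For a function of mean zero the product term of the covariance drops out, exchanging the
  positions \<open>i\<close> and \<open>Suc i\<close> shows that both norms agree, and at most
  \<open>R\<close> indices are revealed.\<close>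

lemma tensor_expanding:
  assumes "s > 0" and lam': "real R * (2 * sqrt (1 / 2 ^ s + lam)) \<le> lam'"
  shows "frame_system.expanding \<Omega>2 W d lam'"
proof -
  interpret Y: frame_system \<Omega>2 W d "n * n" using assms(1) by (rule tensor_frame_system)
  show ?thesis
  proof (rule Y.expandingI)
    fix i \<omega>0 and F :: "f2vec \<Rightarrow> real"
    assume i: "i + 2 \<le> d" and \<omega>0: "\<omega>0 \<in> \<Omega>2" and 0: "(\<Sum>\<omega>\<in>Y.cls {..<i} \<omega>0. F (W \<omega> i)) = 0"
    define A where "A = Y.cls {..<i} \<omega>0"
    have A: "A = CC i {} \<omega>0" by (auto simp: A_def Y.cls_def CC_def W_def)
    let ?c = "2 * sqrt (1 / 2 ^ s + lam)"
    have "corr_le (real (card (tset i - {})) * ?c) A (\<lambda>\<omega>. F (W \<omega> i)) (\<lambda>\<omega>. F (W \<omega> (i + 1)))"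
      unfolding A W_def by (rule link_correlation[OF i]) auto
    then have "\<bar>\<Sum>\<omega>\<in>A. F (W \<omega> i) * F (W \<omega> (Suc i))\<bar> \<le> card (tset i) * ?c *
        sqrt (\<Sum>\<omega>\<in>A. (F (W \<omega> i))\<^sup>2) * sqrt (\<Sum>\<omega>\<in>A. (F (W \<omega> (Suc i)))\<^sup>2)"
      using 0 by (simp add: corr_le_def A_def)
    also have "(\<Sum>\<omega>\<in>A. (F (W \<omega> (Suc i)))\<^sup>2) = (\<Sum>\<omega>\<in>A. (F (W \<omega> i))\<^sup>2)"
    proof -
      have "Transposition.transpose i (Suc i) permutes {..<d}" using i by (intro permutes_swap_id) auto
      then obtain \<theta> where \<theta>: "bij_betw \<theta> \<Omega>2 \<Omega>2"
        "\<And>\<omega> k. \<omega> \<in> \<Omega>2 \<Longrightarrow> k < d \<Longrightarrow> W (\<theta> \<omega>) k = W \<omega> (Transposition.transpose i (Suc i) k)"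
        using Y.permute by metis
      have "bij_betw \<theta> A A"
      proof (rule bij_betw_invariant[OF \<theta>(1)])
        show "A \<subseteq> \<Omega>2" by (auto simp: A_def Y.cls_def)
        fix \<omega> assume \<omega>: "\<omega> \<in> \<Omega>2"
        have "W (\<theta> \<omega>) k = W \<omega> k" if "k < i" for k
          using \<theta>(2)[OF \<omega>, of k] that i by (simp add: transpose_apply_other)
        moreover have "\<theta> \<omega> \<in> \<Omega>2" using \<theta>(1) \<omega> by (auto simp: bij_betw_def)
        ultimately show "\<theta> \<omega> \<in> A \<longleftrightarrow> \<omega> \<in> A" using \<omega> by (simp add: A_def Y.cls_def)
      qed
      then have "(\<Sum>\<omega>\<in>A. (F (W (\<theta> \<omega>) i))\<^sup>2) = (\<Sum>\<omega>\<in>A. (F (W \<omega> i))\<^sup>2)"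
        by (rule sum.reindex_bij_betw[where g = "\<lambda>\<omega>. (F (W \<omega> i))\<^sup>2"])
      moreover have "(\<Sum>\<omega>\<in>A. (F (W (\<theta> \<omega>) i))\<^sup>2) = (\<Sum>\<omega>\<in>A. (F (W \<omega> (Suc i)))\<^sup>2)"
        using \<theta>(2) i by (intro sum.cong) (auto simp: A_def Y.cls_def)
      ultimately show ?thesis by simp
    qed
    also have "card (tset i) * ?c * sqrt (\<Sum>\<omega>\<in>A. (F (W \<omega> i))\<^sup>2) * sqrt (\<Sum>\<omega>\<in>A. (F (W \<omega> i))\<^sup>2) =
        card (tset i) * ?c * (\<Sum>\<omega>\<in>A. (F (W \<omega> i))\<^sup>2)"
      by (simp add: mult.assoc sum_nonneg)
    also have "\<dots> \<le> lam' * (\<Sum>\<omega>\<in>A. (F (W \<omega> i))\<^sup>2)"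
    proof (rule mult_right_mono)
      have "card (tset i) \<le> R" using card_mono[OF _ tset_sub, of i] by simp
      then have "card (tset i) * ?c \<le> real R * ?c" using lam0 by (intro mult_right_mono) auto
      then show "card (tset i) * ?c \<le> lam'" using lam' by linarith
    qed (simp add: sum_nonneg)
    finally show "\<bar>\<Sum>\<omega>\<in>Y.cls {..<i} \<omega>0. F (W \<omega> i) * F (W \<omega> (Suc i))\<bar>
        \<le> lam' * (\<Sum>\<omega>\<in>Y.cls {..<i} \<omega>0. (F (W \<omega> i))\<^sup>2)" by (simp add: A_def)
  qed
qed

section \<open>Size and span of the tensor system\<close>

lemma V_points: "k < R \<Longrightarrow> (\<lambda>\<omega>. V \<omega> k) ` \<Omega> = (\<lambda>\<omega>. V \<omega> 0) ` \<Omega>"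
proof -
  assume k: "k < R"
  then have "Transposition.transpose 0 k permutes {..<R}" by (intro permutes_swap_id) auto
  then obtain \<theta> where \<theta>: "bij_betw \<theta> \<Omega> \<Omega>"
    "\<And>\<omega> l. \<omega> \<in> \<Omega> \<Longrightarrow> l < R \<Longrightarrow> V (\<theta> \<omega>) l = V \<omega> (Transposition.transpose 0 k l)"
    using permute by metis
  have "(\<lambda>\<omega>. V \<omega> k) ` \<Omega> = (\<lambda>\<omega>. V \<omega> k) ` \<theta> ` \<Omega>" using \<theta>(1) by (simp add: bij_betw_def)
  also have "\<dots> = (\<lambda>\<omega>. V \<omega> 0) ` \<Omega>" unfolding image_image using \<theta>(2) k by (intro image_cong) auto
  finally show ?thesis .
qed

text \<open>A new vector is determined by \<open>2 * R\<close> old ones, so the number of vectors is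
  raised to a power that does not depend on \<open>n\<close>.\<close>

lemma tensor_card:
  "card ((\<lambda>\<omega>. W \<omega> 0) ` \<Omega>2) \<le> card ((\<lambda>\<omega>. V \<omega> 0) ` \<Omega>) ^ (2 * R)"
proof -
  define X where "X = (\<lambda>\<omega>. V \<omega> 0) ` \<Omega>"
  define E where "E = PiE {..<R} (\<lambda>_. X)"
  define \<Phi> where "\<Phi> fg = (\<Sum>k\<in>tset 0. tens n (fst fg k) (snd fg k))" for fg :: "(nat \<Rightarrow> f2vec) \<times> (nat \<Rightarrow> f2vec)"
  have X: "finite X" "V p k \<in> X" if "p \<in> \<Omega>" "k < R" for p k
    using fin_\<Omega> V_points[OF that(2)] that by (auto simp: X_def)
  have finX: "finite X" using fin_\<Omega> by (simp add: X_def)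
  have "(\<lambda>\<omega>. W \<omega> 0) ` \<Omega>2 \<subseteq> \<Phi> ` (E \<times> E)"
  proof
    fix x assume "x \<in> (\<lambda>\<omega>. W \<omega> 0) ` \<Omega>2"
    then obtain p q where pq: "p \<in> \<Omega>" "q \<in> \<Omega>" "x = W (p, q) 0" by auto
    have "x = \<Phi> (restrict (V p) {..<R}, restrict (V q) {..<R})"
      unfolding pq W_def K_def \<Phi>_def using tset_sub[of 0] by (intro sum.cong) (auto simp: P_def Q_def)
    moreover have "restrict (V p) {..<R} \<in> E" "restrict (V q) {..<R} \<in> E" using X pq by (auto simp: E_def)
    ultimately show "x \<in> \<Phi> ` (E \<times> E)" by blast
  qed
  moreover have finE: "finite E" unfolding E_def using finX by (intro finite_PiE) auto
  ultimately have "card ((\<lambda>\<omega>. W \<omega> 0) ` \<Omega>2) \<le> card (E \<times> E)"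
    by (meson card_image_le card_mono finite_SigmaI finite_imageI le_trans)
  also have "\<dots> = card X ^ (2 * R)"
    by (simp add: E_def card_PiE card_cartesian_product mult_2 power_add)
  finally show ?thesis by (simp add: X_def)
qed

text \<open>A transvection of the left tuple that is not compensated on the right changes the sum by
  a single pure tensor. Its factors run independently over all old vectors, so bilinearity reaches
  every tensor.\<close>

lemma tensor_span:
  assumes "s > 0" "d > 0" and span: "fun_vs.span ((\<lambda>\<omega>. V \<omega> 0) ` \<Omega>) = F2 n"
  shows "fun_vs.span ((\<lambda>\<omega>. W \<omega> 0) ` \<Omega>2) = F2 (n * n)"
proof
  define L where "L = fun_vs.span ((\<lambda>\<omega>. W \<omega> 0) ` \<Omega>2)"
  have subL: "fun_vs.subspace L" by (simp add: L_def)
  show "fun_vs.span ((\<lambda>\<omega>. W \<omega> 0) ` \<Omega>2) \<subseteq> F2 (n * n)"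
    by (rule fun_vs.span_minimal) (auto simp: W_def intro!: K_F2 tset_sub)
  have ne: "{j. j < R \<and> \<phi> j = A} \<noteq> {}" if "A \<subseteq> {..<d}" for A
    using fibres[OF that] assms(1) by (metis card.empty less_irrefl)
  \<comment> \<open>The label \<open>{0}\<close> puts \<open>j\<close> into \<open>tset 0\<close>
    and the empty label keeps \<open>i\<close> out of it, so adding the vector at \<open>i\<close>
    to the one at \<open>j\<close> affects just one term of the sum.\<close>
  obtain j where j: "j < R" "\<phi> j = {0}" using ne[of "{0}"] assms(2) by auto
  obtain i where i: "i < R" "\<phi> i = {}" using ne[of "{}"] by auto
  note ji = j i
  have jt: "j \<in> tset 0" "i \<notin> tset 0" "i \<noteq> j" using ji by (auto simp: tset_def)
  have fint: "finite (tset 0)" using tset_sub[of 0] finite_subset[of "tset 0" "{..<R}"] by auto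
  have basic: "tens n (V p i) (V q j) \<in> L" if pq: "p \<in> \<Omega>" "q \<in> \<Omega>" for p q
  proof -
    obtain \<theta> where \<theta>: "bij_betw \<theta> \<Omega> \<Omega>" "\<And>\<omega> k. \<omega> \<in> \<Omega> \<Longrightarrow> k < R \<Longrightarrow>
        V (\<theta> \<omega>) k = (if k = j then V \<omega> j + sum (V \<omega>) {i} else V \<omega> k)"
      using transvection[OF ji(1), of "{i}"] ji jt by auto
    have "\<theta> p \<in> \<Omega>" using \<theta>(1) pq by (auto simp: bij_betw_def)
    then have L2: "W (p, q) 0 \<in> L" "W (\<theta> p, q) 0 \<in> L"
      using pq unfolding L_def by (auto intro!: fun_vs.span_base)
    have "W (\<theta> p, q) 0 = tens n (V p j + V p i) (V q j) + (\<Sum>k\<in>tset 0 - {j}. tens n (V (\<theta> p) k) (V q k))"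
      unfolding W_def K_def P_def Q_def using \<theta>(2)[OF pq(1) ji(1)]
      by (subst sum.remove[OF fint jt(1)]) simp
    also have "(\<Sum>k\<in>tset 0 - {j}. tens n (V (\<theta> p) k) (V q k)) = (\<Sum>k\<in>tset 0 - {j}. tens n (V p k) (V q k))"
      using \<theta>(2)[OF pq(1)] tset_sub[of 0] by (intro sum.cong) auto
    also have "tens n (V p j + V p i) (V q j) + \<dots> = tens n (V p i) (V q j) + W (p, q) 0"
      unfolding W_def K_def P_def Q_def
      by (subst sum.remove[OF fint jt(1)]) (simp add: tens_add_left add.commute add.left_commute)
    finally have "tens n (V p i) (V q j) = W (\<theta> p, q) 0 + W (p, q) 0"
      by (metis add.assoc add.right_neutral f2_add_self)
    then show ?thesis using L2 subL by (simp add: f2_subspace_iff)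
  qed
  have gen: "tens n x y \<in> L" if "x \<in> (\<lambda>\<omega>. V \<omega> 0) ` \<Omega>" "y \<in> (\<lambda>\<omega>. V \<omega> 0) ` \<Omega>" for x y
  proof -
    have "x \<in> (\<lambda>\<omega>. V \<omega> i) ` \<Omega>" "y \<in> (\<lambda>\<omega>. V \<omega> j) ` \<Omega>" 
      unfolding V_points[OF i(1)] V_points[OF j(1)] by (rule that)+
    then show ?thesis using basic by blast
  qed
  have gen2: "tens n x y \<in> L" if x: "x \<in> F2 n" and y: "y \<in> (\<lambda>\<omega>. V \<omega> 0) ` \<Omega>" for x y
  proof -
    have "fun_vs.subspace {x. tens n x y \<in> L}"
      using subL by (auto simp: f2_subspace_iff tens_add_left)
    then have "fun_vs.span ((\<lambda>\<omega>. V \<omega> 0) ` \<Omega>) \<subseteq> {x. tens n x y \<in> L}"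
      using gen y by (intro fun_vs.span_minimal) auto
    then show ?thesis using x span by auto
  qed
  have gen3: "tens n x y \<in> L" if x: "x \<in> F2 n" and y: "y \<in> F2 n" for x y
  proof -
    have "fun_vs.subspace {y. tens n x y \<in> L}"
      using subL by (auto simp: f2_subspace_iff tens_add_right)
    then have "fun_vs.span ((\<lambda>\<omega>. V \<omega> 0) ` \<Omega>) \<subseteq> {y. tens n x y \<in> L}"
      using gen2 x by (intro fun_vs.span_minimal) auto
    then show ?thesis using y span by auto
  qed
  have unit: "unitv k \<in> L" if k: "k < n * n" for k
  proof -
    have n: "n > 0" using k by (cases n) auto
    have "unitv k = tens n (unitv (k div n)) (unitv (k mod n))"
      by (auto simp: fun_eq_iff unitv_def tens_def) (metis div_mult_mod_eq)
    moreover have "k div n < n" "k mod n < n" using k n by (auto simp: less_mult_imp_div_less)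
    ultimately show ?thesis using gen3 by simp
  qed
  show "F2 (n * n) \<subseteq> fun_vs.span ((\<lambda>\<omega>. W \<omega> 0) ` \<Omega>2)"
  proof
    fix c assume "c \<in> F2 (n * n)"
    then have "c = lincomb (n * n) unitv c" by (simp add: lincomb_unitv_id)
    also have "\<dots> \<in> L" using subL unit by (rule lincomb_in_subspace)
    finally show "c \<in> fun_vs.span ((\<lambda>\<omega>. W \<omega> 0) ` \<Omega>2)" by (simp add: L_def)
  qed
qed

end

section \<open>Existence of sparse systems\<close>

context frame_system
begin

lemma expanding_mono:
  assumes "expanding lam" "lam \<le> lam'"
  shows "expanding lam'"
  unfolding expanding_def
proof (intro allI impI ballI)
  fix C j i \<omega>0 and F :: "f2vec \<Rightarrow> real"
  assume h: "C \<subseteq> {..<R} \<and> j < R \<and> i < R \<and> j \<noteq> i \<and> j \<notin> C \<and> i \<notin> C" "\<omega>0 \<in> \<Omega>"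
    "(\<Sum>\<omega>\<in>cls C \<omega>0. F (V \<omega> j)) = 0"
  then have "\<bar>\<Sum>\<omega>\<in>cls C \<omega>0. F (V \<omega> j) * F (V \<omega> i)\<bar> \<le> lam * (\<Sum>\<omega>\<in>cls C \<omega>0. (F (V \<omega> j))\<^sup>2)"
    using assms(1) unfolding expanding_def by blast
  also have "\<dots> \<le> lam' * (\<Sum>\<omega>\<in>cls C \<omega>0. (F (V \<omega> j))\<^sup>2)"
    using assms(2) by (intro mult_right_mono) (auto simp: sum_nonneg)
  finally show "\<bar>\<Sum>\<omega>\<in>cls C \<omega>0. F (V \<omega> j) * F (V \<omega> i)\<bar> \<le> lam' * (\<Sum>\<omega>\<in>cls C \<omega>0. (F (V \<omega> j))\<^sup>2)" .
qed

text \<open>Extending a matrix by the identity realises the smaller group inside the larger one. The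
  index set stays the same, so the shorter frames are counted with multiplicity.\<close>

lemma truncate:
  assumes "d \<le> R"
  shows "frame_system \<Omega> V d n"
proof
  show "finite \<Omega>" "\<Omega> \<noteq> {}" using fin_\<Omega> ne_\<Omega> by auto
next
  fix \<omega> k assume "\<omega> \<in> \<Omega>" "k < d"
  then show "V \<omega> k \<in> F2 n" using V_F2 assms by auto
next
  fix \<omega> assume "\<omega> \<in> \<Omega>"
  then show "indep d (V \<omega>)" using V_indep assms indep_mono by blast
next
  fix b assume b: "indep d b" "\<And>k. k < d \<Longrightarrow> b k \<in> F2 d"
  define b' where "b' k = (if k < d then b k else unitv k)" for k
  have F: "b' k \<in> F2 R" if "k < R" for k
    using that b(2)[of k] F2_mono[OF assms] by (auto simp: b'_def)
  have "indep R b'" unfolding indep_iff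
  proof (intro ballI impI)
    fix c assume c: "c \<in> F2 R" "lincomb R b' c = 0"
    have "c k = 0" if k: "k \<ge> d" for k
    proof (cases "k < R")
      case True
      have "lincomb R b' c k = (\<Sum>l<R. c l * b' l k)"
        by (simp add: lincomb_def sum_fun_apply fun_scale_def)
      also have "\<dots> = (\<Sum>l<R. if l = k then c l else 0)"
        using b(2) k by (intro sum.cong) (auto simp: b'_def F2_def unitv_def)
      also have "\<dots> = c k" using True by simp
      finally show ?thesis using c(2) by (simp add: f2_apply)
    qed (use c in \<open>auto simp: F2_def\<close>)
    then have cd: "c \<in> F2 d" by (simp add: F2_def)
    then have "lincomb d b c = 0"
      using c(2) lincomb_F2[OF cd assms, of b'] lincomb_cong[of d b' b c] by (simp add: b'_def)
    then show "c = 0" using b(1) cd by (simp add: indep_iff)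
  qed
  then obtain \<theta> where \<theta>: "bij_betw \<theta> \<Omega> \<Omega>" "\<forall>\<omega>\<in>\<Omega>. \<forall>k<R. V (\<theta> \<omega>) k = lincomb R (V \<omega>) (b' k)"
    using V_GL F by blast
  have "V (\<theta> \<omega>) k = lincomb d (V \<omega>) (b k)" if "\<omega> \<in> \<Omega>" "k < d" for \<omega> k
  proof -
    have "V (\<theta> \<omega>) k = lincomb R (V \<omega>) (b k)" using \<theta>(2) that assms by (simp add: b'_def)
    then show ?thesis using lincomb_F2[OF b(2)[OF that(2)] assms] by simp
  qed
  then show "\<exists>\<theta>. bij_betw \<theta> \<Omega> \<Omega> \<and> (\<forall>\<omega>\<in>\<Omega>. \<forall>k<d. V (\<theta> \<omega>) k = lincomb d (V \<omega>) (b k))"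
    using \<theta>(1) by blast
qed

lemma transport:
  assumes f: "bij_betw f N \<Omega>"
  shows "frame_system N (\<lambda>x. V (f x)) R n"
proof
  show "finite N" using f fin_\<Omega> bij_betw_finite by blast
  show "N \<noteq> {}" using f ne_\<Omega> by (auto simp: bij_betw_def)
next
  fix x k assume "x \<in> N" "k < R"
  then show "V (f x) k \<in> F2 n" using f V_F2 bij_betwE by blast
next
  fix x assume "x \<in> N"
  then show "indep R (V (f x))" using f V_indep bij_betwE by blast
next
  fix b assume "indep R b" "\<And>k. k < R \<Longrightarrow> b k \<in> F2 R"
  then obtain \<theta> where \<theta>: "bij_betw \<theta> \<Omega> \<Omega>" "\<forall>\<omega>\<in>\<Omega>. \<forall>k<R. V (\<theta> \<omega>) k = lincomb R (V \<omega>) (b k)"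
    using V_GL by blast
  define g where "g = inv_into N f"
  have g: "bij_betw g \<Omega> N" unfolding g_def using f by (rule bij_betw_inv_into)
  have fg: "f (g y) = y" if "y \<in> \<Omega>" for y
    unfolding g_def using f that by (rule bij_betw_inv_into_right)
  have "bij_betw (g \<circ> \<theta> \<circ> f) N N"
    using bij_betw_trans[OF f bij_betw_trans[OF \<theta>(1) g]] by (simp add: o_assoc)
  moreover have "V (f ((g \<circ> \<theta> \<circ> f) x)) k = lincomb R (V (f x)) (b k)" if "x \<in> N" "k < R" for x k
  proof -
    have "f x \<in> \<Omega>" "\<theta> (f x) \<in> \<Omega>" using bij_betwE[OF f] bij_betwE[OF \<theta>(1)] that by auto
    then show ?thesis using \<theta>(2) that fg by simp
  qed
  ultimately show "\<exists>\<theta>. bij_betw \<theta> N N \<and> (\<forall>\<omega>\<in>N. \<forall>k<R. V (f (\<theta> \<omega>)) k = lincomb R (V (f \<omega>)) (b k))"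
    by blast
qed

lemma transport_expanding:
  assumes f: "bij_betw f N \<Omega>" and exp: "expanding lam"
  shows "frame_system.expanding N (\<lambda>x. V (f x)) R lam"
proof -
  interpret N: frame_system N "\<lambda>x. V (f x)" R n using f by (rule transport)
  have sums: "(\<Sum>x\<in>N.cls C x0. h (f x)) = (\<Sum>\<omega>\<in>cls C (f x0). h \<omega>)" if "x0 \<in> N" for C x0 and h :: "'a \<Rightarrow> real"
  proof (rule sum.reindex_bij_betw)
    have "f ` N.cls C x0 = cls C (f x0)"
      using f by (auto simp: bij_betw_def N.cls_def cls_def)
    then show "bij_betw f (N.cls C x0) (cls C (f x0))"
      using f by (auto simp: bij_betw_def N.cls_def intro: inj_on_subset)
  qed
  show ?thesis unfolding N.expanding_def
  proof (intro allI impI ballI)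
    fix C j i x0 and F :: "f2vec \<Rightarrow> real"
    assume h: "C \<subseteq> {..<R} \<and> j < R \<and> i < R \<and> j \<noteq> i \<and> j \<notin> C \<and> i \<notin> C" and x0: "x0 \<in> N"
      and 0: "(\<Sum>x\<in>N.cls C x0. F (V (f x) j)) = 0"
    have fx: "f x0 \<in> \<Omega>" using f x0 bij_betwE by blast
    have "(\<Sum>\<omega>\<in>cls C (f x0). F (V \<omega> j)) = 0" using 0 sums[OF x0, of "\<lambda>\<omega>. F (V \<omega> j)"] by simp
    then have "\<bar>\<Sum>\<omega>\<in>cls C (f x0). F (V \<omega> j) * F (V \<omega> i)\<bar> \<le> lam * (\<Sum>\<omega>\<in>cls C (f x0). (F (V \<omega> j))\<^sup>2)"
      using exp h fx unfolding expanding_def by blast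
    then show "\<bar>\<Sum>x\<in>N.cls C x0. F (V (f x) j) * F (V (f x) i)\<bar> \<le> lam * (\<Sum>x\<in>N.cls C x0. (F (V (f x) j))\<^sup>2)"
      using sums[OF x0, of "\<lambda>\<omega>. F (V \<omega> j) * F (V \<omega> i)"] sums[OF x0, of "\<lambda>\<omega>. (F (V \<omega> j))\<^sup>2"] by simp
  qed
qed

end

text \<open>A tensor step changes the type of the index set to a product. Index sets of natural
  numbers keep the iteration at one type, and \<open>goodI\<close> renumbers after each
  step.\<close>

definition good :: "nat \<Rightarrow> nat \<Rightarrow> real \<Rightarrow> nat \<Rightarrow> bool" where
  "good d n lam N \<longleftrightarrow> (\<exists>(\<Omega>::nat set) V. frame_system \<Omega> V d n \<and> frame_system.expanding \<Omega> V d lam \<and>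
     fun_vs.span ((\<lambda>\<omega>. V \<omega> 0) ` \<Omega>) = F2 n \<and> card ((\<lambda>\<omega>. V \<omega> 0) ` \<Omega>) \<le> N)"

lemma goodI:
  assumes "frame_system \<Omega> V d n" "frame_system.expanding \<Omega> V d lam"
    "fun_vs.span ((\<lambda>\<omega>. V \<omega> 0) ` \<Omega>) = F2 n" "card ((\<lambda>\<omega>. V \<omega> 0) ` \<Omega>) \<le> N"
  shows "good d n lam N"
proof -
  interpret frame_system \<Omega> V d n by fact
  obtain f where f: "bij_betw f {0..<card \<Omega>} \<Omega>" using ex_bij_betw_nat_finite[OF fin_\<Omega>] by blast
  have "(\<lambda>x. V (f x) 0) ` {0..<card \<Omega>} = (\<lambda>\<omega>. V \<omega> 0) ` \<Omega>"
  proof -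
    have "f ` {0..<card \<Omega>} = \<Omega>" using f by (simp add: bij_betw_def)
    moreover have "(\<lambda>x. V (f x) 0) ` {0..<card \<Omega>} = (\<lambda>\<omega>. V \<omega> 0) ` (f ` {0..<card \<Omega>})"
      by (simp add: image_image)
    ultimately show ?thesis by simp
  qed
  then show ?thesis
    unfolding good_def using transport[OF f] transport_expanding[OF f assms(2)] assms(3,4)
    by (intro exI[of _ "{0..<card \<Omega>}"] exI[of _ "\<lambda>x. V (f x)"]) simp
qed

lemma good_tensor:
  assumes good: "good (2 ^ d * s) n lam N" and "d > 0" "s > 0" "lam \<ge> 0"
    and lam': "real (2 ^ d * s) * (2 * sqrt (1 / 2 ^ s + lam)) \<le> lam'"
  shows "good d (n * n) lam' (N ^ (2 * (2 ^ d * s)))"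
proof -
  define R where "R = 2 ^ d * s"
  obtain \<Omega> :: "nat set" and V where sys: "frame_system \<Omega> V R n" and exp: "frame_system.expanding \<Omega> V R lam"
    and span: "fun_vs.span ((\<lambda>\<omega>. V \<omega> 0) ` \<Omega>) = F2 n" and N: "card ((\<lambda>\<omega>. V \<omega> 0) ` \<Omega>) \<le> N"
    using good unfolding good_def R_def by blast
  interpret frame_system \<Omega> V R n by (rule sys)
  \<comment> \<open>Indices are matched with pairs of a label and a copy number below
    \<open>s\<close>.\<close>
  have "card {..<R} = card (Pow {..<d} \<times> {..<s})"
    by (simp add: R_def card_cartesian_product card_Pow)
  then obtain h where h: "bij_betw h {..<R} (Pow {..<d} \<times> {..<s})"
    using finite_same_card_bij[of "{..<R}" "Pow {..<d} \<times> {..<s}"] by auto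
  define \<phi> where "\<phi> j = fst (h j)" for j
  have \<phi>: "\<phi> j \<subseteq> {..<d}" if "j < R" for j
    using bij_betwE[OF h] that unfolding \<phi>_def by (metis PowD SigmaE fst_conv lessThan_iff)
  have fib: "card {j. j < R \<and> \<phi> j = A} = s" if "A \<subseteq> {..<d}" for A
  proof -
    have "h ` {j. j < R \<and> \<phi> j = A} = {A} \<times> {..<s}"
    proof (intro equalityI subsetI)
      fix x assume "x \<in> h ` {j. j < R \<and> \<phi> j = A}"
      then show "x \<in> {A} \<times> {..<s}" using bij_betwE[OF h] by (auto simp: \<phi>_def mem_Times_iff)
    next
      fix x assume x: "x \<in> {A} \<times> {..<s}"
      then have "x \<in> h ` {..<R}" using h that by (auto simp: bij_betw_def)
      then obtain k where k: "k < R" "x = h k" by auto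
      then have "k \<in> {j. j < R \<and> \<phi> j = A}" using x by (auto simp: \<phi>_def)
      then show "x \<in> h ` {j. j < R \<and> \<phi> j = A}" using k(2) by blast
    qed
    moreover have "inj_on h {j. j < R \<and> \<phi> j = A}" using h by (auto simp: bij_betw_def intro: inj_on_subset)
    from card_image[OF this] have "card (h ` {j. j < R \<and> \<phi> j = A}) = card {j. j < R \<and> \<phi> j = A}" .
    ultimately show ?thesis by (simp add: card_cartesian_product)
  qed
  interpret tensor_step \<Omega> V R n d s \<phi> lam
    by unfold_locales (use \<phi> fib assms exp in auto)
  have "card ((\<lambda>\<omega>. W \<omega> 0) ` \<Omega>2) \<le> N ^ (2 * R)"
    using tensor_card power_mono[OF N, of "2 * R"] by simp
  then show ?thesis
    using goodI[OF tensor_frame_system[OF assms(3)] tensor_expanding[OF assms(3), of lam'] tensor_span[OF assms(3,2) span]]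
      lam' by (simp add: R_def)
qed

section \<open>The system of all bases\<close>

lemma full_frame_system:
  "frame_system {b \<in> {..<m} \<rightarrow>\<^sub>E F2 m. indep m b} (\<lambda>b. b) m m"
proof
  show "finite {b \<in> {..<m} \<rightarrow>\<^sub>E F2 m. indep m b}"
    by (rule finite_subset[of _ "{..<m} \<rightarrow>\<^sub>E F2 m"]) (auto intro: finite_PiE)
  have "indep m (restrict unitv {..<m})" using indep_cong[of m "restrict unitv {..<m}" unitv] by simp
  then have "restrict unitv {..<m} \<in> {b \<in> {..<m} \<rightarrow>\<^sub>E F2 m. indep m b}" by auto
  then show "{b \<in> {..<m} \<rightarrow>\<^sub>E F2 m. indep m b} \<noteq> {}" by blast
next
  fix b assume b: "indep m b" "\<And>k. k < m \<Longrightarrow> b k \<in> F2 m"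
  define \<Omega> where "\<Omega> = {b \<in> {..<m} \<rightarrow>\<^sub>E F2 m. indep m b}"
  define \<theta> where "\<theta> v = restrict (\<lambda>k. lincomb m v (b k)) {..<m}" for v :: "nat \<Rightarrow> f2vec"
  have into: "\<theta> v \<in> \<Omega>" if v: "v \<in> \<Omega>" for v
  proof -
    have vF: "v k \<in> F2 m" if "k < m" for k using v that by (auto simp: \<Omega>_def)
    have "lincomb m v (b k) \<in> F2 m" for k using vF by (intro lincomb_in_subspace) auto
    moreover have "indep m (\<lambda>k. lincomb m v (b k))" using v b by (intro indep_compose) (auto simp: \<Omega>_def)
    then have "indep m (\<theta> v)" using indep_cong[of m "\<theta> v" "\<lambda>k. lincomb m v (b k)"] by (simp add: \<theta>_def)
    ultimately show ?thesis by (auto simp: \<Omega>_def \<theta>_def)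
  qed
  have "inj_on \<theta> \<Omega>"
  proof (rule inj_onI)
    fix v w assume vw: "v \<in> \<Omega>" "w \<in> \<Omega>" "\<theta> v = \<theta> w"
    have eq: "lincomb m v (b k) = lincomb m w (b k)" if "k < m" for k
      using fun_cong[OF vw(3), of k] that by (simp add: \<theta>_def)
    have "v k = w k" if k: "k < m" for k
    proof -
      have "unitv k \<in> lincomb m b ` F2 m" using indep_bij[OF b] k by (auto simp: bij_betw_def)
      then obtain c where c: "unitv k = lincomb m b c" by auto
      have "v k = lincomb m v (lincomb m b c)" using k by (simp flip: c)
      also have "\<dots> = lincomb m w (lincomb m b c)"
        unfolding lincomb_lincomb by (rule lincomb_cong) (rule eq)
      also have "\<dots> = w k" using k by (simp flip: c)
      finally show ?thesis .
    qed
    then show "v = w"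
      using PiE_ext[of v "{..<m}" "\<lambda>_. F2 m" w] vw(1,2) unfolding \<Omega>_def by auto
  qed
  moreover have "finite \<Omega>"
    unfolding \<Omega>_def by (rule finite_subset[of _ "{..<m} \<rightarrow>\<^sub>E F2 m"]) (auto intro: finite_PiE)
  ultimately have "bij_betw \<theta> \<Omega> \<Omega>" using into by (simp add: bij_betw_def endo_inj_surj image_subsetI)
  then show "\<exists>\<theta>. bij_betw \<theta> {b \<in> {..<m} \<rightarrow>\<^sub>E F2 m. indep m b} {b \<in> {..<m} \<rightarrow>\<^sub>E F2 m. indep m b} \<and>
      (\<forall>\<omega>\<in>{b \<in> {..<m} \<rightarrow>\<^sub>E F2 m. indep m b}. \<forall>k<m. \<theta> \<omega> k = lincomb m \<omega> (b k))"
    unfolding \<Omega>_def[symmetric] by (intro exI[of _ \<theta>]) (simp add: \<theta>_def)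
qed auto

text \<open>Given the first \<open>i\<close> vectors, the sums over the sets in \<open>I\<close> run
  through all vectors outside the revealed span, so the total covariance with
  \<open>F (V \<omega> i)\<close> is zero. All but at most \<open>2 ^ Suc i\<close> of these
  covariances equal the desired \<open>\<kappa>\<close>. The symmetries come from the full bases of
  \<open>m\<close> vectors, although the conclusion concerns \<open>d\<close> positions
  only.\<close>

lemma full_expanding:
  assumes sys: "frame_system \<Omega> V m m" and d: "d \<le> m"
  shows "frame_system.expanding \<Omega> V d (2 ^ d / 2 ^ m)"
proof -
  interpret X: frame_system \<Omega> V m m by (rule sys)
  interpret Y: frame_system \<Omega> V d m using d by (rule X.truncate)
  show ?thesis
  proof (rule Y.expandingI)
    fix i \<omega>0 and F :: "f2vec \<Rightarrow> real"
    assume i: "i + 2 \<le> d" and \<omega>0: "\<omega>0 \<in> \<Omega>" and 0: "(\<Sum>\<omega>\<in>Y.cls {..<i} \<omega>0. F (V \<omega> i)) = 0"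
    define A where "A = Y.cls {..<i} \<omega>0"
    define S where "S = (\<Sum>\<omega>\<in>A. (F (V \<omega> i))\<^sup>2)"
    define \<kappa> where "\<kappa> = (\<Sum>\<omega>\<in>A. F (V \<omega> i) * F (V \<omega> (Suc i)))"
    have S0: "S \<ge> 0" by (simp add: S_def sum_nonneg)
    have A\<Omega>: "A \<subseteq> \<Omega>" by (auto simp: A_def Y.cls_def)
    have finA: "finite A" using A\<Omega> X.fin_\<Omega> finite_subset by blast
    have inv: "bij_betw \<theta> A A" if "bij_betw \<theta> \<Omega> \<Omega>" "\<And>\<omega> k. \<omega> \<in> \<Omega> \<Longrightarrow> k < i \<Longrightarrow> V (\<theta> \<omega>) k = V \<omega> k" for \<theta>
    proof (rule bij_betw_invariant[OF that(1) A\<Omega>])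
      fix \<omega> assume \<omega>: "\<omega> \<in> \<Omega>"
      then have "\<theta> \<omega> \<in> \<Omega>" using that(1) by (auto simp: bij_betw_def)
      then show "\<theta> \<omega> \<in> A \<longleftrightarrow> \<omega> \<in> A" using \<omega> that(2) by (simp add: A_def Y.cls_def)
    qed
    have shift: "(\<Sum>\<omega>\<in>A. H (V \<omega> i) (sum (V \<omega>) D)) = (\<Sum>\<omega>\<in>A. H (V \<omega> i) (V \<omega> l) :: real)"
      if D: "D \<subseteq> {..<m}" "l \<in> D" "l > i" for D l H
    proof -
      have finD: "finite D" using D finite_subset by blast
      obtain \<theta> where \<theta>: "bij_betw \<theta> \<Omega> \<Omega>" "\<And>\<omega> k. \<omega> \<in> \<Omega> \<Longrightarrow> k < m \<Longrightarrow>
          V (\<theta> \<omega>) k = (if k = l then V \<omega> l + sum (V \<omega>) (D - {l}) else V \<omega> k)"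
        using X.transvection[of l "D - {l}"] D by auto
      have bij: "bij_betw \<theta> A A" by (rule inv[OF \<theta>(1)]) (use \<theta>(2) D i d in auto)
      have "(\<Sum>\<omega>\<in>A. H (V \<omega> i) (V \<omega> l)) = (\<Sum>\<omega>\<in>A. H (V (\<theta> \<omega>) i) (V (\<theta> \<omega>) l))"
        by (rule sum.reindex_bij_betw[OF bij, of "\<lambda>\<omega>. H (V \<omega> i) (V \<omega> l)", symmetric])
      also have "\<dots> = (\<Sum>\<omega>\<in>A. H (V \<omega> i) (sum (V \<omega>) D))"
      proof (rule sum.cong[OF refl])
        fix \<omega> assume "\<omega> \<in> A"
        then have \<omega>: "\<omega> \<in> \<Omega>" using A\<Omega> by blast
        have lm: "l < m" "i < m" "i \<noteq> l" using D i d by auto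
        have "V (\<theta> \<omega>) l = sum (V \<omega>) D"
          unfolding sum.remove[OF finD D(2), of "V \<omega>"] using \<theta>(2)[OF \<omega> lm(1)] by (simp only: refl if_True)
        moreover have "V (\<theta> \<omega>) i = V \<omega> i" using \<theta>(2)[OF \<omega> lm(2)] lm by simp
        ultimately show "H (V (\<theta> \<omega>) i) (V (\<theta> \<omega>) l) = H (V \<omega> i) (sum (V \<omega>) D)" by simp
      qed
      finally show ?thesis by simp
    qed
    have swap: "(\<Sum>\<omega>\<in>A. H (V \<omega> l) (V \<omega> l')) = (\<Sum>\<omega>\<in>A. H (V \<omega> (Transposition.transpose k k' l)) (V \<omega> (Transposition.transpose k k' l')) :: real)"
      if k: "k \<ge> i" "k' \<ge> i" "k < m" "k' < m" "l < m" "l' < m" for k k' l l' H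
    proof -
      have "Transposition.transpose k k' permutes {..<m}" using k by (intro permutes_swap_id) auto
      then obtain \<theta> where \<theta>: "bij_betw \<theta> \<Omega> \<Omega>"
        "\<And>\<omega> x. \<omega> \<in> \<Omega> \<Longrightarrow> x < m \<Longrightarrow> V (\<theta> \<omega>) x = V \<omega> (Transposition.transpose k k' x)"
        using X.permute by metis
      have bij: "bij_betw \<theta> A A"
        by (rule inv[OF \<theta>(1)]) (use \<theta>(2) k i d in \<open>auto simp: transpose_apply_other\<close>)
      have "(\<Sum>\<omega>\<in>A. H (V \<omega> l) (V \<omega> l')) = (\<Sum>\<omega>\<in>A. H (V (\<theta> \<omega>) l) (V (\<theta> \<omega>) l'))"
        by (rule sum.reindex_bij_betw[OF bij, of "\<lambda>\<omega>. H (V \<omega> l) (V \<omega> l')", symmetric])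
      also have "\<dots> = (\<Sum>\<omega>\<in>A. H (V \<omega> (Transposition.transpose k k' l)) (V \<omega> (Transposition.transpose k k' l')))"
        using \<theta>(2) A\<Omega> k by (intro sum.cong) auto
      finally show ?thesis .
    qed
    have im: "i < m" "Suc i < m" using i d by auto
    \<comment> \<open>Sums involving a vector after \<open>i\<close> can be moved to position
      \<open>Suc i\<close> while \<open>V \<omega> i\<close> is kept. The exceptional sums in
      \<open>I1\<close> end at \<open>i\<close>; for them the Cauchy-Schwarz bound is
      enough.\<close>
    define I where "I = {D \<in> Pow {..<m}. \<not> D \<subseteq> {..<i}}"
    define I1 where "I1 = {D \<in> I. D \<subseteq> {..i}}"
    have one: "(\<Sum>\<omega>\<in>A. h (sum (V \<omega>) D)) = (\<Sum>\<omega>\<in>A. h (V \<omega> i))" if D: "D \<in> I" for D and h :: "f2vec \<Rightarrow> real"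
    proof -
      have finD: "finite D" using D finite_subset by (auto simp: I_def)
      obtain l where l: "l \<in> D" "l \<ge> i" using D by (auto simp: I_def not_less subset_iff)
      have lm: "l < m" using l D by (auto simp: I_def)
      obtain \<theta> where \<theta>: "bij_betw \<theta> \<Omega> \<Omega>" "\<And>\<omega> k. \<omega> \<in> \<Omega> \<Longrightarrow> k < m \<Longrightarrow>
          V (\<theta> \<omega>) k = (if k = l then V \<omega> l + sum (V \<omega>) (D - {l}) else V \<omega> k)"
        using X.transvection[of l "D - {l}"] D l lm by (auto simp: I_def)
      have bij: "bij_betw \<theta> A A" by (rule inv[OF \<theta>(1)]) (use \<theta>(2) l i d in auto)
      have "(\<Sum>\<omega>\<in>A. h (V \<omega> l)) = (\<Sum>\<omega>\<in>A. h (V (\<theta> \<omega>) l))"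
        by (rule sum.reindex_bij_betw[OF bij, of "\<lambda>\<omega>. h (V \<omega> l)", symmetric])
      also have "\<dots> = (\<Sum>\<omega>\<in>A. h (sum (V \<omega>) D))"
      proof (rule sum.cong[OF refl])
        fix \<omega> assume "\<omega> \<in> A"
        then have \<omega>: "\<omega> \<in> \<Omega>" using A\<Omega> by blast
        have "V (\<theta> \<omega>) l = sum (V \<omega>) D"
          unfolding sum.remove[OF finD l(1), of "V \<omega>"] using \<theta>(2)[OF \<omega> lm] by (simp only: refl if_True)
        then show "h (V (\<theta> \<omega>) l) = h (sum (V \<omega>) D)" by simp
      qed
      finally have "(\<Sum>\<omega>\<in>A. h (sum (V \<omega>) D)) = (\<Sum>\<omega>\<in>A. h (V \<omega> l))" by simp
      also have "\<dots> = (\<Sum>\<omega>\<in>A. h (V \<omega> i))"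
        using swap[of i l l l "\<lambda>x _. h x"] l lm im by simp
      finally show ?thesis .
    qed
    have const: "(\<Sum>D\<in>I. F (sum (V \<omega>) D)) = (\<Sum>t\<in>F2 m - ssums (V \<omega>0) {..<i}. F t)" if \<omega>A: "\<omega> \<in> A" for \<omega>
    proof -
      have \<omega>: "\<omega> \<in> \<Omega>" using \<omega>A A\<Omega> by blast
      have inj: "inj_on (sum (V \<omega>)) (Pow {..<m})"
        using X.V_inj[OF \<omega>] by (intro inj_onI) auto
      have all: "sum (V \<omega>) ` Pow {..<m} = F2 m"
        using indep_bij[OF X.V_indep[OF \<omega>] X.V_F2[OF \<omega>]] lincomb_image_ssums[of m m "V \<omega>"]
        by (simp add: bij_betw_def ssums_def)
      have low: "sum (V \<omega>) ` Pow {..<i} = ssums (V \<omega>0) {..<i}"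
        unfolding ssums_def using \<omega>A by (intro image_cong) (auto simp: A_def Y.cls_def intro!: sum.cong)
      have "I = Pow {..<m} - Pow {..<i}" by (auto simp: I_def)
      moreover have "sum (V \<omega>) ` (Pow {..<m} - Pow {..<i}) = sum (V \<omega>) ` Pow {..<m} - sum (V \<omega>) ` Pow {..<i}"
        by (rule inj_on_image_set_diff[OF inj]) (use im in auto)
      ultimately have img: "sum (V \<omega>) ` I = F2 m - ssums (V \<omega>0) {..<i}" by (simp only: all low)
      have "inj_on (sum (V \<omega>)) I" using inj by (rule inj_on_subset) (auto simp: I_def)
      from sum.reindex[OF this, of F] show ?thesis unfolding img by (simp add: o_def)
    qed
    have finI: "finite I" by (simp add: I_def)
    have "(\<Sum>D\<in>I. \<Sum>\<omega>\<in>A. F (V \<omega> i) * F (sum (V \<omega>) D)) = (\<Sum>\<omega>\<in>A. F (V \<omega> i) * (\<Sum>D\<in>I. F (sum (V \<omega>) D)))"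
      by (subst sum.swap) (simp add: sum_distrib_left)
    also have "\<dots> = (\<Sum>\<omega>\<in>A. F (V \<omega> i)) * (\<Sum>t\<in>F2 m - ssums (V \<omega>0) {..<i}. F t)"
      using const by (simp add: sum_distrib_right)
    also have "\<dots> = 0" using 0 by (simp add: A_def)
    finally have total: "(\<Sum>D\<in>I. \<Sum>\<omega>\<in>A. F (V \<omega> i) * F (sum (V \<omega>) D)) = 0" .
    have big: "(\<Sum>\<omega>\<in>A. F (V \<omega> i) * F (sum (V \<omega>) D)) = \<kappa>" if D: "D \<in> I - I1" for D
    proof -
      obtain l where l: "l \<in> D" "l > i" using D by (auto simp: I1_def subset_iff not_le)
      have lm: "l < m" "D \<subseteq> {..<m}" using l D by (auto simp: I_def)
      have "(\<Sum>\<omega>\<in>A. F (V \<omega> i) * F (sum (V \<omega>) D)) = (\<Sum>\<omega>\<in>A. F (V \<omega> i) * F (V \<omega> l))"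
        using shift[OF lm(2) l, of "\<lambda>x y. F x * F y"] .
      also have "\<dots> = \<kappa>"
      proof (cases "l = Suc i")
        case False
        then show ?thesis
          using swap[of "Suc i" l i l "\<lambda>x y. F x * F y"] l lm im by (simp add: \<kappa>_def transpose_apply_other)
      qed (simp add: \<kappa>_def)
      finally show ?thesis .
    qed
    have small: "\<bar>\<Sum>\<omega>\<in>A. F (V \<omega> i) * F (sum (V \<omega>) D)\<bar> \<le> S" if "D \<in> I" for D
    proof -
      have "\<bar>\<Sum>\<omega>\<in>A. F (V \<omega> i) * F (sum (V \<omega>) D)\<bar> \<le> sqrt S * sqrt (\<Sum>\<omega>\<in>A. (F (sum (V \<omega>) D))\<^sup>2)"
        unfolding S_def by (rule cauchy_schwarz_sum)
      also have "(\<Sum>\<omega>\<in>A. (F (sum (V \<omega>) D))\<^sup>2) = S" using one[OF that, of "\<lambda>x. (F x)\<^sup>2"] by (simp add: S_def)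
      finally show ?thesis using S0 by simp
    qed
    have I1: "I1 \<subseteq> I" "I1 = Pow {..i} - Pow {..<i}"
      using im by (auto simp: I1_def I_def)
    have cI1: "card I1 \<le> 2 ^ Suc i"
    proof -
      have "card I1 \<le> card (Pow {..i})" unfolding I1(2) by (intro card_mono) auto
      then show ?thesis by (simp add: card_Pow)
    qed
    have cII: "card (I - I1) = 2 ^ m - 2 ^ Suc i"
    proof -
      have "I - I1 = Pow {..<m} - Pow {..<Suc i}" by (auto simp: I_def I1_def lessThan_Suc_atMost)
      moreover have "Pow {..<Suc i} \<subseteq> Pow {..<m}" using im by auto
      ultimately show ?thesis by (simp add: card_Diff_subset card_Pow)
    qed
    define X where "X = (\<Sum>D\<in>I1. \<Sum>\<omega>\<in>A. F (V \<omega> i) * F (sum (V \<omega>) D))"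
    have "card (I - I1) * \<kappa> + X = 0" unfolding X_def
      using total sum.subset_diff[OF I1(1) finI, of "\<lambda>D. \<Sum>\<omega>\<in>A. F (V \<omega> i) * F (sum (V \<omega>) D)"] big by simp
    then have "X = - (card (I - I1) * \<kappa>)" by linarith
    then have "card (I - I1) * \<bar>\<kappa>\<bar> = \<bar>X\<bar>" by (simp add: abs_mult)
    also have "\<dots> \<le> (\<Sum>D\<in>I1. S)" unfolding X_def
      by (rule order_trans[OF sum_abs], rule sum_mono) (use small I1(1) in blast)
    also have "\<dots> = real (card I1) * S" by simp
    also have "\<dots> \<le> 2 ^ Suc i * S"
      using of_nat_mono[OF cI1, where ?'a = real] S0 by (intro mult_right_mono) auto
    finally have le: "card (I - I1) * \<bar>\<kappa>\<bar> \<le> 2 ^ Suc i * S" .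
    \<comment> \<open>Since \<open>Suc i < m\<close>, the subsets of \<open>{..i}\<close> make up at
      most half of all subsets of \<open>{..<m}\<close>.\<close>
    have "real (card (I - I1)) \<ge> 2 ^ (m - 1)"
    proof -
      obtain m' where m': "m = Suc m'" using im by (cases m) auto
      have "(2::nat) ^ Suc i \<le> 2 ^ m'" using im m' by (intro power_increasing) auto
      then have "2 ^ m' \<le> card (I - I1)" unfolding cII m' by simp
      then have "real (2 ^ m') \<le> real (card (I - I1))" by (simp only: of_nat_le_iff)
      then show ?thesis by (simp add: m')
    qed
    then have "2 ^ (m - 1) * \<bar>\<kappa>\<bar> \<le> card (I - I1) * \<bar>\<kappa>\<bar>" by (intro mult_right_mono) auto
    then have "2 ^ (m - 1) * \<bar>\<kappa>\<bar> \<le> 2 ^ Suc i * S" using le by linarith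
    then have "2 ^ m * \<bar>\<kappa>\<bar> \<le> 2 ^ (i + 2) * S" using im by (cases m) (auto simp: algebra_simps)
    also have "\<dots> \<le> 2 ^ d * S" using i S0 by (intro mult_right_mono power_increasing) auto
    finally have "\<bar>\<kappa>\<bar> \<le> 2 ^ d / 2 ^ m * S" by (simp add: field_simps)
    then show "\<bar>\<Sum>\<omega>\<in>Y.cls {..<i} \<omega>0. F (V \<omega> i) * F (V \<omega> (Suc i))\<bar>
        \<le> 2 ^ d / 2 ^ m * (\<Sum>\<omega>\<in>Y.cls {..<i} \<omega>0. (F (V \<omega> i))\<^sup>2)"
      by (simp add: \<kappa>_def S_def A_def)
  qed
qed

lemma good_base:
  assumes "d > 0" "d \<le> m" "2 ^ d / 2 ^ m \<le> lam"
  shows "good d m lam (2 ^ m)"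
proof -
  define \<Omega> where "\<Omega> = {b \<in> {..<m} \<rightarrow>\<^sub>E F2 m. indep m b}"
  interpret X: frame_system \<Omega> "\<lambda>b. b" m m unfolding \<Omega>_def by (rule full_frame_system)
  interpret Y: frame_system \<Omega> "\<lambda>b. b" d m using assms(2) by (rule X.truncate)
  have exp: "Y.expanding lam"
    using Y.expanding_mono[OF full_expanding[OF X.frame_system_axioms assms(2)] assms(3)] .
  have sub: "(\<lambda>b. b 0) ` \<Omega> \<subseteq> F2 m"
  proof (rule image_subsetI)
    fix b assume "b \<in> \<Omega>"
    then have "b \<in> {..<m} \<rightarrow>\<^sub>E F2 m" by (simp add: \<Omega>_def)
    then show "b 0 \<in> F2 m" by (rule PiE_mem) (use assms in auto)
  qed
  then have "card ((\<lambda>b. b 0) ` \<Omega>) \<le> card (F2 m)" by (intro card_mono) auto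
  then have card: "card ((\<lambda>b. b 0) ` \<Omega>) \<le> 2 ^ m" by (simp add: card_F2)
  have unit: "unitv k \<in> fun_vs.span ((\<lambda>b. b 0) ` \<Omega>)" if k: "k < m" for k
  proof (rule fun_vs.span_base)
    define b where "b = restrict (\<lambda>l. unitv (Transposition.transpose 0 k l)) {..<m}"
    have perm: "Transposition.transpose 0 k permutes {..<m}" using k by (intro permutes_swap_id) auto
    have "indep m b"
      using indep_permute[OF perm] indep_cong[of m b "\<lambda>l. unitv (Transposition.transpose 0 k l)"]
      by (simp add: b_def)
    moreover have "b \<in> {..<m} \<rightarrow>\<^sub>E F2 m"
      using permutes_in_image[OF perm] by (auto simp: b_def)
    ultimately have "b \<in> \<Omega>" by (simp add: \<Omega>_def)
    moreover have "b 0 = unitv k" using k by (simp add: b_def)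
    ultimately show "unitv k \<in> (\<lambda>b. b 0) ` \<Omega>" by (metis image_eqI)
  qed
  have "fun_vs.span ((\<lambda>b. b 0) ` \<Omega>) = F2 m"
  proof
    show "fun_vs.span ((\<lambda>b. b 0) ` \<Omega>) \<subseteq> F2 m" using sub by (intro fun_vs.span_minimal) auto
    show "F2 m \<subseteq> fun_vs.span ((\<lambda>b. b 0) ` \<Omega>)"
    proof
      fix c assume "c \<in> F2 m"
      then have "c = lincomb m unitv c" by (simp add: lincomb_unitv_id)
      also have "\<dots> \<in> fun_vs.span ((\<lambda>b. b 0) ` \<Omega>)"
        using unit by (intro lincomb_in_subspace) auto
      finally show "c \<in> fun_vs.span ((\<lambda>b. b 0) ` \<Omega>)" .
    qed
  qed
  then show ?thesis using goodI[OF Y.frame_system_axioms exp _ card] by blast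
qed

text \<open>The old system is taken with expansion \<open>1 / 2 ^ s\<close>, equal to the other term
  under the root in \<open>tensor_expanding\<close>. The factor linear in \<open>s\<close> is then
  beaten by an exponentially small root.\<close>

lemma exists_small_parameter:
  fixes lam :: real
  assumes "lam > 0"
  obtains s :: nat where "s > 0" "real (2 ^ d * s) * (2 * sqrt (1 / 2 ^ s + 1 / 2 ^ s)) \<le> lam"
proof -
  have "(\<lambda>t. 2 ^ d * 2 * (2 * (real t * (1 / 2) ^ t) + (1 / 2) ^ t)) \<longlonglongrightarrow> 2 ^ d * 2 * (2 * 0 + 0)"
    by (intro tendsto_intros powser_times_n_limit_0 LIMSEQ_power_zero) auto
  then have "\<forall>\<^sub>F t in sequentially. 2 ^ d * 2 * (2 * (real t * (1 / 2) ^ t) + (1 / 2) ^ t) < lam"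
    using assms by (intro order_tendstoD) auto
  then obtain t where t: "2 ^ d * 2 * (2 * (real t * (1 / 2) ^ t) + (1 / 2) ^ t) < lam"
    by (meson eventually_sequentially order_refl)
  \<comment> \<open>The odd exponent \<open>s = 2 * t + 1\<close> makes the sum under the root a
    perfect square.\<close>
  have "1 / 2 ^ (2 * t + 1) + 1 / 2 ^ (2 * t + 1) = ((1 / 2) ^ t :: real)\<^sup>2"
    by (simp add: power_mult[symmetric] power_divide mult.commute)
  then have "sqrt (1 / 2 ^ (2 * t + 1) + 1 / 2 ^ (2 * t + 1)) = (1 / 2) ^ t" by simp
  then have "real (2 ^ d * (2 * t + 1)) * (2 * sqrt (1 / 2 ^ (2 * t + 1) + 1 / 2 ^ (2 * t + 1))) =
      2 ^ d * 2 * (2 * (real t * (1 / 2) ^ t) + (1 / 2) ^ t)"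
    by (simp add: algebra_simps)
  then show ?thesis using that[of "2 * t + 1"] t by simp
qed

text \<open>The induction leaves \<open>d\<close> and \<open>lam\<close> arbitrary, because frames
  of length \<open>d\<close> after one more step need frames of length \<open>2 ^ d * s\<close> with
  expansion \<open>1 / 2 ^ s\<close> before it. The constant \<open>C\<close> grows by the factor
  \<open>2 * R\<close>, which does not involve \<open>m\<close>, so the exponent stays linear in
  \<open>m\<close>.\<close>

lemma good_family:
  assumes "d > 0" "lam > 0"
  shows "\<exists>C m0. \<forall>m\<ge>m0. good d (m ^ (2 ^ k)) lam (2 ^ (C * m))"
  using assms
proof (induction k arbitrary: d lam)
  case 0
  obtain k0 where k0: "(1 / 2) ^ k0 < lam" using real_arch_pow_inv[OF 0(2), of "1/2"] by auto
  have "good d m lam (2 ^ m)" if m: "m \<ge> d + k0" for m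
  proof (rule good_base)
    have "(2::real) ^ d / 2 ^ m = (1 / 2) ^ (m - d)"
      using m by (simp add: power_diff power_divide)
    also have "\<dots> \<le> (1 / 2) ^ k0" using m by (intro power_decreasing) auto
    finally show "2 ^ d / 2 ^ m \<le> lam" using k0 by simp
  qed (use 0 m in auto)
  then show ?case by (intro exI[of _ 1] exI[of _ "d + k0"]) simp
next
  case (Suc k)
  obtain s where s: "s > 0" "real (2 ^ d * s) * (2 * sqrt (1 / 2 ^ s + 1 / 2 ^ s)) \<le> lam"
    using exists_small_parameter[OF Suc.prems(2)] by blast
  define R where "R = 2 ^ d * s"
  obtain C m0 where C: "\<And>m. m \<ge> m0 \<Longrightarrow> good R (m ^ (2 ^ k)) (1 / 2 ^ s) (2 ^ (C * m))"
    using Suc.IH[of R "1 / 2 ^ s"] s(1) by (auto simp: R_def)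
  have "good d (m ^ (2 ^ Suc k)) lam (2 ^ (C * (2 * R) * m))" if m: "m \<ge> m0" for m
  proof -
    have "good d (m ^ (2 ^ k) * m ^ (2 ^ k)) lam ((2 ^ (C * m)) ^ (2 * (2 ^ d * s)))"
      by (rule good_tensor[OF C[OF m, unfolded R_def]]) (use Suc.prems s in auto)
    moreover have "m ^ (2 ^ k) * m ^ (2 ^ k) = m ^ (2 ^ Suc k)" by (simp add: mult_2 flip: power_add)
    moreover have "((2::nat) ^ (C * m)) ^ (2 * (2 ^ d * s)) = 2 ^ (C * (2 * R) * m)"
      by (simp add: R_def power_mult[symmetric] algebra_simps)
    ultimately show ?thesis by simp
  qed
  then show ?case by blast
qed

section \<open>From systems of frames to Grassmann posets\<close>

lemma ssums_cong: "(\<And>k. k \<in> C \<Longrightarrow> v k = v' k) \<Longrightarrow> ssums v C = ssums v' C"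
  unfolding ssums_def by (intro image_cong) (auto intro!: sum.cong)

lemma indep_ssums_sequential:
  assumes "\<And>k. k < r \<Longrightarrow> b k \<notin> ssums b {..<k}"
  shows "indep r b"
  by (rule indep_sequential) (use assms lincomb_image_ssums in auto)

lemma card_ssums: "indep R v \<Longrightarrow> k \<le> R \<Longrightarrow> card (ssums v {..<k}) = 2 ^ k"
  using card_lincomb_image lincomb_image_ssums by metis

lemma sequence_extend:
  assumes W: "fun_vs.subspace W" "finite W" "card W = 2 ^ r" and "j \<le> r"
    and "\<And>k. k < j \<Longrightarrow> b k \<in> W \<and> b k \<notin> ssums b {..<k}"
  shows "\<exists>b'. (\<forall>k<j. b' k = b k) \<and> (\<forall>k<r. b' k \<in> W \<and> b' k \<notin> ssums b' {..<k})"
  using assms(4,5)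
proof (induction "r - j" arbitrary: j b)
  case 0
  then show ?case by (intro exI[of _ b]) auto
next
  case (Suc m)
  have "indep j b" using Suc.prems by (intro indep_ssums_sequential) auto
  then have "card (ssums b {..<j}) = 2 ^ j" by (rule card_ssums) simp
  then have "card (ssums b {..<j}) < card W" using W Suc.hyps(2) by simp
  then have "\<not> W \<subseteq> ssums b {..<j}" by (metis card_mono finite_Pow_iff finite_imageI finite_lessThan not_le ssums_def)
  then obtain x where x: "x \<in> W" "x \<notin> ssums b {..<j}" by blast
  define b1 where "b1 = b(j := x)"
  have same: "ssums b1 {..<k} = ssums b {..<k}" if "k \<le> j" for k
    using that by (intro ssums_cong) (auto simp: b1_def)
  have "\<exists>b'. (\<forall>k<Suc j. b' k = b1 k) \<and> (\<forall>k<r. b' k \<in> W \<and> b' k \<notin> ssums b' {..<k})"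
  proof (rule Suc.hyps(1))
    show "m = r - Suc j" "Suc j \<le> r" using Suc.hyps(2) by auto
    fix k assume "k < Suc j"
    then show "b1 k \<in> W \<and> b1 k \<notin> ssums b1 {..<k}"
      using x Suc.prems(2)[of k] same[of k] by (cases "k = j") (auto simp: b1_def)
  qed
  then obtain b' where b': "\<forall>k<Suc j. b' k = b1 k" "\<forall>k<r. b' k \<in> W \<and> b' k \<notin> ssums b' {..<k}" by blast
  have "\<forall>k<j. b' k = b k" using b'(1) by (auto simp: b1_def)
  then show ?case using b'(2) by blast
qed

text \<open>Read as a matrix: through \<open>V_GL\<close> it turns a frame into one that starts with
  a basis of a prescribed subspace followed by a prescribed vector.\<close>

lemma adapted_basis:
  assumes w: "fun_vs.subspace w" "w \<subseteq> F2 R" "card w = 2 ^ i" and x: "x \<in> F2 R" "x \<notin> w"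
  obtains b where "indep R b" "\<And>k. k < R \<Longrightarrow> b k \<in> F2 R" "ssums b {..<i} = w" "b i = x" "i < R"
proof -
  have finw: "finite w" using w(2) by (rule subspace_F2_finite)
  have "card w < card (F2 R)" using w x by (intro psubset_card_mono) auto
  then have iR: "i < R" using w(3) by (simp add: card_F2)
  obtain b0 where b0: "\<And>k. k < i \<Longrightarrow> b0 k \<in> w \<and> b0 k \<notin> ssums b0 {..<k}"
    using sequence_extend[OF w(1) finw w(3), of 0] by auto
  have s0: "ssums b0 {..<i} = w"
  proof (rule card_subset_eq[OF finw])
    show "ssums b0 {..<i} \<subseteq> w" using b0 by (intro ssums_minimal w) auto
    have "indep i b0" using b0 by (intro indep_ssums_sequential) auto
    then show "card (ssums b0 {..<i}) = card w" using card_ssums w(3) by simp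
  qed
  define b1 where "b1 = b0(i := x)"
  have same: "ssums b1 {..<k} = ssums b0 {..<k}" if "k \<le> i" for k
    using that by (intro ssums_cong) (auto simp: b1_def)
  have b1: "b1 k \<in> F2 R \<and> b1 k \<notin> ssums b1 {..<k}" if "k < Suc i" for k
    using that b0[of k] same[of k] x s0 w(2) by (cases "k = i") (auto simp: b1_def)
  obtain b where b: "\<forall>k<Suc i. b k = b1 k" "\<forall>k<R. b k \<in> F2 R \<and> b k \<notin> ssums b {..<k}"
    using sequence_extend[OF subspace_F2 finite_F2 card_F2, of "Suc i" R b1] b1 iR by auto
  have "ssums b {..<i} = ssums b0 {..<i}" using b(1) by (intro ssums_cong) (auto simp: b1_def)
  moreover have "indep R b" using b(2) by (intro indep_ssums_sequential) auto
  ultimately show ?thesis using that[of b] b s0 iR by (auto simp: b1_def)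
qed

lemma complete_flagsD:
  assumes "F \<in> complete_flags W" "i \<le> fun_vs.dim W"
  shows "length F = Suc (fun_vs.dim W)" "fun_vs.subspace (F ! i)" "fun_vs.dim (F ! i) = i"
    "F ! i \<subseteq> W" "F ! fun_vs.dim W = W"
proof -
  show len: "length F = Suc (fun_vs.dim W)" and "fun_vs.subspace (F ! i)" "fun_vs.dim (F ! i) = i"
    using assms by (auto simp: complete_flags_def)
  have "last F = W" using assms by (auto simp: complete_flags_def)
  then show l: "F ! fun_vs.dim W = W" using len by (cases F rule: rev_cases) (auto simp: nth_append)
  show "F ! i \<subseteq> W"
  proof (cases "i = fun_vs.dim W")
    case True
    then show ?thesis using l by simp
  next
    case False
    have "sorted_wrt (\<subset>) F" using assms by (auto simp: complete_flags_def)
    then have "F ! i \<subset> F ! fun_vs.dim W" using False assms(2) len by (simp add: sorted_wrt_iff_nth_less)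
    then show ?thesis using l by auto
  qed
qed

lemma complete_flags_image:
  fixes f :: "f2vec \<Rightarrow> f2vec"
  assumes W: "fun_vs.subspace W" "finite W" and inj: "inj_on f W"
    and add: "\<And>x y. x \<in> W \<Longrightarrow> y \<in> W \<Longrightarrow> f (x + y) = f x + f y"
    and F: "F \<in> complete_flags W"
  shows "map (image f) F \<in> complete_flags (f ` W)"
proof -
  have W0: "0 \<in> W" using W by (simp add: f2_subspace_iff)
  have f0: "f 0 = 0" using add[OF W0 W0] by simp
  have sub: "fun_vs.subspace (f ` X)" if X: "X \<subseteq> W" "fun_vs.subspace X" for X
    unfolding f2_subspace_iff
  proof (intro conjI ballI)
    show "0 \<in> f ` X" using X f0 by (metis f2_subspace_iff image_eqI)
    fix a b assume "a \<in> f ` X" "b \<in> f ` X"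
    then obtain x y where xy: "x \<in> X" "y \<in> X" "a = f x" "b = f y" by blast
    then have "x \<in> W" "y \<in> W" using X(1) by blast+
    then have "a + b = f (x + y)" using add[of x y] xy by simp
    then show "a + b \<in> f ` X" using xy X by (auto simp: f2_subspace_iff)
  qed
  have dim: "fun_vs.dim (f ` X) = fun_vs.dim X" if X: "X \<subseteq> W" "fun_vs.subspace X" for X
  proof -
    have finX: "finite X" using X W finite_subset by blast
    have "card (f ` X) = card X" using inj X by (intro card_image) (auto intro: inj_on_subset)
    then show ?thesis
      using card_subspace[OF X(2) finX] dim_f2_iff[OF sub[OF X], of "fun_vs.dim X"] finX by simp
  qed
  note D = complete_flagsD[OF F]
  have setF: "X \<subseteq> W" if "X \<in> set F" for X
    using that D(4) D(1)[of 0] by (auto simp: in_set_conv_nth less_Suc_eq_le)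
  have "sorted_wrt (\<subset>) F" using F by (simp add: complete_flags_def)
  then have "sorted_wrt (\<lambda>X Y. f ` X \<subset> f ` Y) F"
  proof (rule sorted_wrt_mono_rel[rotated])
    fix X Y assume "X \<in> set F" "Y \<in> set F" "X \<subset> Y"
    then show "f ` X \<subset> f ` Y"
      using setF inj by (metis image_strict_mono inj_on_subset)
  qed
  then have "sorted_wrt (\<subset>) (map (image f) F)" by (simp add: sorted_wrt_map)
  moreover have "F \<noteq> []" "last F = W" using D(1)[of 0] F by (auto simp: complete_flags_def)
  moreover have "fun_vs.dim (f ` W) = fun_vs.dim W" using dim W by blast
  ultimately show ?thesis
    using D sub dim by (auto simp: complete_flags_def last_map less_Suc_eq_le)
qed

lemma dim_F2 [simp]: "fun_vs.dim (F2 R) = R"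
  using dim_f2_iff[OF subspace_F2 finite_F2] card_F2 by blast

lemma standard_flag: "map F2 [0..<Suc R] \<in> complete_flags (F2 R)"
proof -
  have strict: "F2 i \<subset> F2 j" if "i < j" for i j
  proof -
    have "unitv i \<in> F2 j - F2 i" using that by simp
    then show ?thesis using F2_mono[of i j] that by (metis DiffD1 DiffD2 less_imp_le psubsetI)
  qed
  then have "sorted_wrt (\<subset>) (map F2 [0..<Suc R])"
    by (simp add: sorted_wrt_iff_nth_less del: upt_Suc)
  moreover have "last (map F2 [0..<Suc R]) = F2 R" by simp
  ultimately show ?thesis by (simp add: complete_flags_def less_Suc_eq_le del: upt_Suc)
qed

lemma finite_complete_flags:
  assumes "finite W"
  shows "finite (complete_flags W)"
proof (rule finite_subset)
  show "complete_flags W \<subseteq> {F. set F \<subseteq> Pow W \<and> length F = Suc (fun_vs.dim W)}"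
  proof
    fix F assume F: "F \<in> complete_flags W"
    have "X \<subseteq> W" if "X \<in> set F" for X
      using that complete_flagsD(4)[OF F] complete_flagsD(1)[OF F, of 0] by (auto simp: in_set_conv_nth less_Suc_eq_le)
    then show "F \<in> {F. set F \<subseteq> Pow W \<and> length F = Suc (fun_vs.dim W)}"
      using complete_flagsD(1)[OF F, of 0] by auto
  qed
  show "finite {F. set F \<subseteq> Pow W \<and> length F = Suc (fun_vs.dim W)}"
    using assms by (intro finite_lists_length_eq) auto
qed

text \<open>A vector chosen from each step of the flag outside the previous step gives a matrix that
  carries the standard flag to \<open>F\<close>.\<close>

lemma flag_basis:
  assumes F: "F \<in> complete_flags (F2 R)"
  obtains b where "indep R b" "\<And>k. k < R \<Longrightarrow> b k \<in> F2 R" "\<And>k. k \<le> R \<Longrightarrow> ssums b {..<k} = F ! k"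
proof -
  note D = complete_flagsD[OF F, simplified]
  have strict: "F ! k \<subset> F ! Suc k" if "k < R" for k
  proof -
    have "sorted_wrt (\<subset>) F" using F by (simp add: complete_flags_def)
    then show ?thesis using that D(1)[of 0] by (simp add: sorted_wrt_iff_nth_less)
  qed
  have "\<forall>k\<in>{..<R}. \<exists>x. x \<in> F ! Suc k - F ! k" using strict by blast
  from bchoice[OF this] obtain b where b: "\<And>k. k < R \<Longrightarrow> b k \<in> F ! Suc k - F ! k" by auto
  have fin: "finite (F ! k)" if "k \<le> R" for k using D(4)[OF that] by (rule subspace_F2_finite)
  have eq: "(\<forall>l<k. b l \<notin> ssums b {..<l}) \<and> ssums b {..<k} = F ! k" if "k \<le> R" for k
    using that
  proof (induction k)
    case 0
    have "fun_vs.subspace (F ! 0)" "card (F ! 0) = 1"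
      using D(2)[of 0] D(3)[of 0] card_subspace[of "F ! 0"] fin[of 0] by auto
    then have "F ! 0 = {0}" by (auto simp: card_1_singleton_iff f2_subspace_iff)
    then show ?case by (simp add: ssums_def)
  next
    case (Suc k)
    then have IH: "\<forall>l<k. b l \<notin> ssums b {..<l}" "ssums b {..<k} = F ! k" by auto
    have n: "\<forall>l<Suc k. b l \<notin> ssums b {..<l}" using IH b[of k] Suc.prems by (auto simp: less_Suc_eq)
    have "ssums b {..<Suc k} = F ! Suc k"
    proof (rule card_subset_eq[OF fin[OF Suc.prems]])
      show "ssums b {..<Suc k} \<subseteq> F ! Suc k"
      proof (rule ssums_minimal)
        show "fun_vs.subspace (F ! Suc k)" using D(2)[OF Suc.prems] .
        fix l assume "l \<in> {..<Suc k}"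
        then show "b l \<in> F ! Suc k"
        proof (cases "l = k")
          case True
          then show ?thesis using b[of k] Suc.prems by auto
        next
          case False
          then have "b l \<in> ssums b {..<k}" using \<open>l \<in> {..<Suc k}\<close> by (intro ssums_base) auto
          then show ?thesis using IH(2) strict[of k] Suc.prems by auto
        qed
      qed
      have "indep (Suc k) b" using n by (intro indep_ssums_sequential) auto
      then show "card (ssums b {..<Suc k}) = card (F ! Suc k)"
        using card_ssums[of "Suc k" b "Suc k"] card_subspace[OF D(2)[OF Suc.prems] fin[OF Suc.prems]] D(3)[OF Suc.prems] by simp
    qed
    then show ?case using n by blast
  qed
  have "indep R b" using eq[of R] by (intro indep_ssums_sequential) auto
  moreover have "b k \<in> F2 R" if "k < R" for k using b[OF that] D(4)[of "Suc k"] that by auto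
  ultimately show ?thesis using that[of b] eq by blast
qed

lemma span_f2_singleton: "fun_vs.span {v} = {0, v :: f2vec}"
  unfolding finite_span_f2[OF finite.insertI[OF finite.emptyI]] by (auto simp: Pow_insert)

text \<open>Adjoining a vector outside \<open>w\<close> doubles its cardinality and so fills
  \<open>X\<close>. The uniform choices in \<open>link_edge_pmf\<close> are therefore uniform on
  differences of consecutive flag members.\<close>

lemma adjacent_vectors:
  fixes w X :: "f2vec set"
  assumes w: "fun_vs.subspace w" "finite w" and X: "fun_vs.subspace X" "w \<subseteq> X" "card X = 2 * card w"
  shows "{v. w + fun_vs.span {v} = X} = X - w"
proof (intro equalityI subsetI)
  fix v assume "v \<in> {v. w + fun_vs.span {v} = X}"
  then have eq: "w + fun_vs.span {v} = X" by simp
  have 0: "0 \<in> w" using w by (simp add: f2_subspace_iff)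
  then have "0 + v \<in> w + fun_vs.span {v}" unfolding span_f2_singleton by (intro set_plus_intro) auto
  moreover have "v \<notin> w"
  proof
    assume v: "v \<in> w"
    have "X \<subseteq> w" unfolding eq[symmetric] span_f2_singleton
      using w v by (auto simp: set_plus_def f2_subspace_iff)
    then have "card X \<le> card w" using w(2) by (rule card_mono[rotated])
    moreover have "card w > 0" using w(2) 0 by (auto simp: card_gt_0_iff)
    ultimately show False using X by simp
  qed
  ultimately show "v \<in> X - w" using eq by simp
next
  fix v assume v: "v \<in> X - w"
  have finX: "finite X"
  proof -
    have "0 \<in> w" using w by (simp add: f2_subspace_iff)
    then have "card w > 0" using w(2) by (auto simp: card_gt_0_iff)
    then show ?thesis using X(3) by (intro card_ge_0_finite) simp
  qed
  have "w + fun_vs.span {v} = w \<union> (\<lambda>a. a + v) ` w"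
    unfolding span_f2_singleton by (auto simp: set_plus_def)
  moreover have "w \<union> (\<lambda>a. a + v) ` w = X"
  proof (rule card_subset_eq[OF finX])
    show "w \<union> (\<lambda>a. a + v) ` w \<subseteq> X" using X v by (auto simp: f2_subspace_iff)
    have dis: "w \<inter> (\<lambda>a. a + v) ` w = {}"
    proof (rule ccontr)
      assume "w \<inter> (\<lambda>a. a + v) ` w \<noteq> {}"
      then obtain a where a: "a \<in> w" "a + v \<in> w" by auto
      then have "a + (a + v) \<in> w" using w unfolding f2_subspace_iff by blast
      then show False using v by simp
    qed
    have "inj_on (\<lambda>a. a + v) w" by (rule inj_onI) simp
    then show "card (w \<union> (\<lambda>a. a + v) ` w) = card X"
      using X(3) w(2) by (simp add: card_Un_disjoint[OF _ _ dis] card_image)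
  qed
  ultimately show "v \<in> {v. w + fun_vs.span {v} = X}" by simp
qed

lemma span_f2_pair: "fun_vs.span {v, v' :: f2vec} = fun_vs.span {v} + fun_vs.span {v'}"
proof -
  have "{v, v'} = {v} \<union> {v'}" by auto
  then show ?thesis using fun_vs.span_Un[of "{v}" "{v'}"] by (auto simp: set_plus_def)
qed

lemma map_pmf_bij_invariant:
  assumes "bij_betw \<theta> A A" "finite A" "A \<noteq> {}"
  shows "map_pmf (\<lambda>x. f (\<theta> x)) (pmf_of_set A) = map_pmf f (pmf_of_set A)"
proof -
  have "map_pmf (\<lambda>x. f (\<theta> x)) (pmf_of_set A) = map_pmf f (map_pmf \<theta> (pmf_of_set A))"
    by (simp add: pmf.map_comp o_def)
  also have "map_pmf \<theta> (pmf_of_set A) = pmf_of_set A" using assms by (intro map_pmf_of_set_bij_betw)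
  finally show ?thesis .
qed

lemma cond_pmf_of_set:
  assumes "finite A" "A \<inter> S \<noteq> {}"
  shows "cond_pmf (pmf_of_set A) S = pmf_of_set (A \<inter> S)"
proof (rule pmf_eqI)
  fix x
  have ne: "A \<noteq> {}" using assms by blast
  then have c: "card A > 0" using assms by (simp add: card_gt_0_iff)
  have S: "set_pmf (pmf_of_set A) \<inter> S \<noteq> {}" using assms ne by simp
  show "pmf (cond_pmf (pmf_of_set A) S) x = pmf (pmf_of_set (A \<inter> S)) x"
    using assms ne c by (simp add: pmf_cond[OF S] measure_pmf_of_set indicator_def)
qed

section \<open>The poset of the frames and its random flag\<close>

context frame_system
begin

definition U :: "nat \<Rightarrow> 'a \<Rightarrow> f2vec set" where "U k \<omega> = ssums (V \<omega>) {..<k}"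

definition Flag :: "'a \<Rightarrow> f2vec set list" where "Flag \<omega> = map (\<lambda>k. U k \<omega>) [0..<Suc R]"

definition poset :: "f2vec set set" where
  "poset = {w. fun_vs.subspace w \<and> (\<exists>\<omega>\<in>\<Omega>. w \<subseteq> U R \<omega>)}"

definition weight :: "f2vec set pmf" where "weight = map_pmf (U R) (pmf_of_set \<Omega>)"

lemma U_image: "k \<le> R \<Longrightarrow> U k \<omega> = lincomb R (V \<omega>) ` F2 k"
  by (simp add: U_def lincomb_image_ssums)

lemma subspace_U: "fun_vs.subspace (U k \<omega>)"
  by (simp add: U_def subspace_ssums)

lemma finite_U: "finite (U k \<omega>)"
  by (simp add: U_def ssums_def)

lemma card_U: "\<omega> \<in> \<Omega> \<Longrightarrow> k \<le> R \<Longrightarrow> card (U k \<omega>) = 2 ^ k"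
  unfolding U_def by (rule card_ssums[OF V_indep])

lemma U_mono: "k \<le> l \<Longrightarrow> U k \<omega> \<subseteq> U l \<omega>"
  by (simp add: U_def ssums_mono)

lemma U_F2: "\<omega> \<in> \<Omega> \<Longrightarrow> k \<le> R \<Longrightarrow> U k \<omega> \<subseteq> F2 n"
  unfolding U_def using V_F2 by (intro ssums_minimal) auto

lemma inj_L: "\<omega> \<in> \<Omega> \<Longrightarrow> inj_on (lincomb R (V \<omega>)) (F2 R)"
  using V_indep by (simp add: indep_def)

lemma U_diff:
  assumes "\<omega> \<in> \<Omega>" "k \<le> R" "l \<le> R"
  shows "U l \<omega> - U k \<omega> = lincomb R (V \<omega>) ` (F2 l - F2 k)"
proof -
  have "F2 l - F2 k \<subseteq> F2 R" "F2 k \<subseteq> F2 R" using F2_mono[of l R] F2_mono[of k R] assms by auto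
  from inj_on_image_set_diff[OF inj_L[OF assms(1)] this] show ?thesis using assms by (simp add: U_image)
qed

lemma U_reframe:
  assumes "\<And>k. k < R \<Longrightarrow> V \<omega>' k = lincomb R (V \<omega>) (b k)" "k \<le> R"
  shows "U k \<omega>' = lincomb R (V \<omega>) ` ssums b {..<k}"
proof -
  have "lincomb R (V \<omega>') c = lincomb R (V \<omega>) (lincomb R b c)" for c
    unfolding lincomb_lincomb by (rule lincomb_cong) (rule assms(1))
  then have "U k \<omega>' = lincomb R (V \<omega>) ` (lincomb R b ` F2 k)"
    using assms(2) by (simp add: U_image image_image)
  then show ?thesis using assms(2) by (simp add: lincomb_image_ssums)
qed

text \<open>Pulled back to coefficients, \<open>w\<close> and \<open>v\<close> have an adapted
  basis, and invariance under its action produces a frame of the system with prefix span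
  \<open>w\<close> and next vector \<open>v\<close>. Hence the levels of the poset consist of prefix
  spans only.\<close>

lemma realize_pair:
  assumes \<omega>: "\<omega> \<in> \<Omega>" and w: "fun_vs.subspace w" "w \<subseteq> U R \<omega>" "card w = 2 ^ i" and v: "v \<in> U R \<omega>" "v \<notin> w"
  obtains \<omega>' where "\<omega>' \<in> \<Omega>" "U i \<omega>' = w" "V \<omega>' i = v" "i < R"
proof -
  let ?L = "lincomb R (V \<omega>)"
  define w0 where "w0 = {c \<in> F2 R. ?L c \<in> w}"
  have im: "?L ` w0 = w" using w(2) by (auto simp: w0_def U_image)
  have w0: "fun_vs.subspace w0" using w(1) by (auto simp: w0_def f2_subspace_iff lincomb_add)
  have sub: "w0 \<subseteq> F2 R" by (auto simp: w0_def)
  have card_w0: "card w0 = 2 ^ i"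
    using card_image[of ?L w0] inj_on_subset[OF inj_L[OF \<omega>] sub] im w(3) by simp
  obtain x where x: "x \<in> F2 R" "?L x = v" using v by (auto simp: U_image)
  have "x \<notin> w0" using x v by (simp add: w0_def)
  obtain b where b: "indep R b" "\<And>k. k < R \<Longrightarrow> b k \<in> F2 R" "ssums b {..<i} = w0" "b i = x" "i < R"
    by (rule adapted_basis[OF w0 sub card_w0 x(1) \<open>x \<notin> w0\<close>]) (rule that)
  obtain \<theta> where \<theta>: "bij_betw \<theta> \<Omega> \<Omega>" "\<forall>\<omega>\<in>\<Omega>. \<forall>k<R. V (\<theta> \<omega>) k = lincomb R (V \<omega>) (b k)"
    using V_GL[OF b(1,2)] by blast
  have "\<theta> \<omega> \<in> \<Omega>" using \<theta>(1) \<omega> by (auto simp: bij_betw_def)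
  moreover have "U i (\<theta> \<omega>) = w"
    using U_reframe[of "\<theta> \<omega>" \<omega> b i] \<theta>(2) \<omega> b(3,5) im by simp
  moreover have "V (\<theta> \<omega>) i = v" using \<theta>(2) \<omega> b(4,5) x by simp
  ultimately show ?thesis using that b(5) by blast
qed

lemma realize:
  assumes \<omega>: "\<omega> \<in> \<Omega>" and w: "fun_vs.subspace w" "w \<subseteq> U R \<omega>" "card w = 2 ^ i"
  obtains \<omega>' where "\<omega>' \<in> \<Omega>" "U i \<omega>' = w" "i \<le> R"
proof (cases "w = U R \<omega>")
  case True
  then have "i = R" using card_U[OF \<omega>, of R] w(3) by simp
  then show ?thesis using that True \<omega> by blast
next
  case False
  then obtain v where "v \<in> U R \<omega>" "v \<notin> w" using w(2) by blast
  then show ?thesis using realize_pair[OF \<omega> w, of v] that by (metis less_imp_le)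
qed

lemma mem_level: "w \<in> level poset i \<longleftrightarrow> (\<exists>\<omega>\<in>\<Omega>. U i \<omega> = w \<and> i \<le> R)"
proof
  assume w: "w \<in> level poset i"
  then obtain \<omega> where \<omega>: "\<omega> \<in> \<Omega>" "w \<subseteq> U R \<omega>" "fun_vs.subspace w" "fun_vs.dim w = i"
    by (auto simp: level_def poset_def)
  have "finite w" using \<omega>(2) finite_U finite_subset by blast
  then have "card w = 2 ^ i" using card_subspace[OF \<omega>(3)] \<omega>(4) by simp
  then show "\<exists>\<omega>\<in>\<Omega>. U i \<omega> = w \<and> i \<le> R" using realize[OF \<omega>(1,3,2)] by metis
next
  assume "\<exists>\<omega>\<in>\<Omega>. U i \<omega> = w \<and> i \<le> R"
  then obtain \<omega> where \<omega>: "\<omega> \<in> \<Omega>" "U i \<omega> = w" "i \<le> R" by blast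
  have "fun_vs.dim w = i" using dim_f2_iff[OF subspace_U finite_U, of i \<omega> i] card_U[OF \<omega>(1,3)] \<omega>(2) by simp
  then show "w \<in> level poset i" using \<omega> U_mono[of i R \<omega>] subspace_U[of i \<omega>] by (auto simp: level_def poset_def)
qed

lemma measured: "measured_grassmann_poset R n poset weight"
  unfolding measured_grassmann_poset_def grassmann_poset_def
proof (intro conjI ballI allI impI)
  fix w assume "w \<in> poset"
  then show "fun_vs.subspace w" "w \<subseteq> F2 n" using U_F2[of _ R] by (auto simp: poset_def)
next
  fix w w' assume "w \<in> poset" "fun_vs.subspace w' \<and> w' \<subseteq> w"
  then show "w' \<in> poset" by (auto simp: poset_def)
next
  fix w assume w: "w \<in> poset" "\<forall>u\<in>poset. w \<subseteq> u \<longrightarrow> u = w"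
  then obtain \<omega> where \<omega>: "\<omega> \<in> \<Omega>" "w \<subseteq> U R \<omega>" by (auto simp: poset_def)
  have "U R \<omega> \<in> level poset R" using mem_level \<omega> by blast
  then show "fun_vs.dim w = R" using w(2) \<omega>(2) by (auto simp: level_def)
next
  show "set_pmf weight = level poset R"
    using fin_\<Omega> ne_\<Omega> mem_level[of _ R] by (auto simp: weight_def)
qed

text \<open>A frame identifies the flags of its span with the flags of \<open>F2 R\<close>, so the
  flag can be drawn first, independently of the frame. For each fixed flag of \<open>F2 R\<close> an
  adapted basis acts as an invertible matrix, and invariance reduces it to the flag of prefix
  spans.\<close>

lemma random_flag_weight: "random_flag weight = map_pmf Flag (pmf_of_set \<Omega>)"
proof -
  define CF where "CF = complete_flags (F2 R)"
  have CF: "finite CF" "CF \<noteq> {}"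
    using finite_complete_flags[OF finite_F2] standard_flag by (auto simp: CF_def)
  have subF: "X \<subseteq> F2 R" if "F \<in> CF" "X \<in> set F" for F X
    using that complete_flagsD(4)[of F "F2 R"] complete_flagsD(1)[of F "F2 R" 0]
    by (auto simp: CF_def in_set_conv_nth less_Suc_eq_le)
  have cf: "pmf_of_set (complete_flags (U R \<omega>)) = map_pmf (map (image (lincomb R (V \<omega>)))) (pmf_of_set CF)"
    if \<omega>: "\<omega> \<in> \<Omega>" for \<omega>
  proof -
    let ?L = "lincomb R (V \<omega>)"
    define M where "M = inv_into (F2 R) ?L"
    have UL: "U R \<omega> = ?L ` F2 R" by (simp add: U_image)
    have retr: "M (?L c) = c" if "c \<in> F2 R" for c
      unfolding M_def using inj_L[OF \<omega>] that by (rule inv_into_f_f)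
    have LM: "?L (M x) = x" "M x \<in> F2 R" if "x \<in> U R \<omega>" for x
      using that retr by (auto simp: UL)
    have "complete_flags (U R \<omega>) = map (image ?L) ` CF"
    proof (intro equalityI subsetI)
      fix F assume F: "F \<in> complete_flags (U R \<omega>)"
      have "map (image M) F \<in> complete_flags (M ` U R \<omega>)"
      proof (rule complete_flags_image[OF subspace_U finite_U _ _ F])
        show "inj_on M (U R \<omega>)" using LM by (metis inj_onI)
        fix x y assume xy: "x \<in> U R \<omega>" "y \<in> U R \<omega>"
        have "?L (M x + M y) = x + y" using LM xy by (simp add: lincomb_add)
        then show "M (x + y) = M x + M y" using retr[of "M x + M y"] LM xy by (metis F2_add)
      qed
      moreover have "M ` U R \<omega> = F2 R" unfolding UL image_image using retr by auto
      ultimately have "map (image M) F \<in> CF" by (simp add: CF_def)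
      moreover have "map (image ?L) (map (image M) F) = F"
      proof -
        have "?L ` M ` X = X" if "X \<in> set F" for X
        proof -
          have "X \<subseteq> U R \<omega>"
            using that complete_flagsD(4)[OF F] complete_flagsD(1)[OF F, of 0]
            by (auto simp: in_set_conv_nth less_Suc_eq_le)
          then show ?thesis using LM by (force simp: image_image)
        qed
        then show ?thesis by (simp add: map_idI)
      qed
      ultimately show "F \<in> map (image ?L) ` CF" by (metis image_eqI)
    next
      fix F assume "F \<in> map (image ?L) ` CF"
      then obtain F0 where F0: "F0 \<in> CF" "F = map (image ?L) F0" by blast
      show "F \<in> complete_flags (U R \<omega>)"
        unfolding UL F0(2) by (rule complete_flags_image) (use F0 inj_L[OF \<omega>] in \<open>auto simp: CF_def lincomb_add\<close>)
    qed
    moreover have "inj_on (map (image ?L)) CF"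
    proof (rule inj_onI)
      fix F G assume FG: "F \<in> CF" "G \<in> CF" "map (image ?L) F = map (image ?L) G"
      then have len: "length F = length G" by (metis length_map)
      show "F = G"
      proof (rule nth_equalityI[OF len])
        fix k assume k: "k < length F"
        have "?L ` (F ! k) = ?L ` (G ! k)" using FG(3) k len by (metis nth_map)
        moreover have "F ! k \<subseteq> F2 R" "G ! k \<subseteq> F2 R" using subF FG k len by auto
        ultimately show "F ! k = G ! k" using inj_on_image_eq_iff[OF inj_L[OF \<omega>]] by blast
      qed
    qed
    ultimately show ?thesis using CF by (simp add: map_pmf_of_set_inj)
  qed
  have flag: "map_pmf (\<lambda>\<omega>. map (image (lincomb R (V \<omega>))) F) (pmf_of_set \<Omega>) = map_pmf Flag (pmf_of_set \<Omega>)"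
    if F: "F \<in> CF" for F
  proof -
    have lenF: "length F = Suc R" using F complete_flagsD(1)[of F "F2 R" 0] by (simp add: CF_def)
    obtain b where b: "indep R b" "\<And>k. k < R \<Longrightarrow> b k \<in> F2 R" "\<And>k. k \<le> R \<Longrightarrow> ssums b {..<k} = F ! k"
      using flag_basis F unfolding CF_def by metis
    obtain \<theta> where \<theta>: "bij_betw \<theta> \<Omega> \<Omega>" "\<forall>\<omega>\<in>\<Omega>. \<forall>k<R. V (\<theta> \<omega>) k = lincomb R (V \<omega>) (b k)"
      using V_GL[OF b(1,2)] by blast
    have "map (image (lincomb R (V \<omega>))) F = Flag (\<theta> \<omega>)" if \<omega>: "\<omega> \<in> \<Omega>" for \<omega>
    proof (rule nth_equalityI)
      fix k assume k: "k < length (map (image (lincomb R (V \<omega>))) F)"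
      then have kR: "k \<le> R" using lenF by simp
      have "U k (\<theta> \<omega>) = lincomb R (V \<omega>) ` (F ! k)"
        using U_reframe[of "\<theta> \<omega>" \<omega> b k] \<theta>(2) \<omega> kR b(3)[OF kR] by simp
      then show "map (image (lincomb R (V \<omega>))) F ! k = Flag (\<theta> \<omega>) ! k"
        using k kR lenF by (simp add: Flag_def del: upt_Suc)
    qed (simp add: lenF Flag_def)
    then have "map_pmf (\<lambda>\<omega>. map (image (lincomb R (V \<omega>))) F) (pmf_of_set \<Omega>) = map_pmf (\<lambda>\<omega>. Flag (\<theta> \<omega>)) (pmf_of_set \<Omega>)"
      using fin_\<Omega> ne_\<Omega> by (intro map_pmf_cong) auto
    then show ?thesis using map_pmf_bij_invariant[OF \<theta>(1) fin_\<Omega> ne_\<Omega>] by metis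
  qed
  have "random_flag weight = bind_pmf (pmf_of_set \<Omega>) (\<lambda>\<omega>. pmf_of_set (complete_flags (U R \<omega>)))"
    by (simp add: random_flag_def weight_def bind_map_pmf)
  also have "\<dots> = bind_pmf (pmf_of_set \<Omega>) (\<lambda>\<omega>. bind_pmf (pmf_of_set CF)
      (\<lambda>F. return_pmf (map (image (lincomb R (V \<omega>))) F)))"
    using fin_\<Omega> ne_\<Omega> cf by (intro bind_pmf_cong) (auto simp: map_pmf_def)
  also have "\<dots> = bind_pmf (pmf_of_set CF) (\<lambda>F. map_pmf (\<lambda>\<omega>. map (image (lincomb R (V \<omega>))) F) (pmf_of_set \<Omega>))"
    by (subst bind_commute_pmf) (simp add: map_pmf_def)
  also have "\<dots> = bind_pmf (pmf_of_set CF) (\<lambda>F. map_pmf Flag (pmf_of_set \<Omega>))"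
    using CF flag by (intro bind_pmf_cong) auto
  finally show ?thesis by simp
qed

text \<open>The two vectors of the edge have uniform coefficient vectors in \<open>B1\<close> and
  \<open>B2\<close>. Any such pair, placed at positions \<open>i\<close> and \<open>Suc i\<close> of
  the identity, gives an invertible matrix that keeps the first \<open>i\<close> vectors, so it may
  be replaced by \<open>unitv i\<close> and \<open>unitv (Suc i)\<close>.\<close>

lemma link_edge_weight:
  assumes i: "i + 2 \<le> R" and w: "w \<in> level poset i"
  shows "link_edge_pmf weight i w = map_pmf (\<lambda>\<omega>. {V \<omega> i, V \<omega> (Suc i)}) (pmf_of_set {\<omega>\<in>\<Omega>. U i \<omega> = w})"
proof -
  define A where "A = {\<omega>\<in>\<Omega>. U i \<omega> = w}"
  have A: "finite A" "A \<noteq> {}" "A \<subseteq> \<Omega>" using fin_\<Omega> w mem_level by (auto simp: A_def)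
  define B1 where "B1 = F2 (Suc i) - F2 i"
  define B2 where "B2 = F2 (Suc (Suc i)) - F2 (Suc i)"
  have "unitv i \<in> B1" "unitv (Suc i) \<in> B2" by (simp_all add: B1_def B2_def)
  then have B: "B1 \<noteq> {}" "B2 \<noteq> {}" "finite B1" "finite B2" by (blast, blast) (simp_all add: B1_def B2_def)
  have sub: "F2 i \<subseteq> F2 R" "F2 (Suc i) \<subseteq> F2 R" "F2 (Suc (Suc i)) \<subseteq> F2 R" using i by (auto intro!: F2_mono)
  have Flag_nth: "Flag \<omega> ! k = U k \<omega>" if "k \<le> R" for \<omega> k
    using that by (simp add: Flag_def del: upt_Suc)
  have set1: "{v. w + fun_vs.span {v} = U (Suc i) \<omega>} = lincomb R (V \<omega>) ` B1" if \<omega>: "\<omega> \<in> A" for \<omega>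
  proof -
    have \<omega>': "\<omega> \<in> \<Omega>" "w = U i \<omega>" using \<omega> by (auto simp: A_def)
    have "{v. w + fun_vs.span {v} = U (Suc i) \<omega>} = U (Suc i) \<omega> - U i \<omega>"
      unfolding \<omega>'(2) by (rule adjacent_vectors) (use \<omega>' i in \<open>auto simp: subspace_U finite_U card_U intro!: U_mono\<close>)
    also have "\<dots> = lincomb R (V \<omega>) ` B1"
      unfolding B1_def using i by (intro U_diff \<omega>'(1)) auto
    finally show ?thesis .
  qed
  have set2: "{v'. w + fun_vs.span {v, v'} = U (Suc (Suc i)) \<omega>} = lincomb R (V \<omega>) ` B2"
    if \<omega>: "\<omega> \<in> A" and v: "w + fun_vs.span {v} = U (Suc i) \<omega>" for \<omega> v
  proof -
    have \<omega>': "\<omega> \<in> \<Omega>" "w = U i \<omega>" using \<omega> by (auto simp: A_def)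
    have "w + fun_vs.span {v, v'} = U (Suc i) \<omega> + fun_vs.span {v'}" for v'
      unfolding span_f2_pair v[symmetric] by (simp add: add.assoc)
    then have "{v'. w + fun_vs.span {v, v'} = U (Suc (Suc i)) \<omega>} = U (Suc (Suc i)) \<omega> - U (Suc i) \<omega>"
      using adjacent_vectors[OF subspace_U finite_U subspace_U, of "Suc i" \<omega> "Suc (Suc i)" \<omega>] \<omega>' i
      by (simp add: card_U U_mono)
    also have "\<dots> = lincomb R (V \<omega>) ` B2"
      unfolding B2_def using i by (intro U_diff \<omega>'(1)) auto
    finally show ?thesis .
  qed
  have inj: "inj_on (lincomb R (V \<omega>)) B1" "inj_on (lincomb R (V \<omega>)) B2" if "\<omega> \<in> A" for \<omega>
  proof -
    have "inj_on (lincomb R (V \<omega>)) (F2 R)" using that A(3) by (intro inj_L) blast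
    moreover have "B1 \<subseteq> F2 R" "B2 \<subseteq> F2 R" using sub by (auto simp: B1_def B2_def)
    ultimately show "inj_on (lincomb R (V \<omega>)) B1" "inj_on (lincomb R (V \<omega>)) B2" by (simp_all add: inj_on_subset)
  qed
  have pair: "map_pmf (\<lambda>\<omega>. {lincomb R (V \<omega>) c, lincomb R (V \<omega>) c'}) (pmf_of_set A) =
      map_pmf (\<lambda>\<omega>. {V \<omega> i, V \<omega> (Suc i)}) (pmf_of_set A)" if c: "c \<in> B1" "c' \<in> B2" for c c'
  proof -
    define b where "b k = (if k = i then c else if k = Suc i then c' else unitv k)" for k
    have bF: "b k \<in> F2 (Suc k)" for k using c by (auto simp: b_def B1_def B2_def)
    have low: "ssums b {..<k} \<subseteq> F2 k" for k
    proof (rule ssums_minimal[OF subspace_F2])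
      fix l assume "l \<in> {..<k}"
      then show "b l \<in> F2 k" using bF[of l] F2_mono[of "Suc l" k] by auto
    qed
    have "b k \<notin> F2 k" for k using c by (auto simp: b_def B1_def B2_def)
    then have ind: "indep R b" using low by (intro indep_ssums_sequential) blast
    have bR: "b k \<in> F2 R" if "k < R" for k using bF[of k] F2_mono[of "Suc k" R] that by auto
    obtain \<theta> where \<theta>: "bij_betw \<theta> \<Omega> \<Omega>" "\<forall>\<omega>\<in>\<Omega>. \<forall>k<R. V (\<theta> \<omega>) k = lincomb R (V \<omega>) (b k)"
      using V_GL[OF ind bR] by blast
    have same: "V (\<theta> \<omega>) k = V \<omega> k" if "\<omega> \<in> \<Omega>" "k < i" for \<omega> k
      using \<theta>(2) that i by (simp add: b_def)
    have bij: "bij_betw \<theta> A A"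
    proof (rule bij_betw_invariant[OF \<theta>(1) A(3)])
      fix \<omega> assume \<omega>: "\<omega> \<in> \<Omega>"
      then have "U i (\<theta> \<omega>) = U i \<omega>" unfolding U_def using same by (intro ssums_cong) auto
      moreover have "\<theta> \<omega> \<in> \<Omega>" using \<theta>(1) \<omega> by (auto simp: bij_betw_def)
      ultimately show "\<theta> \<omega> \<in> A \<longleftrightarrow> \<omega> \<in> A" using \<omega> by (simp add: A_def)
    qed
    have "map_pmf (\<lambda>\<omega>. {lincomb R (V \<omega>) c, lincomb R (V \<omega>) c'}) (pmf_of_set A) =
        map_pmf (\<lambda>\<omega>. {V (\<theta> \<omega>) i, V (\<theta> \<omega>) (Suc i)}) (pmf_of_set A)"
    proof (rule map_pmf_cong[OF refl])
      fix \<omega> assume "\<omega> \<in> set_pmf (pmf_of_set A)"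
      then have "\<omega> \<in> \<Omega>" using A by auto
      then show "{lincomb R (V \<omega>) c, lincomb R (V \<omega>) c'} = {V (\<theta> \<omega>) i, V (\<theta> \<omega>) (Suc i)}"
        using \<theta>(2) i by (simp add: b_def)
    qed
    also have "\<dots> = map_pmf (\<lambda>\<omega>. {V \<omega> i, V \<omega> (Suc i)}) (pmf_of_set A)"
      by (rule map_pmf_bij_invariant[OF bij A(1,2), of "\<lambda>\<omega>. {V \<omega> i, V \<omega> (Suc i)}"])
    finally show ?thesis .
  qed
  have "cond_pmf (random_flag weight) {F. F ! i = w} = map_pmf Flag (cond_pmf (pmf_of_set \<Omega>) (Flag -` {F. F ! i = w}))"
    unfolding random_flag_weight
    by (rule cond_map_pmf) (use A fin_\<Omega> ne_\<Omega> i Flag_nth in \<open>auto simp: A_def\<close>)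
  also have "cond_pmf (pmf_of_set \<Omega>) (Flag -` {F. F ! i = w}) = pmf_of_set A"
  proof -
    have "\<Omega> \<inter> (Flag -` {F. F ! i = w}) = A" using i Flag_nth by (auto simp: A_def)
    then show ?thesis using A fin_\<Omega> ne_\<Omega> by (simp add: cond_pmf_of_set)
  qed
  finally have cond: "cond_pmf (random_flag weight) {F. F ! i = w} = map_pmf Flag (pmf_of_set A)" .
  have "link_edge_pmf weight i w = bind_pmf (pmf_of_set A) (\<lambda>\<omega>.
     bind_pmf (pmf_of_set {v. w + fun_vs.span {v} = U (Suc i) \<omega>}) (\<lambda>v.
     bind_pmf (pmf_of_set {v'. w + fun_vs.span {v, v'} = U (Suc (Suc i)) \<omega>}) (\<lambda>v'.
     return_pmf {v, v'})))"
    unfolding link_edge_pmf_def cond bind_map_pmf using i Flag_nth by simp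
  also have "\<dots> = bind_pmf (pmf_of_set A) (\<lambda>\<omega>. bind_pmf (pmf_of_set B1) (\<lambda>c. bind_pmf (pmf_of_set B2) (\<lambda>c'.
     return_pmf {lincomb R (V \<omega>) c, lincomb R (V \<omega>) c'})))"
  proof (rule bind_pmf_cong[OF refl])
    fix \<omega> assume "\<omega> \<in> set_pmf (pmf_of_set A)"
    then have \<omega>: "\<omega> \<in> A" using A by simp
    have "bind_pmf (pmf_of_set {v. w + fun_vs.span {v} = U (Suc i) \<omega>}) (\<lambda>v.
       bind_pmf (pmf_of_set {v'. w + fun_vs.span {v, v'} = U (Suc (Suc i)) \<omega>}) (\<lambda>v'. return_pmf {v, v'})) =
      bind_pmf (pmf_of_set {v. w + fun_vs.span {v} = U (Suc i) \<omega>}) (\<lambda>v.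
       bind_pmf (pmf_of_set (lincomb R (V \<omega>) ` B2)) (\<lambda>v'. return_pmf {v, v'}))"
    proof (rule bind_pmf_cong[OF refl])
      fix v assume "v \<in> set_pmf (pmf_of_set {v. w + fun_vs.span {v} = U (Suc i) \<omega>})"
      then have "w + fun_vs.span {v} = U (Suc i) \<omega>" using B set1[OF \<omega>] by auto
      then show "bind_pmf (pmf_of_set {v'. w + fun_vs.span {v, v'} = U (Suc (Suc i)) \<omega>}) (\<lambda>v'. return_pmf {v, v'}) =
         bind_pmf (pmf_of_set (lincomb R (V \<omega>) ` B2)) (\<lambda>v'. return_pmf {v, v'})"
        by (simp only: set2[OF \<omega>])
    qed
    then show "bind_pmf (pmf_of_set {v. w + fun_vs.span {v} = U (Suc i) \<omega>}) (\<lambda>v.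
       bind_pmf (pmf_of_set {v'. w + fun_vs.span {v, v'} = U (Suc (Suc i)) \<omega>}) (\<lambda>v'. return_pmf {v, v'})) =
      bind_pmf (pmf_of_set B1) (\<lambda>c. bind_pmf (pmf_of_set B2) (\<lambda>c'.
       return_pmf {lincomb R (V \<omega>) c, lincomb R (V \<omega>) c'}))"
      unfolding set1[OF \<omega>] using B inj[OF \<omega>] by (simp add: bind_map_pmf flip: map_pmf_of_set_inj)
  qed
  also have "\<dots> = bind_pmf (pmf_of_set B1) (\<lambda>c. bind_pmf (pmf_of_set B2) (\<lambda>c'.
     map_pmf (\<lambda>\<omega>. {lincomb R (V \<omega>) c, lincomb R (V \<omega>) c'}) (pmf_of_set A)))"
    by (subst bind_commute_pmf, subst bind_commute_pmf) (simp add: map_pmf_def)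
  also have "\<dots> = bind_pmf (pmf_of_set B1) (\<lambda>c. bind_pmf (pmf_of_set B2) (\<lambda>c'.
     map_pmf (\<lambda>\<omega>. {V \<omega> i, V \<omega> (Suc i)}) (pmf_of_set A)))"
    using B pair by (intro bind_pmf_cong) auto
  finally show ?thesis by (simp add: A_def)
qed

end

section \<open>Spectral gap of the links\<close>

context frame_system
begin

lemma link_vertices_eq:
  assumes i: "i < R" and w: "w \<in> level poset i"
  shows "link_vertices n poset i w = (\<lambda>\<omega>. V \<omega> i) ` {\<omega>\<in>\<Omega>. U i \<omega> = w}"
proof (intro equalityI subsetI)
  obtain \<omega>0 where \<omega>0: "\<omega>0 \<in> \<Omega>" "U i \<omega>0 = w" using w mem_level by blast
  have sw: "fun_vs.subspace w" "finite w" "card w = 2 ^ i"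
    using \<omega>0 i subspace_U[of i \<omega>0] finite_U[of i \<omega>0] card_U[OF \<omega>0(1), of i] by auto
  fix v assume "v \<in> link_vertices n poset i w"
  then have "w + fun_vs.span {v} \<in> level poset (Suc i)" by (simp add: link_vertices_def add.commute)
  then obtain \<omega> where \<omega>: "\<omega> \<in> \<Omega>" "U (Suc i) \<omega> = w + fun_vs.span {v}" using mem_level by blast
  have cU: "card (U (Suc i) \<omega>) = 2 * card w" using card_U[OF \<omega>(1), of "Suc i"] i sw(3) by simp
  have 0: "0 \<in> w" "0 \<in> fun_vs.span {v}" using sw(1) by (simp_all add: f2_subspace_iff fun_vs.span_zero)
  have wU: "w \<subseteq> U (Suc i) \<omega>"
  proof
    fix x assume "x \<in> w"
    then have "x + 0 \<in> w + fun_vs.span {v}" using 0 by (intro set_plus_intro)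
    then show "x \<in> U (Suc i) \<omega>" using \<omega>(2) by simp
  qed
  have "v \<in> U (Suc i) \<omega> - w"
    using adjacent_vectors[OF sw(1,2) subspace_U wU cU] \<omega>(2) by blast
  then have v: "v \<in> U R \<omega>" "v \<notin> w" "w \<subseteq> U R \<omega>" using wU U_mono[of "Suc i" R \<omega>] i by auto
  obtain \<omega>' where "\<omega>' \<in> \<Omega>" "U i \<omega>' = w" "V \<omega>' i = v"
    by (rule realize_pair[OF \<omega>(1) sw(1) v(3) sw(3) v(1,2)]) (rule that)
  then show "v \<in> (\<lambda>\<omega>. V \<omega> i) ` {\<omega>\<in>\<Omega>. U i \<omega> = w}" by blast
next
  fix v assume "v \<in> (\<lambda>\<omega>. V \<omega> i) ` {\<omega>\<in>\<Omega>. U i \<omega> = w}"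
  then obtain \<omega> where \<omega>: "\<omega> \<in> \<Omega>" "U i \<omega> = w" "v = V \<omega> i" by blast
  have "U (Suc i) \<omega> - U i \<omega> = lincomb R (V \<omega>) ` (F2 (Suc i) - F2 i)" using \<omega> i by (intro U_diff) auto
  moreover have "unitv i \<in> F2 (Suc i) - F2 i" by simp
  moreover have "v = lincomb R (V \<omega>) (unitv i)" using \<omega> i by simp
  ultimately have v: "v \<in> U (Suc i) \<omega> - U i \<omega>" by blast
  have "{v. U i \<omega> + fun_vs.span {v} = U (Suc i) \<omega>} = U (Suc i) \<omega> - U i \<omega>"
    by (rule adjacent_vectors) (use \<omega> i in \<open>auto simp: subspace_U finite_U card_U intro!: U_mono\<close>)
  then have "w + fun_vs.span {v} = U (Suc i) \<omega>" using v \<omega> by blast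
  then have "w + fun_vs.span {v} \<in> level poset (Suc i)" using mem_level \<omega> i by auto
  moreover have "v \<in> F2 n" using \<omega> i V_F2 by simp
  ultimately show "v \<in> link_vertices n poset i w" by (simp add: link_vertices_def add.commute)
qed

lemma V_distinct: "\<omega> \<in> \<Omega> \<Longrightarrow> i < R \<Longrightarrow> j < R \<Longrightarrow> i \<noteq> j \<Longrightarrow> V \<omega> i \<noteq> V \<omega> j"
  using V_inj[of \<omega> "{i}" "{j}"] by auto

lemma swap_class:
  assumes i: "Suc i < R"
  obtains \<theta> where "bij_betw \<theta> {\<omega>\<in>\<Omega>. U i \<omega> = w} {\<omega>\<in>\<Omega>. U i \<omega> = w}"
    "\<And>\<omega>. \<omega> \<in> \<Omega> \<Longrightarrow> V (\<theta> \<omega>) i = V \<omega> (Suc i)" "\<And>\<omega>. \<omega> \<in> \<Omega> \<Longrightarrow> V (\<theta> \<omega>) (Suc i) = V \<omega> i"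
proof -
  have "Transposition.transpose i (Suc i) permutes {..<R}" using i by (intro permutes_swap_id) auto
  then obtain \<theta> where \<theta>: "bij_betw \<theta> \<Omega> \<Omega>"
    "\<And>\<omega> k. \<omega> \<in> \<Omega> \<Longrightarrow> k < R \<Longrightarrow> V (\<theta> \<omega>) k = V \<omega> (Transposition.transpose i (Suc i) k)"
    by (rule permute) (rule that)
  have "bij_betw \<theta> {\<omega>\<in>\<Omega>. U i \<omega> = w} {\<omega>\<in>\<Omega>. U i \<omega> = w}"
  proof (rule bij_betw_invariant[OF \<theta>(1)])
    fix \<omega> assume \<omega>: "\<omega> \<in> \<Omega>"
    have "U i (\<theta> \<omega>) = U i \<omega>"
      unfolding U_def using \<theta>(2)[OF \<omega>] i by (intro ssums_cong) (auto simp: transpose_def)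
    moreover have "\<theta> \<omega> \<in> \<Omega>" using \<theta>(1) \<omega> by (auto simp: bij_betw_def)
    ultimately show "\<theta> \<omega> \<in> {\<omega>\<in>\<Omega>. U i \<omega> = w} \<longleftrightarrow> \<omega> \<in> {\<omega>\<in>\<Omega>. U i \<omega> = w}" using \<omega> by simp
  qed auto
  then show ?thesis using that[of \<theta>] \<theta>(2) i by simp
qed

text \<open>A link fixes the prefix span whereas \<open>expanding\<close> fixes the prefix vectors.
  The frames with prefix span \<open>w\<close> form a union of such classes, and a dummy second
  component brings them into the form of \<open>expanding_fst\<close>.\<close>

lemma link_gap:
  fixes G :: "f2vec \<Rightarrow> real"
  assumes exp: "expanding lam" and i: "Suc i < R"
    and zero: "(\<Sum>\<omega>\<in>{\<omega>\<in>\<Omega>. U i \<omega> = w}. G (V \<omega> i)) = 0"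
  shows "\<bar>\<Sum>\<omega>\<in>{\<omega>\<in>\<Omega>. U i \<omega> = w}. G (V \<omega> i) * G (V \<omega> (Suc i))\<bar>
    \<le> lam * (\<Sum>\<omega>\<in>{\<omega>\<in>\<Omega>. U i \<omega> = w}. (G (V \<omega> i))\<^sup>2)"
proof -
  define A where "A = {\<omega>\<in>\<Omega>. U i \<omega> = w}"
  have re: "(\<Sum>x\<in>A \<times> {()}. h (fst x)) = (\<Sum>\<omega>\<in>A. h \<omega>)" for h :: "'a \<Rightarrow> real"
    using sum.cartesian_product[of "\<lambda>x y. h x" "{()}" A] by (simp add: split_def)
  have "\<bar>\<Sum>x\<in>A \<times> {()}. G (V (fst x) i) * G (V (fst x) (Suc i))\<bar> \<le> lam * (\<Sum>x\<in>A \<times> {()}. (G (V (fst x) i))\<^sup>2)"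
  proof (rule expanding_fst[OF exp, where C = "{..<i}"])
    show "finite (A \<times> {()})" using fin_\<Omega> by (simp add: A_def)
    show "fst ` (A \<times> {()}) \<subseteq> \<Omega>" by (auto simp: A_def)
    show "(\<Sum>x\<in>A \<times> {()}. G (V (fst x) i)) = 0" using zero re[of "\<lambda>\<omega>. G (V \<omega> i)"] by (simp add: A_def)
  next
    fix p q p' assume p: "(p, q) \<in> A \<times> {()}" "p' \<in> cls {..<i} p"
    then have "U i p' = U i p" unfolding U_def by (intro ssums_cong) (auto simp: cls_def)
    then show "(p', q) \<in> A \<times> {()}" using p by (auto simp: A_def cls_def)
  next
    fix x x' k assume "x \<in> A \<times> {()}" "x' \<in> A \<times> {()}" and k: "k \<in> {..<i}"
    then have "U i (fst x) = U i (fst x')" by (auto simp: A_def)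
    then show "V (fst x') k \<in> ssums (V (fst x)) {..<i}" using ssums_base[OF k, of "V (fst x')"] by (simp add: U_def)
  qed (use i in auto)
  then show ?thesis
    using re[of "\<lambda>\<omega>. G (V \<omega> i) * G (V \<omega> (Suc i))"] re[of "\<lambda>\<omega>. (G (V \<omega> i))\<^sup>2"] by (simp add: A_def)
qed

lemma link_lambda_le:
  assumes exp: "expanding lam" and lam: "lam < 1" and i: "i + 2 \<le> R" and w: "w \<in> level poset i"
  shows "link_lambda n poset weight i w \<le> lam"
proof -
  define A where "A = {\<omega>\<in>\<Omega>. U i \<omega> = w}"
  define VS where "VS = (\<lambda>\<omega>. V \<omega> i) ` A"
  \<comment> \<open>\<open>N\<close> counts frames by the ordered pair of their vectors at
    \<open>i\<close> and \<open>Suc i\<close>, so that sums over vertices become sums over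
    frames.\<close>
  define N where "N v u = (\<Sum>\<omega>\<in>A. of_bool (V \<omega> i = v \<and> V \<omega> (Suc i) = u) :: real)" for v u
  have A: "finite A" "A \<noteq> {}" "A \<subseteq> \<Omega>" using fin_\<Omega> w mem_level by (auto simp: A_def)
  have iR: "i < R" "Suc i < R" using i by auto
  obtain \<theta> where \<theta>: "bij_betw \<theta> A A"
    "\<And>\<omega>. \<omega> \<in> \<Omega> \<Longrightarrow> V (\<theta> \<omega>) i = V \<omega> (Suc i)" "\<And>\<omega>. \<omega> \<in> \<Omega> \<Longrightarrow> V (\<theta> \<omega>) (Suc i) = V \<omega> i"
    by (rule swap_class[OF iR(2), of w, folded A_def]) (rule that)
  have finVS: "finite VS" using A by (simp add: VS_def)
  have VS1: "V \<omega> i \<in> VS" if "\<omega> \<in> A" for \<omega> using that by (simp add: VS_def)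
  have VS2: "V \<omega> (Suc i) \<in> VS" if "\<omega> \<in> A" for \<omega>
    using VS1[of "\<theta> \<omega>"] \<theta>(2)[of \<omega>] bij_betwE[OF \<theta>(1)] that A(3) by auto
  have N_sym: "N v u = N u v" for v u
  proof -
    have "N v u = (\<Sum>\<omega>\<in>A. of_bool (V (\<theta> \<omega>) i = v \<and> V (\<theta> \<omega>) (Suc i) = u))"
      unfolding N_def by (rule sum.reindex_bij_betw[OF \<theta>(1), symmetric])
    also have "\<dots> = N u v"
      unfolding N_def using \<theta>(2,3) A(3) by (intro sum.cong) auto
    finally show ?thesis .
  qed
  have N_sum: "(\<Sum>u\<in>VS. N v u) = (\<Sum>\<omega>\<in>A. of_bool (V \<omega> i = v))" for v
  proof -
    have "(\<Sum>u\<in>VS. N v u) = (\<Sum>\<omega>\<in>A. \<Sum>u\<in>VS. of_bool (V \<omega> i = v \<and> V \<omega> (Suc i) = u))"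
      unfolding N_def by (rule sum.swap)
    also have "\<dots> = (\<Sum>\<omega>\<in>A. of_bool (V \<omega> i = v))"
    proof (rule sum.cong[OF refl])
      fix \<omega> assume \<omega>: "\<omega> \<in> A"
      have "(\<Sum>u\<in>VS. of_bool (V \<omega> i = v \<and> V \<omega> (Suc i) = u) :: real) =
        (\<Sum>u\<in>VS. if u = V \<omega> (Suc i) then of_bool (V \<omega> i = v) else 0)"
        by (intro sum.cong) auto
      then show "(\<Sum>u\<in>VS. of_bool (V \<omega> i = v \<and> V \<omega> (Suc i) = u)) = (of_bool (V \<omega> i = v) :: real)"
        using finVS VS2[OF \<omega>] by simp
    qed
    finally show ?thesis .
  qed
  have N_int: "(\<Sum>v\<in>VS. (\<Sum>u\<in>VS. N v u) * f v) = (\<Sum>\<omega>\<in>A. f (V \<omega> i))" for f :: "f2vec \<Rightarrow> real"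
  proof -
    have "(\<Sum>v\<in>VS. (\<Sum>u\<in>VS. N v u) * f v) = (\<Sum>\<omega>\<in>A. \<Sum>v\<in>VS. of_bool (V \<omega> i = v) * f v)"
      unfolding N_sum sum_distrib_right by (rule sum.swap)
    also have "\<dots> = (\<Sum>\<omega>\<in>A. f (V \<omega> i))"
    proof (rule sum.cong[OF refl])
      fix \<omega> assume \<omega>: "\<omega> \<in> A"
      have "(\<Sum>v\<in>VS. of_bool (V \<omega> i = v) * f v) = (\<Sum>v\<in>VS. if v = V \<omega> i then f v else 0)"
        by (intro sum.cong) auto
      then show "(\<Sum>v\<in>VS. of_bool (V \<omega> i = v) * f v) = f (V \<omega> i)" using finVS VS1[OF \<omega>] by simp
    qed
    finally show ?thesis .
  qed
  have N_int2: "(\<Sum>v\<in>VS. \<Sum>u\<in>VS. N v u * g v u) = (\<Sum>\<omega>\<in>A. g (V \<omega> i) (V \<omega> (Suc i)))"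
    for g :: "f2vec \<Rightarrow> f2vec \<Rightarrow> real"
  proof -
    have "(\<Sum>v\<in>VS. \<Sum>u\<in>VS. N v u * g v u) =
      (\<Sum>x\<in>VS \<times> VS. \<Sum>\<omega>\<in>A. of_bool (V \<omega> i = fst x \<and> V \<omega> (Suc i) = snd x) * g (fst x) (snd x))"
      unfolding N_def sum_distrib_right
      using sum.cartesian_product[of "\<lambda>v u. \<Sum>\<omega>\<in>A. of_bool (V \<omega> i = v \<and> V \<omega> (Suc i) = u) * g v u" VS VS]
      by (simp only: split_def)
    also have "\<dots> = (\<Sum>\<omega>\<in>A. \<Sum>x\<in>VS \<times> VS. of_bool (V \<omega> i = fst x \<and> V \<omega> (Suc i) = snd x) * g (fst x) (snd x))"
      by (rule sum.swap)
    also have "\<dots> = (\<Sum>\<omega>\<in>A. g (V \<omega> i) (V \<omega> (Suc i)))"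
    proof (rule sum.cong[OF refl])
      fix \<omega> assume \<omega>: "\<omega> \<in> A"
      have "(\<Sum>x\<in>VS \<times> VS. of_bool (V \<omega> i = fst x \<and> V \<omega> (Suc i) = snd x) * g (fst x) (snd x)) =
        (\<Sum>x\<in>VS \<times> VS. if x = (V \<omega> i, V \<omega> (Suc i)) then g (V \<omega> i) (V \<omega> (Suc i)) else 0)"
        by (intro sum.cong) (auto simp: prod_eq_iff)
      then show "(\<Sum>x\<in>VS \<times> VS. of_bool (V \<omega> i = fst x \<and> V \<omega> (Suc i) = snd x) * g (fst x) (snd x)) =
        g (V \<omega> i) (V \<omega> (Suc i))"
        using finVS VS1[OF \<omega>] VS2[OF \<omega>] by simp
    qed
    finally show ?thesis .
  qed
  have card_sum: "real (card {\<omega>\<in>A. P \<omega>}) = (\<Sum>\<omega>\<in>A. of_bool (P \<omega>))" for P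
    using A(1) by (simp add: of_bool_def sum.If_cases Int_def)
  \<comment> \<open>An unordered pair arises from two orders, whence the factor 2; for
    \<open>v = u\<close> both sides vanish because the vectors of a frame are distinct.\<close>
  have wt: "pmf (link_edge_pmf weight i w) {v, u} = 2 / card A * N v u" for v u
  proof -
    have "pmf (link_edge_pmf weight i w) {v, u} =
        measure (pmf_of_set A) ((\<lambda>\<omega>. {V \<omega> i, V \<omega> (Suc i)}) -` {{v, u}})"
      unfolding link_edge_weight[OF i w] A_def[symmetric] by (simp add: pmf_map)
    also have "\<dots> = real (card {\<omega>\<in>A. {V \<omega> i, V \<omega> (Suc i)} = {v, u}}) / card A"
      using A by (simp add: measure_pmf_of_set vimage_def Int_def)
    also have "real (card {\<omega>\<in>A. {V \<omega> i, V \<omega> (Suc i)} = {v, u}}) =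
      (\<Sum>\<omega>\<in>A. of_bool (V \<omega> i = v \<and> V \<omega> (Suc i) = u) + of_bool (V \<omega> i = u \<and> V \<omega> (Suc i) = v))"
      unfolding card_sum
    proof (rule sum.cong[OF refl])
      fix \<omega> assume "\<omega> \<in> A"
      then have "V \<omega> i \<noteq> V \<omega> (Suc i)" using A(3) iR V_distinct[of \<omega> i "Suc i"] by auto
      then show "of_bool ({V \<omega> i, V \<omega> (Suc i)} = {v, u}) =
         (of_bool (V \<omega> i = v \<and> V \<omega> (Suc i) = u) + of_bool (V \<omega> i = u \<and> V \<omega> (Suc i) = v) :: real)"
        by (auto simp: doubleton_eq_iff)
    qed
    also have "\<dots> = 2 * N v u" unfolding sum.distrib using N_sym[of v u] by (simp add: N_def)
    finally show ?thesis by simp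
  qed
  interpret gap_graph VS "pmf (link_edge_pmf weight i w)" N "2 / card A" lam
  proof
    show "finite VS" by (rule finVS)
    obtain \<omega> where \<omega>: "\<omega> \<in> A" using A by blast
    then have "V \<omega> i \<noteq> V \<omega> (Suc i)" using A(3) iR V_distinct[of \<omega> i "Suc i"] by auto
    then show "\<exists>a\<in>VS. \<exists>b\<in>VS. a \<noteq> b" using VS1[OF \<omega>] VS2[OF \<omega>] by blast
    show "0 < 2 / real (card A)" using A by (simp add: card_gt_0_iff)
    show "pmf (link_edge_pmf weight i w) {v, u} = 2 / real (card A) * N v u" for v u by (rule wt)
    show "N v u = N u v" for v u by (rule N_sym)
    show "lam < 1" by (rule lam)
  next
    fix v assume "v \<in> VS"
    then obtain \<omega> where "\<omega> \<in> A" "V \<omega> i = v" by (auto simp: VS_def)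
    then have "(\<Sum>\<omega>\<in>A. of_bool (V \<omega> i = v)) > (0::real)" using A(1) by (intro sum_pos2[of A \<omega>]) auto
    then show "0 < (\<Sum>u\<in>VS. N v u)" by (simp add: N_sum)
  next
    fix f :: "f2vec \<Rightarrow> real" assume "(\<Sum>v\<in>VS. (\<Sum>u\<in>VS. N v u) * f v) = 0"
    then have "(\<Sum>\<omega>\<in>A. f (V \<omega> i)) = 0" by (simp add: N_int)
    then show "\<bar>\<Sum>v\<in>VS. \<Sum>u\<in>VS. N v u * (f v * f u)\<bar> \<le> lam * (\<Sum>v\<in>VS. (\<Sum>u\<in>VS. N v u) * (f v)\<^sup>2)"
      unfolding N_int N_int2 unfolding A_def by (rule link_gap[OF exp iR(2)])
  qed
  show ?thesis
    using graph_lambda_le link_vertices_eq[OF iR(1) w] by (simp add: link_lambda_def VS_def A_def)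
qed

lemma U_1: "\<omega> \<in> \<Omega> \<Longrightarrow> U 1 \<omega> = {0, V \<omega> 0}"
  by (simp add: U_def ssums_def Pow_insert insert_commute lessThan_Suc)

text \<open>The bound \<open>lam < 1\<close> concerns the system, where it makes the eigenvalue 1
  simple; the target \<open>lam'\<close> may be any larger number.\<close>

lemma parameter_poset_of_frames:
  assumes R: "R > 0" and exp: "expanding lam" and lam: "lam < 1" "lam \<le> lam'"
    and span: "fun_vs.span ((\<lambda>\<omega>. V \<omega> 0) ` \<Omega>) = F2 n"
    and size: "real (card ((\<lambda>\<omega>. V \<omega> 0) ` \<Omega>)) \<le> 2 powr D"
  shows "parameter_poset R n D lam' poset weight"
  unfolding parameter_poset_def
proof (intro conjI)
  show "measured_grassmann_poset R n poset weight" by (rule measured)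
  show "expander_poset R n lam' poset weight"
    unfolding expander_poset_def using link_lambda_le[OF exp lam(1)] lam(2) by (meson order_trans)
  have lev: "level poset 1 = (\<lambda>x. {0, x}) ` (\<lambda>\<omega>. V \<omega> 0) ` \<Omega>"
  proof -
    have "level poset 1 = U 1 ` \<Omega>" using mem_level[of _ 1] R by auto
    also have "\<dots> = (\<lambda>\<omega>. {0, V \<omega> 0}) ` \<Omega>" using U_1 by (intro image_cong) auto
    finally show ?thesis by (simp add: image_image)
  qed
  have "\<Union> (level poset 1) = insert 0 ((\<lambda>\<omega>. V \<omega> 0) ` \<Omega>)" unfolding lev using ne_\<Omega> by auto
  then show "ambient_space poset = F2 n" using span by (simp add: ambient_space_def)
  have "card (level poset 1) \<le> card ((\<lambda>\<omega>. V \<omega> 0) ` \<Omega>)"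
    unfolding lev using fin_\<Omega> by (intro card_image_le) simp
  then show "real (card (level poset 1)) \<le> 2 powr D" using size by linarith
qed

end

lemma good_imp_parameter_poset:
  assumes "good d n lam N" "d > 0" "lam < 1" "lam \<le> lam'" "real N \<le> 2 powr D"
  obtains Y \<mu> where "parameter_poset d n D lam' Y \<mu>"
proof -
  obtain \<Omega> :: "nat set" and V where s: "frame_system \<Omega> V d n" "frame_system.expanding \<Omega> V d lam"
     "fun_vs.span ((\<lambda>\<omega>. V \<omega> 0) ` \<Omega>) = F2 n" "card ((\<lambda>\<omega>. V \<omega> 0) ` \<Omega>) \<le> N"
    using assms(1) unfolding good_def by blast
  have "real (card ((\<lambda>\<omega>. V \<omega> 0) ` \<Omega>)) \<le> 2 powr D" using s(4) assms(5) by linarith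
  then show ?thesis
    using that frame_system.parameter_poset_of_frames[OF s(1) assms(2) s(2) assms(3,4) s(3)] by blast
qed

theorem theorem3p6:
  fixes \<epsilon> lam' :: real and d' :: nat
  assumes "\<epsilon> > 0" and "lam' > 0" and "d' > 0"
  shows "\<exists>(n' :: nat \<Rightarrow> nat) (Y :: nat \<Rightarrow> f2vec set set) (\<mu> :: nat \<Rightarrow> f2vec set pmf).
           infinite (range n') \<and>
           (\<forall>k. parameter_poset d' (n' k) (real (n' k) powr \<epsilon>) lam' (Y k) (\<mu> k))"
proof -
  \<comment> \<open>The cap at \<open>1 / 2\<close> keeps the spectral argument valid when
    \<open>lam'\<close> is 1 or more.\<close>
  define lam where "lam = min lam' (1 / 2)"
  have lam: "lam > 0" "lam < 1" "lam \<le> lam'" using assms(2) by (auto simp: lam_def)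
  \<comment> \<open>The number of steps depends on \<open>\<epsilon>\<close> alone, and the family
    is indexed by the base dimension \<open>m\<close>. With \<open>n = m ^ 2 ^ k\<close> the allowed
    exponent is \<open>m powr (2 ^ k * \<epsilon>)\<close>, superlinear in \<open>m\<close> and thus
    eventually above \<open>C * m\<close>.\<close>
  obtain k :: nat where "1 / \<epsilon> < 2 ^ k" using real_arch_pow[of 2 "1 / \<epsilon>"] by auto
  then have k: "2 ^ k * \<epsilon> > 1" using assms(1) by (simp add: field_simps)
  obtain C m0 where C: "\<forall>m\<ge>m0. good d' (m ^ (2 ^ k)) lam (2 ^ (C * m))"
    using good_family[OF assms(3) lam(1)] by blast
  have "eventually (\<lambda>m::nat. real C * real m \<le> real m powr (2 ^ k * \<epsilon>)) sequentially"
  proof -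
    have "filterlim (\<lambda>m::nat. real m powr (2 ^ k * \<epsilon> - 1)) at_top sequentially"
      using k by (intro filterlim_compose[OF real_powr_at_top filterlim_real_sequentially]) auto
    then have "eventually (\<lambda>m::nat. real C \<le> real m powr (2 ^ k * \<epsilon> - 1)) sequentially"
      by (simp add: filterlim_at_top)
    then show ?thesis using eventually_gt_at_top[of 0]
    proof eventually_elim
      case (elim m)
      have "real C * real m \<le> real m powr (2 ^ k * \<epsilon> - 1) * real m powr 1"
        using elim by (intro mult_mono) auto
      then show ?case using powr_add[of "real m" "2 ^ k * \<epsilon> - 1" 1] by simp
    qed
  qed
  then obtain m1 where m1: "\<And>m. m \<ge> m1 \<Longrightarrow> real C * real m \<le> real m powr (2 ^ k * \<epsilon>)"
    unfolding eventually_sequentially by blast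
  \<comment> \<open>The bases are positive, lie beyond both thresholds and increase strictly with
    \<open>j\<close>, which makes the dimensions pairwise distinct.\<close>
  define n' where "n' j = (Suc (m0 + m1 + j)) ^ (2 ^ k)" for j
  have ex: "\<exists>p. parameter_poset d' (n' j) (real (n' j) powr \<epsilon>) lam' (fst p) (snd p)" for j
  proof -
    define m where "m = Suc (m0 + m1 + j)"
    have "real (2 ^ (C * m)) = 2 powr (real C * real m)" by (simp add: powr_realpow flip: of_nat_mult)
    also have "\<dots> \<le> 2 powr (real m powr (2 ^ k * \<epsilon>))" using m1[of m] by (simp add: m_def)
    also have "real m powr (2 ^ k * \<epsilon>) = real (n' j) powr \<epsilon>"
      by (simp add: n'_def m_def powr_powr flip: powr_realpow)
    finally have size: "real (2 ^ (C * m)) \<le> 2 powr (real (n' j) powr \<epsilon>)" .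
    have "good d' (n' j) lam (2 ^ (C * m))" using C[rule_format, of m] unfolding n'_def m_def[symmetric] by (simp add: m_def)
    then obtain Y \<mu> where "parameter_poset d' (n' j) (real (n' j) powr \<epsilon>) lam' Y \<mu>"
      by (rule good_imp_parameter_poset[OF _ assms(3) lam(2,3) size]) (rule that)
    then show ?thesis by (intro exI[of _ "(Y, \<mu>)"]) simp
  qed
  obtain p where p: "\<And>j. parameter_poset d' (n' j) (real (n' j) powr \<epsilon>) lam' (fst (p j)) (snd (p j))"
    using choice[of "\<lambda>j p. parameter_poset d' (n' j) (real (n' j) powr \<epsilon>) lam' (fst p) (snd p)"] ex by blast
  have "inj n'"
  proof (rule injI)
    fix a b assume "n' a = n' b"
    then show "a = b" unfolding n'_def by (subst (asm) power_eq_iff_eq_base) auto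
  qed
  then have "infinite (range n')" by (rule range_inj_infinite)
  then show ?thesis using p
    by (intro exI[of _ n'] exI[of _ "\<lambda>j. fst (p j)"] exI[of _ "\<lambda>j. snd (p j)"]) simp
qed

end
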